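(* Let $k$ be a field, $A = k[x_1,\ldots,x_n]$ and $\mathfrak{m}_A = (x_1,\ldots,x_n)$. Let $I \subset A$ be a monomial ideal with $I \subseteq \mathfrak{m}_A^2$, let $q > 1$ be an integer, and let $I_q \subset A$ be the monomial ideal with $G(I_q) = \{m^q \mid m \in G(I)\}$. Put $R = A/I$ and $R_q = A/I_q$. Then $P_k^R(z) = P_k^{R_q}(z)$.
   Context: For a monomial ideal $I$ of the polynomial ring $A$, $G(I)$ denotes its unique (finite) minimal set of monomial generators. For a quotient $R = A/I$ of $A$ by a monomial ideal, $k$ is regarded as the $R$-module $A/\mathfrak{m}_A$, and the Poincaré series of $R$ is the power series $$P_k^R(z) = \sum_{i \ge 0} \dim_k\bigl(\operatorname{Tor}_i^R(k,k)\bigr)\, z^i \in \mathbb{Z}[[z]].$$ *)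

theory Defs
  imports
    "HOL-Library.Poly_Mapping"
    "HOL-Computational_Algebra.Formal_Power_Series"
    "HOL-Algebra.Algebra"
    "HOL-Algebra.Algebraic_Closure_Type"
    "Jordan_Normal_Form.Missing_VectorSpace"
begin

section \<open>Tor over a commutative ring\<close>

text \<open>
  A module record extends a ring record; its fields \<open>mult\<close> and \<open>one\<close> play no role for modules and
  are left unspecified below.
\<close>

text \<open>The free module \<open>R\<^sup>(\<^sup>B\<^sup>)\<close>: finitely supported functions from \<open>B\<close> to \<open>R\<close>.\<close>

definition free_mod :: "('r, 'x) ring_scheme \<Rightarrow> 'b set \<Rightarrow> ('r, 'b \<Rightarrow> 'r) module" where
  "free_mod R B =
     \<lparr>carrier = {f. (\<forall>b. f b \<in> carrier R) \<and> finite {b. f b \<noteq> \<zero>\<^bsub>R\<^esub>} \<and> {b. f b \<noteq> \<zero>\<^bsub>R\<^esub>} \<subseteq> B},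
      monoid.mult = undefined, monoid.one = undefined,
      ring.zero = (\<lambda>b. \<zero>\<^bsub>R\<^esub>),
      ring.add = (\<lambda>f g b. f b \<oplus>\<^bsub>R\<^esub> g b),
      module.smult = (\<lambda>r f b. r \<otimes>\<^bsub>R\<^esub> f b)\<rparr>"

text \<open>
  \<open>\<dots> \<rightarrow> R\<^sup>(\<^sup>B\<^sup>2\<^sup>) \<rightarrow> R\<^sup>(\<^sup>B\<^sup>1\<^sup>) \<rightarrow> R\<^sup>(\<^sup>B\<^sup>0\<^sup>) \<rightarrow> M \<rightarrow> 0\<close> is exact, with \<open>d i\<close> the differential from degree \<open>i + 1\<close> to
  degree \<open>i\<close> and \<open>e\<close> the augmentation. The bases are sets of natural numbers; such resolutions exist
  whenever \<open>R\<close> is Noetherian and \<open>M\<close> is countably generated, since then every submodule of a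
  free module of countable rank is countably generated.
\<close>

definition free_resolution ::
  "('r, 'x) ring_scheme \<Rightarrow> ('r, 'm, 'y) module_scheme \<Rightarrow> (nat \<Rightarrow> nat set) \<Rightarrow>
   (nat \<Rightarrow> (nat \<Rightarrow> 'r) \<Rightarrow> (nat \<Rightarrow> 'r)) \<Rightarrow> ((nat \<Rightarrow> 'r) \<Rightarrow> 'm) \<Rightarrow> bool" where
  "free_resolution R M B d e \<longleftrightarrow>
     e \<in> module_hom R (free_mod R (B 0)) M \<and>
     (\<forall>i. d i \<in> module_hom R (free_mod R (B (Suc i))) (free_mod R (B i))) \<and>
     e ` carrier (free_mod R (B 0)) = carrier M \<and>
     d 0 ` carrier (free_mod R (B 1)) = {x \<in> carrier (free_mod R (B 0)). e x = \<zero>\<^bsub>M\<^esub>} \<and>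
     (\<forall>i. d (Suc i) ` carrier (free_mod R (B (Suc (Suc i)))) =
          {x \<in> carrier (free_mod R (B (Suc i))). d i x = \<zero>\<^bsub>free_mod R (B i)\<^esub>})"

text \<open>
  The tensor product is the free abelian group on \<open>M \<times> N\<close> modulo the subgroup generated by the
  bilinearity relations. Operations on cosets are given by applying the operation to all
  representatives and adding the subgroup again.
\<close>

definition tensor_free ::
  "('r, 'm, 'y) module_scheme \<Rightarrow> ('r, 'n, 'z) module_scheme \<Rightarrow> ('m \<times> 'n \<Rightarrow>\<^sub>0 int) monoid" where
  "tensor_free M N = free_Abelian_group (carrier M \<times> carrier N)"

definition tensor_rels ::
  "('r, 'x) ring_scheme \<Rightarrow> ('r, 'm, 'y) module_scheme \<Rightarrow> ('r, 'n, 'z) module_scheme \<Rightarrow>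
   ('m \<times> 'n \<Rightarrow>\<^sub>0 int) set" where
  "tensor_rels R M N = generate (tensor_free M N)
     ({frag_of (x \<oplus>\<^bsub>M\<^esub> x', y) - frag_of (x, y) - frag_of (x', y) | x x' y.
         x \<in> carrier M \<and> x' \<in> carrier M \<and> y \<in> carrier N} \<union>
      {frag_of (x, y \<oplus>\<^bsub>N\<^esub> y') - frag_of (x, y) - frag_of (x, y') | x y y'.
         x \<in> carrier M \<and> y \<in> carrier N \<and> y' \<in> carrier N} \<union>
      {frag_of (r \<odot>\<^bsub>M\<^esub> x, y) - frag_of (x, r \<odot>\<^bsub>N\<^esub> y) | r x y.
         r \<in> carrier R \<and> x \<in> carrier M \<and> y \<in> carrier N})"

definition tensor_product ::
  "('r, 'x) ring_scheme \<Rightarrow> ('r, 'm, 'y) module_scheme \<Rightarrow> ('r, 'n, 'z) module_scheme \<Rightarrow>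
   ('r, ('m \<times> 'n \<Rightarrow>\<^sub>0 int) set) module" where
  "tensor_product R M N =
     \<lparr>carrier = carrier (tensor_free M N Mod tensor_rels R M N),
      monoid.mult = undefined, monoid.one = undefined,
      ring.zero = \<one>\<^bsub>tensor_free M N Mod tensor_rels R M N\<^esub>,
      ring.add = monoid.mult (tensor_free M N Mod tensor_rels R M N),
      module.smult = (\<lambda>r Y. set_mult (tensor_free M N) (tensor_rels R M N)
                      (frag_extend (\<lambda>(x, y). frag_of (r \<odot>\<^bsub>M\<^esub> x, y)) ` Y))\<rparr>"

text \<open>The map \<open>f \<otimes> id\<close> from \<open>M \<otimes> N\<close> to \<open>M' \<otimes> N\<close> induced by \<open>f\<close> from \<open>M\<close> to \<open>M'\<close>.\<close>

definition tensor_map ::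
  "('r, 'x) ring_scheme \<Rightarrow> ('r, 'm, 'y) module_scheme \<Rightarrow> ('r, 'n, 'z) module_scheme \<Rightarrow>
   ('l \<Rightarrow> 'm) \<Rightarrow> ('l \<times> 'n \<Rightarrow>\<^sub>0 int) set \<Rightarrow> ('m \<times> 'n \<Rightarrow>\<^sub>0 int) set" where
  "tensor_map R M' N f Y =
     set_mult (tensor_free M' N) (tensor_rels R M' N)
       (frag_extend (\<lambda>(x, y). frag_of (f x, y)) ` Y)"

definition quotient_module ::
  "('r, 'm, 'y) module_scheme \<Rightarrow> 'm set \<Rightarrow> ('r, 'm set) module" where
  "quotient_module M S =
     \<lparr>carrier = a_rcosets\<^bsub>M\<^esub> S,
      monoid.mult = undefined, monoid.one = undefined,
      ring.zero = S,
      ring.add = set_add M,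
      module.smult = (\<lambda>r Y. set_add M S ((\<lambda>x. r \<odot>\<^bsub>M\<^esub> x) ` Y))\<rparr>"

text \<open>
  Homology in degree \<open>i\<close> of a complex \<open>\<dots> \<rightarrow> C 1 \<rightarrow> C 0 \<rightarrow> 0\<close>, with \<open>d i\<close> from \<open>C (i + 1)\<close> to \<open>C i\<close>.
\<close>

fun chain_cycles :: "(nat \<Rightarrow> ('r, 'm, 'y) module_scheme) \<Rightarrow> (nat \<Rightarrow> 'm \<Rightarrow> 'm) \<Rightarrow> nat \<Rightarrow> 'm set" where
  "chain_cycles C d 0 = carrier (C 0)"
| "chain_cycles C d (Suc i) = {x \<in> carrier (C (Suc i)). d i x = \<zero>\<^bsub>C i\<^esub>}"

definition homology ::
  "(nat \<Rightarrow> ('r, 'm, 'y) module_scheme) \<Rightarrow> (nat \<Rightarrow> 'm \<Rightarrow> 'm) \<Rightarrow> nat \<Rightarrow> ('r, 'm set) module" where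
  "homology C d i =
     quotient_module ((C i)\<lparr>carrier := chain_cycles C d i\<rparr>) (d i ` carrier (C (Suc i)))"

definition Tor ::
  "('r, 'x) ring_scheme \<Rightarrow> ('r, 'm, 'y) module_scheme \<Rightarrow> ('r, 'n, 'z) module_scheme \<Rightarrow> nat \<Rightarrow>
   ('r, ((nat \<Rightarrow> 'r) \<times> 'n \<Rightarrow>\<^sub>0 int) set set) module" where
  "Tor R M N i =
     (case (SOME (B, d, e). free_resolution R M B d e) of (B, d, e) \<Rightarrow>
        homology (\<lambda>j. tensor_product R (free_mod R (B j)) N)
                 (\<lambda>j. tensor_map R (free_mod R (B j)) N (d j)) i)"

definition restrict_scalars ::
  "('s \<Rightarrow> 'r) \<Rightarrow> ('r, 'm, 'y) module_scheme \<Rightarrow> ('s, 'm) module" where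
  "restrict_scalars h M =
     \<lparr>carrier = carrier M, monoid.mult = monoid.mult M, monoid.one = monoid.one M,
      ring.zero = ring.zero M, ring.add = ring.add M,
      module.smult = (\<lambda>s x. h s \<odot>\<^bsub>M\<^esub> x)\<rparr>"


section \<open>Monomial ideals and Poincare series\<close>

text \<open>
  The polynomial ring in the variables \<open>x\<^sub>v\<close>, where \<open>v\<close> ranges over the finite type \<open>'v\<close>: a monomial is
  its exponent vector in \<open>'v \<Rightarrow>\<^sub>0 nat\<close>, and multiplication on \<open>\<Rightarrow>\<^sub>0\<close> is convolution.
\<close>

type_synonym ('v, 'k) mpoly = "('v \<Rightarrow>\<^sub>0 nat) \<Rightarrow>\<^sub>0 'k"

definition mpoly_ring :: "('v::finite, 'k::field) mpoly ring" where
  "mpoly_ring = ring_of_type_algebra"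

definition monomial :: "('v::finite \<Rightarrow>\<^sub>0 nat) \<Rightarrow> ('v, 'k::field) mpoly" where
  "monomial a = Poly_Mapping.single a 1"

definition mvar :: "'v::finite \<Rightarrow> ('v, 'k::field) mpoly" where
  "mvar v = monomial (Poly_Mapping.single v 1)"

definition mconst :: "'k::field \<Rightarrow> ('v::finite, 'k) mpoly" where
  "mconst c = Poly_Mapping.single 0 c"

definition max_ideal :: "('v::finite, 'k::field) mpoly set" where
  "max_ideal = Idl\<^bsub>mpoly_ring\<^esub> (range mvar)"

definition monomial_ideal :: "('v::finite, 'k::field) mpoly set \<Rightarrow> bool" where
  "monomial_ideal I \<longleftrightarrow> (\<exists>S \<subseteq> range monomial. I = Idl\<^bsub>mpoly_ring\<^esub> S)"

definition min_gens :: "('v::finite, 'k::field) mpoly set \<Rightarrow> ('v, 'k) mpoly set" where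
  "min_gens I = (THE G. G \<subseteq> range monomial \<and> Idl\<^bsub>mpoly_ring\<^esub> G = I \<and>
                        (\<forall>H. H \<subset> G \<longrightarrow> Idl\<^bsub>mpoly_ring\<^esub> H \<noteq> I))"

text \<open>
  The residue field \<open>k = A/\<mm>\<close> as a module over \<open>A/I\<close>, for \<open>I \<subseteq> \<mm>\<close>: the product of the cosets of \<open>a\<close>
  modulo \<open>I\<close> and of \<open>b\<close> modulo \<open>\<mm>\<close> is the coset of \<open>a b\<close> modulo \<open>\<mm>\<close>. The record itself does not depend
  on \<open>I\<close>.
\<close>

definition residue_module :: "(('v::finite, 'k::field) mpoly set, ('v, 'k) mpoly set) module" where
  "residue_module =
     \<lparr>carrier = carrier (mpoly_ring Quot max_ideal),
      monoid.mult = undefined, monoid.one = undefined,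
      ring.zero = \<zero>\<^bsub>mpoly_ring Quot max_ideal\<^esub>,
      ring.add = ring.add (mpoly_ring Quot max_ideal),
      module.smult = rcoset_mult mpoly_ring max_ideal\<rparr>"

definition poincare_series :: "('v::finite, 'k::field) mpoly set \<Rightarrow> int fps" where
  "poincare_series I = Abs_fps (\<lambda>i.
     int (vectorspace.dim (ring_of_type_algebra :: 'k ring)
       (restrict_scalars (\<lambda>c. I +>\<^bsub>mpoly_ring\<^esub> mconst c)
         (Tor (mpoly_ring Quot I) residue_module residue_module i))))"

end

theory Submission
  imports Defs
begin

text \<open>
  Let \<open>T\<close> be the free \<open>A\<close>-module on all lists of generators of \<open>I\<close>, where a list has the multidegree of
  its least common multiple and the differential deletes entries. Like the Taylor complex it resolves
  \<open>R\<close>, but concatenation of lists makes it an associative differential graded algebra. In the same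
  way lists of variables give a resolution \<open>K\<close> of \<open>k\<close>, and replacing each generator by its least
  variable makes \<open>K\<close> a module over \<open>T\<close>. Then \<open>R\<close> tensored with the bar construction of \<open>T\<close> with
  coefficients in \<open>K\<close> is a free resolution of \<open>k\<close> over \<open>R\<close>. After tensoring with \<open>k\<close> only the terms
  of the differential that preserve the multidegree survive. As the generators have degree at least 2,
  \<open>T\<close> acts trivially on \<open>k \<otimes> K\<close> in positive degrees, and the surviving terms depend only on which least common
  multiples of generators coincide. Replacing every generator by its \<open>q\<close>-th power does not change this.
\<close>

subsection \<open>Linear maps on finitely supported functions\<close>

text \<open>A word of multidegree \<beta> occurs in the strand of multidegree \<alpha> exactly when
  \<beta> \<le> \<alpha>, and then once, with the monomial of exponent \<alpha> - \<beta> as its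
  coefficient. A strand is thus spanned over k by words, and the differential has coefficients that
  depend neither on \<alpha> nor on the scaling. So all variables are set to 1 and the complexes are
  studied as formal combinations of words; the factor \<open>c\<close> in the degrees (1 for I, q
  for \<open>I_q\<close>) enters only through inequalities. Exactness has two sources. With T as its
  first factor, the bar construction contracts to K; the differential on bars is defined by solving
  the homotopy identity, which replaces sign computations and makes its square vanish by induction.
  Passing from T to R divides by a kernel that is acyclic in each strand, since a generator dividing
  the available monomial can be prepended. Tor is defined from an arbitrarily chosen resolution, so
  resolutions must also be compared. This is done on elements of free modules taken modulo the
  maximal ideal, away from the tensor cosets.\<close>

abbreviation "lookup \<equiv> Poly_Mapping.lookup"
abbreviation "keys \<equiv> Poly_Mapping.keys"

definition scl :: "'k::comm_ring_1 \<Rightarrow> ('a \<Rightarrow>\<^sub>0 'k) \<Rightarrow> 'a \<Rightarrow>\<^sub>0 'k" where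
  "scl c p = Poly_Mapping.map ((*) c) p"

lemma lookup_scl [simp]: "lookup (scl c p) a = c * lookup p a"
  unfolding scl_def by (simp add: map.rep_eq when_def)

lemma scl_simps [simp]:
  "scl 0 p = 0" "scl 1 p = p" "scl c 0 = 0" "scl c (scl d p) = scl (c * d) p"
  "scl c (Poly_Mapping.single a d) = Poly_Mapping.single a (c * d)"
  by (auto intro!: poly_mapping_eqI simp: lookup_single when_def mult.assoc)

lemma scl_distribs:
  "scl c (p + r) = scl c p + scl c r" "scl c (p - r) = scl c p - scl c r" "scl (c + d) p = scl c p + scl d p"
  by (auto intro!: poly_mapping_eqI simp: lookup_add lookup_minus algebra_simps)

lemma keys_scl: "keys (scl c p) \<subseteq> keys p"
  by (auto simp: in_keys_iff)

lemma scl_sum: "scl c (sum f A) = (\<Sum>a\<in>A. scl c (f a))"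
  by (auto intro!: poly_mapping_eqI simp: lookup_sum sum_distrib_left)

definition lext :: "('a \<Rightarrow> 'b \<Rightarrow>\<^sub>0 'k::comm_ring_1) \<Rightarrow> ('a \<Rightarrow>\<^sub>0 'k) \<Rightarrow> 'b \<Rightarrow>\<^sub>0 'k" where
  "lext \<phi> z = (\<Sum>a\<in>keys z. scl (lookup z a) (\<phi> a))"

lemma lext_superset:
  assumes "finite S" "keys z \<subseteq> S"
  shows "lext \<phi> z = (\<Sum>a\<in>S. scl (lookup z a) (\<phi> a))"
  unfolding lext_def using assms
  by (intro sum.mono_neutral_left) (auto simp: in_keys_iff)

definition lin :: "(('a \<Rightarrow>\<^sub>0 'k::comm_ring_1) \<Rightarrow> 'b \<Rightarrow>\<^sub>0 'k) \<Rightarrow> bool" where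
  "lin F \<longleftrightarrow> (\<forall>x y. F (x + y) = F x + F y) \<and> (\<forall>c x. F (scl c x) = scl c (F x))"

lemma lin_lext:
  fixes \<phi> :: "'a \<Rightarrow> 'b \<Rightarrow>\<^sub>0 'k::comm_ring_1"
  shows "lin (lext \<phi>)"
  unfolding lin_def
proof (intro conjI allI)
  fix x y :: "'a \<Rightarrow>\<^sub>0 'k" and c
  let ?S = "keys x \<union> keys y"
  have "keys (x + y) \<subseteq> ?S" by (rule keys_add)
  then show "lext \<phi> (x + y) = lext \<phi> x + lext \<phi> y"
    by (simp add: lext_superset[of ?S] lookup_add scl_distribs sum.distrib)
  show "lext \<phi> (scl c x) = scl c (lext \<phi> x)"
    by (simp add: lext_superset[of "keys x"] keys_scl scl_sum)
qed

lemma linD: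
  assumes "lin F"
  shows "F (x + y) = F x + F y" "F (scl c x) = scl c (F x)" "F 0 = 0" "F (x - y) = F x - F y"
    "F (sum f A) = (\<Sum>a\<in>A. F (f a))"
proof -
  show a: "F (x + y) = F x + F y" for x y using assms by (simp add: lin_def)
  show s: "F (scl c x) = scl c (F x)" for c x using assms by (simp add: lin_def)
  show z: "F 0 = 0" using s[of 0 0] by simp
  show "F (x - y) = F x - F y" using a[of "x - y" y] by simp
  show "F (sum f A) = (\<Sum>a\<in>A. F (f a))"
    by (induction A rule: infinite_finite_induct) (auto simp: a z)
qed

lemmas lext_linear = linD[OF lin_lext]

lemma lext_single [simp]: "lext \<phi> (Poly_Mapping.single a c) = scl c (\<phi> a)"
  by (cases "c = 0") (auto simp: lext_def)

lemma expand_single: "z = (\<Sum>a\<in>keys z. scl (lookup z a) (Poly_Mapping.single a 1))"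
proof (rule poly_mapping_eqI)
  fix k
  have "(\<Sum>a\<in>keys z. lookup z a when a = k) = (\<Sum>a\<in>keys z. if a = k then lookup z k else 0)"
    by (rule sum.cong) (auto simp: when_def)
  then show "lookup z k = lookup (\<Sum>a\<in>keys z. scl (lookup z a) (Poly_Mapping.single a 1)) k"
    by (simp add: lookup_sum lookup_single in_keys_iff mult_when)
qed

lemma lin_expand: "lin F \<Longrightarrow> F z = lext (\<lambda>a. F (Poly_Mapping.single a 1)) z"
  by (subst expand_single[of z]) (simp add: linD lext_def del: scl_simps)

lemma lext_cong: "(\<And>a. a \<in> keys z \<Longrightarrow> \<phi> a = \<chi> a) \<Longrightarrow> lext \<phi> z = lext \<chi> z"
  by (simp add: lext_def)

text \<open>Linearity reduces an identity between operators to single words. Testing only the words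
  in \<open>keys z\<close> admits identities that hold on well-formed words alone.\<close>

lemma lin_ext:
  assumes "lin F" "lin H" "\<And>a. a \<in> keys z \<Longrightarrow> F (Poly_Mapping.single a 1) = H (Poly_Mapping.single a 1)"
  shows "F z = H z"
proof -
  have "F z = lext (\<lambda>a. F (Poly_Mapping.single a 1)) z" by (rule lin_expand[OF assms(1)])
  also have "\<dots> = lext (\<lambda>a. H (Poly_Mapping.single a 1)) z" by (rule lext_cong) (rule assms(3))
  also have "\<dots> = H z" by (rule lin_expand[OF assms(2), symmetric])
  finally show ?thesis .
qed

lemma lin_intros:
  "lin (\<lambda>x. x)" "lin (\<lambda>x. 0)"
  "lin F \<Longrightarrow> lin H \<Longrightarrow> lin (\<lambda>x. F x + H x)"
  "lin F \<Longrightarrow> lin H \<Longrightarrow> lin (\<lambda>x. F x - H x)"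
  "lin F \<Longrightarrow> lin (\<lambda>x. scl c (F x))"
  "lin F \<Longrightarrow> lin (\<lambda>x. lext \<phi> (F x))"
  by (auto simp: lin_def scl_distribs lext_linear algebra_simps)

lemma keys_lext: "keys (lext \<phi> z) \<subseteq> (\<Union>a\<in>keys z. keys (\<phi> a))"
proof
  fix b assume "b \<in> keys (lext \<phi> z)"
  then have "(\<Sum>a\<in>keys z. lookup z a * lookup (\<phi> a) b) \<noteq> 0"
    by (simp add: in_keys_iff lext_def lookup_sum)
  then obtain a where "a \<in> keys z" "lookup z a * lookup (\<phi> a) b \<noteq> 0"
    by (meson sum.neutral)
  then have "b \<in> keys (\<phi> a)" by (auto simp: in_keys_iff)
  with \<open>a \<in> keys z\<close> show "b \<in> (\<Union>a\<in>keys z. keys (\<phi> a))" by blast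
qed

lemma keys_lextE:
  assumes "b \<in> keys (lext \<phi> z)"
  obtains a where "a \<in> keys z" "b \<in> keys (\<phi> a)"
  using assms keys_lext by fast

lemma lookup_lext: "lookup (lext \<phi> z) b = (\<Sum>a\<in>keys z. lookup z a * lookup (\<phi> a) b)"
  by (simp add: lext_def lookup_sum)

lemma keys_diffE:
  fixes x y :: "'a \<Rightarrow>\<^sub>0 'k::ab_group_add"
  assumes "b \<in> keys (x - y)"
  obtains "b \<in> keys x" | "b \<in> keys y"
  using assms by (cases "b \<in> keys x"; cases "b \<in> keys y") (auto simp: in_keys_iff lookup_minus)

lemma keys_addE:
  fixes x y :: "'a \<Rightarrow>\<^sub>0 'k::ab_group_add"
  assumes "b \<in> keys (x + y)"
  obtains "b \<in> keys x" | "b \<in> keys y"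
  using assms by (cases "b \<in> keys x"; cases "b \<in> keys y") (auto simp: in_keys_iff lookup_add)

definition pmap :: "('a \<Rightarrow> 'b) \<Rightarrow> ('a \<Rightarrow>\<^sub>0 'k::comm_ring_1) \<Rightarrow> 'b \<Rightarrow>\<^sub>0 'k" where
  "pmap f = lext (\<lambda>a. Poly_Mapping.single (f a) 1)"

lemma pmap_single [simp]: "pmap f (Poly_Mapping.single a c) = Poly_Mapping.single (f a) c"
  by (simp add: pmap_def)

lemma lin_pmap: "lin F \<Longrightarrow> lin (\<lambda>x. pmap f (F x))"
  by (simp add: pmap_def lin_intros)

lemma keys_pmap: "keys (pmap f z) \<subseteq> f ` keys z"
  using keys_lext[of "\<lambda>a. Poly_Mapping.single (f a) 1" z] by (auto simp: pmap_def split: if_splits)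

lemmas pmap_linear = linD[OF lin_pmap[OF lin_intros(1)]]
lemmas lins = lin_intros lin_pmap

subsection \<open>The bar construction on words\<close>

type_synonym 'v gens = "('v \<Rightarrow> nat) list"
type_synonym 'v qword = "'v gens list \<times> 'v list"
type_synonym 'v xword = "'v gens \<times> 'v qword"

text \<open>A variable dividing each generator must be chosen consistently. For xy, yz, zx the
  choices x, y, z have product xyz, which is also the least common multiple, and the degree would
  not drop when T acts on K. Taking the least variable in a fixed order excludes such cyclic
  choices.\<close>

definition lvar :: "('v::finite \<Rightarrow> nat) \<Rightarrow> 'v" where
  "lvar m = (ARG_MIN to_nat v. 0 < m v)"

lemma lvar:
  assumes "0 < m v"
  shows "0 < m (lvar m)" "to_nat (lvar m) \<le> to_nat v"
  using arg_min_nat_lemma[of "\<lambda>v. 0 < m v" v to_nat] assms by (auto simp: lvar_def)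

text \<open>The differential of K with all variables set to 1; the recursion is the Leibniz rule for
  a prepended variable.\<close>

fun dK :: "'v list \<Rightarrow> 'v list \<Rightarrow>\<^sub>0 'k::comm_ring_1" where
  "dK [] = 0"
| "dK (v # \<kappa>) = Poly_Mapping.single \<kappa> 1 - pmap (Cons v) (dK \<kappa>)"

definition addl :: "('v \<Rightarrow> nat) \<Rightarrow> 'v xword \<Rightarrow> 'v xword" where
  "addl m = (\<lambda>(t, q). (m # t, q))"

definition addv :: "'v \<Rightarrow> 'v xword \<Rightarrow> 'v xword" where
  "addv v = (\<lambda>(t, ts, \<kappa>). (t, ts, v # \<kappa>))"

definition kword :: "'v list \<Rightarrow> 'v xword" where
  "kword \<kappa> = ([], [], \<kappa>)"

text \<open>The Leibniz rule for \<open>t\<close> times \<open>q\<close>, where \<open>y\<close>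
  stands for the differential of \<open>q\<close> with empty first factor. Having \<open>y\<close>
  as an argument lets \<open>dB\<close> be defined by structural recursion.\<close>

fun dext :: "'v gens \<Rightarrow> 'v qword \<Rightarrow> ('v xword \<Rightarrow>\<^sub>0 'k::comm_ring_1) \<Rightarrow> 'v xword \<Rightarrow>\<^sub>0 'k" where
  "dext [] q y = y"
| "dext (m # t) q y = Poly_Mapping.single (t, q) 1 - pmap (addl m) (dext t q y)"

text \<open>The extra degeneracy of the bar construction: the first factor becomes a new bar. The
  empty list, the unit of T, goes to 0, so the bar construction is the normalized one.\<close>

definition sX :: "('v::finite xword \<Rightarrow>\<^sub>0 'k::comm_ring_1) \<Rightarrow> 'v xword \<Rightarrow>\<^sub>0 'k" where
  "sX = lext (\<lambda>(t, ts, \<kappa>). if t = [] then 0 else Poly_Mapping.single ([], t # ts, \<kappa>) 1)"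

text \<open>The augmentation to K followed by the inclusion of K. Without bars, \<open>t\<close>
  acts on \<open>\<kappa>\<close> by prepending the least variables of its generators; words with
  bars vanish.\<close>

definition iX :: "('v::finite xword \<Rightarrow>\<^sub>0 'k::comm_ring_1) \<Rightarrow> 'v xword \<Rightarrow>\<^sub>0 'k" where
  "iX = lext (\<lambda>(t, ts, \<kappa>). if ts = [] then Poly_Mapping.single (kword (map lvar t @ \<kappa>)) 1 else 0)"

text \<open>The second equation is the identity \<open>dX (sX x) + sX (dX x) = x - iX x\<close>
  solved for its first term, with \<open>x\<close> the word whose image under \<open>sX\<close> has
  \<open>t\<close> as first bar. Unfolded, it is the usual bar differential: open the first bar, act
  on K, differentiate inside bars, concatenate adjacent bars.\<close>

fun dB :: "'v::finite gens list \<Rightarrow> 'v list \<Rightarrow> 'v xword \<Rightarrow>\<^sub>0 'k::comm_ring_1" where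
  "dB [] \<kappa> = pmap kword (dK \<kappa>)"
| "dB (t # ts) \<kappa> = Poly_Mapping.single (t, ts, \<kappa>) 1 - iX (Poly_Mapping.single (t, ts, \<kappa>) 1)
     - sX (dext t (ts, \<kappa>) (dB ts \<kappa>))"

definition dXb :: "'v::finite xword \<Rightarrow> 'v xword \<Rightarrow>\<^sub>0 'k::comm_ring_1" where
  "dXb = (\<lambda>(t, q). dext t q (dB (fst q) (snd q)))"

definition dX :: "('v::finite xword \<Rightarrow>\<^sub>0 'k::comm_ring_1) \<Rightarrow> 'v xword \<Rightarrow>\<^sub>0 'k" where
  "dX = lext dXb"

lemma lin_ops: "lin F \<Longrightarrow> lin (\<lambda>x. sX (F x))" "lin F \<Longrightarrow> lin (\<lambda>x. iX (F x))" "lin F \<Longrightarrow> lin (\<lambda>x. dX (F x))"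
  by (simp_all add: sX_def iX_def dX_def lins)

lemma lin_pmap': "lin (pmap f)" "lin sX" "lin iX" "lin dX"
  by (simp_all add: pmap_def sX_def iX_def dX_def lin_lext)

lemmas opl = lins lin_ops lin_pmap'
lemmas sX_linear = linD[OF lin_ops(1)[OF lins(1)]]
lemmas iX_linear = linD[OF lin_ops(2)[OF lins(1)]]
lemmas dX_linear = linD[OF lin_ops(3)[OF lins(1)]]

lemma dX_single: "dX (Poly_Mapping.single (t, q) c) = scl c (dXb (t, q))"
  by (simp add: dX_def)

lemma dXb_Cons: "dXb (m # t, q) = Poly_Mapping.single (t, q) 1 - pmap (addl m) (dXb (t, q))"
  by (simp add: dXb_def)

lemma dXb_Nil: "dXb ([], ts, \<kappa>) = dB ts \<kappa>"
  by (simp add: dXb_def)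

lemma sX_single [simp]:
  "sX (Poly_Mapping.single (t, ts, \<kappa>) c) = (if t = [] then 0 else Poly_Mapping.single ([], t # ts, \<kappa>) c)"
  by (simp add: sX_def)

lemma iX_single [simp]:
  "iX (Poly_Mapping.single (t, ts, \<kappa>) c) =
    (if ts = [] then Poly_Mapping.single (kword (map lvar t @ \<kappa>)) c else 0)"
  by (simp add: iX_def)

text \<open>With the variables set to 1, prepending any generator is a contracting homotopy. In a
  fixed strand the only obstruction is whether the longer word still fits below the degree of the
  strand.\<close>

lemma dX_addl: "dX (pmap (addl m) x) = x - pmap (addl m) (dX x)"
proof (rule lin_ext[of "\<lambda>x. dX (pmap (addl m) x)" "\<lambda>x. x - pmap (addl m) (dX x)"])
  fix a :: "'a xword"
  obtain t q where "a = (t, q)" by (cases a)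
  then show "dX (pmap (addl m) (Poly_Mapping.single a 1)) =
        Poly_Mapping.single a 1 - pmap (addl m) (dX (Poly_Mapping.single a 1))"
    by (simp add: dX_single addl_def dXb_Cons)
qed (simp_all add: opl)

lemma dX_kword: "dX (pmap kword x) = pmap kword (lext dK x)"
  by (rule lin_ext[of "\<lambda>x. dX (pmap kword x)" "\<lambda>x. pmap kword (lext dK x)"], (intro opl)[1], (intro opl)[1])
    (simp add: kword_def dX_single dXb_Nil)

lemma sX_kword: "sX (pmap kword x) = 0"
  by (rule lin_ext[of "\<lambda>x. sX (pmap kword x)" "\<lambda>x. 0"], (intro opl)[1], (intro opl)[1])
    (simp add: kword_def)

lemma iX_kword: "iX (pmap kword x) = pmap kword x"
  by (rule lin_ext[of "\<lambda>x. iX (pmap kword x)" "pmap kword"], (intro opl)[1], (intro opl)[1])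
    (simp add: kword_def)

lemma iX_factor: "\<exists>y. iX x = pmap kword y"
proof -
  have "iX x = pmap kword (lext (\<lambda>(t, ts, \<kappa>). if ts = [] then Poly_Mapping.single (map lvar t @ \<kappa>) 1 else 0) x)"
    by (rule lin_ext[of iX "\<lambda>x. pmap kword (lext _ x)"]) (auto simp: opl pmap_linear lin_lext)
  then show ?thesis ..
qed

lemma iX_iX: "iX (iX x) = iX x" and sX_iX: "sX (iX x) = 0"
  using iX_factor[of x] iX_kword sX_kword by metis+

lemma iX_sX: "iX (sX x) = 0"
  by (rule lin_ext[of "\<lambda>x. iX (sX x)" "\<lambda>x. 0"], (intro opl)[1], (intro opl)[1])
    (auto simp: iX_linear)

lemma sX_sX: "sX (sX x) = 0"
  by (rule lin_ext[of "\<lambda>x. sX (sX x)" "\<lambda>x. 0"], (intro opl)[1], (intro opl)[1])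
    (auto simp: sX_linear)

lemma iX_addl: "iX (pmap (addl m) x) = pmap (addv (lvar m)) (iX x)"
  by (rule lin_ext[of "\<lambda>x. iX (pmap (addl m) x)" "\<lambda>x. pmap (addv (lvar m)) (iX x)"],
      (intro opl)[1], (intro opl)[1])
    (auto simp: addl_def addv_def kword_def pmap_linear)

lemma addv_kword: "pmap (addv v) (pmap kword x) = pmap kword (pmap (Cons v) x)"
  by (rule lin_ext[of "\<lambda>x. pmap (addv v) (pmap kword x)" "\<lambda>x. pmap kword (pmap (Cons v) x)"],
      (intro opl)[1], (intro opl)[1])
    (simp add: addv_def kword_def)

text \<open>Replacing generators by their least variables turns deletion of generators into deletion
  of variables, with the same signs.\<close>

lemma iX_dXb_K: "iX (dXb (t, [], \<kappa>)) = pmap kword (dK (map lvar t @ \<kappa>))"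
proof (induction t)
  case Nil
  then show ?case by (simp add: dXb_Nil iX_kword)
next
  case (Cons m t)
  then show ?case
    by (simp add: dXb_Cons iX_linear iX_addl pmap_linear addv_kword)
qed

lemma iX_dXb_B: "ts \<noteq> [] \<Longrightarrow> iX (dXb (t, ts, \<kappa>)) = 0"
proof (induction t)
  case Nil
  then obtain t' ts' where "ts = t' # ts'" by (cases ts) auto
  then show ?case by (simp add: dXb_Nil iX_linear iX_iX iX_sX del: iX_single)
next
  case (Cons m t)
  then show ?case
    by (simp add: dXb_Cons iX_linear iX_addl pmap_linear)
qed

text \<open>On words without bars this says that T acts on K compatibly with the differentials; on
  words with bars both sides vanish, by the way \<open>dB\<close> is defined.\<close>

lemma iX_dX: "iX (dX x) = dX (iX x)"
proof (rule lin_ext[of "\<lambda>x. iX (dX x)" "\<lambda>x. dX (iX x)"])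
  fix a :: "'a xword"
  obtain t ts \<kappa> where a: "a = (t, ts, \<kappa>)" by (cases a) auto
  show "iX (dX (Poly_Mapping.single a 1)) = dX (iX (Poly_Mapping.single a 1))"
  proof (cases "ts = []")
    case True
    then show ?thesis
      by (simp add: a dX_single iX_dXb_K) (simp add: kword_def dX_single dXb_Nil)
  next
    case False
    then show ?thesis
      by (simp add: a dX_single iX_dXb_B dX_linear)
  qed
qed (simp_all add: opl)

lemma dK_dK: "lext dK (dK \<kappa>) = 0"
proof (induction \<kappa>)
  case (Cons v \<kappa>)
  have *: "lext dK (pmap (Cons v) x) = x - pmap (Cons v) (lext dK x)" for x :: "_ \<Rightarrow>\<^sub>0 'b"
    by (rule lin_ext[of "\<lambda>x. lext dK (pmap (Cons v) x)" "\<lambda>x. x - pmap (Cons v) (lext dK x)"]) (auto simp: opl)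
  show ?case by (simp add: lext_linear * Cons pmap_linear)
qed (simp add: lext_linear)

section \<open>Well-formed words, their multidegrees and homological degrees\<close>

text \<open>Bars are nonempty because the bar construction is normalized: \<open>sX\<close> never
  creates an empty one.\<close>

definition wfQ :: "('v \<Rightarrow> nat) set \<Rightarrow> 'v qword \<Rightarrow> bool" where
  "wfQ G q \<longleftrightarrow> (\<forall>t\<in>set (fst q). t \<noteq> [] \<and> set t \<subseteq> G)"

definition wfX :: "('v \<Rightarrow> nat) set \<Rightarrow> 'v xword \<Rightarrow> bool" where
  "wfX G x \<longleftrightarrow> set (fst x) \<subseteq> G \<and> wfQ G (snd x)"

definition lcmx :: "'v gens \<Rightarrow> 'v \<Rightarrow> nat" where
  "lcmx t v = fold max (map (\<lambda>m. m v) t) 0"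

lemma lcmx_Nil [simp]: "lcmx [] v = 0"
  by (simp add: lcmx_def)

lemma lcmx_Max: "lcmx t v = Max (insert 0 ((\<lambda>m. m v) ` set t))"
  by (simp add: lcmx_def flip: Max.set_eq_fold)

lemma lcmx_Cons [simp]: "lcmx (m # t) v = max (m v) (lcmx t v)"
  by (simp add: lcmx_Max insert_commute[of 0])

lemma lcmx_append [simp]: "lcmx (t @ t') v = max (lcmx t v) (lcmx t' v)"
  by (induction t) (auto simp: max.assoc)

lemma lcmx_ge: "m \<in> set t \<Longrightarrow> m v \<le> lcmx t v"
  by (simp add: lcmx_Max)

definition lq :: "'v gens list \<Rightarrow> 'v \<Rightarrow> nat" where
  "lq ts v = (\<Sum>t\<leftarrow>ts. lcmx t v)"

lemma lq_simps [simp]: "lq [] v = 0" "lq (t # ts) v = lcmx t v + lq ts v"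
  by (simp_all add: lq_def)

text \<open>The exponent vector of the least common multiple of the variables in
  \<open>\<kappa>\<close>, so a repeated variable counts once.\<close>

definition ind :: "'v list \<Rightarrow> 'v \<Rightarrow> nat" where
  "ind \<kappa> v = (if v \<in> set \<kappa> then 1 else 0)"

text \<open>Only generators are scaled by \<open>c\<close>, not the variables of K. For this reason
  it is not evident that preservation of degrees is independent of \<open>c\<close>: a generator
  that is a single variable could be traded for a variable of K without change of degree when
  \<open>c = 1\<close>, but not when \<open>c > 1\<close>.\<close>

definition qdeg :: "nat \<Rightarrow> 'v qword \<Rightarrow> 'v \<Rightarrow> nat" where
  "qdeg c q v = c * lq (fst q) v + ind (snd q) v"

definition xdeg :: "nat \<Rightarrow> 'v xword \<Rightarrow> 'v \<Rightarrow> nat" where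
  "xdeg c x v = c * lcmx (fst x) v + qdeg c (snd x) v"

text \<open>The \<open>Suc\<close> is the suspension carried by each bar.\<close>

definition qh :: "'v qword \<Rightarrow> nat" where
  "qh q = (\<Sum>t\<leftarrow>fst q. Suc (length t)) + length (snd q)"

definition xh :: "'v xword \<Rightarrow> nat" where
  "xh x = length (fst x) + qh (snd x)"

subsection \<open>Multidegrees\<close>

locale gens =
  fixes G :: "('v::finite \<Rightarrow> nat) set"
  assumes two_le: "m \<in> G \<Longrightarrow> 2 \<le> (\<Sum>v\<in>UNIV. m v)"
begin

lemma lvar_pos: "m \<in> G \<Longrightarrow> 0 < m (lvar m)"
proof -
  assume "m \<in> G"
  then have "(\<Sum>v\<in>UNIV. m v) \<noteq> 0" using two_le[of m] by linarith
  then obtain v where "m v \<noteq> 0" by (meson sum.neutral)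
  then show ?thesis using lvar(1)[of m v] by simp
qed

text \<open>Each chosen variable divides its generator, so the action of T on K does not raise the
  multidegree.\<close>

lemma ind_lvar_le:
  assumes "set t \<subseteq> G" "1 \<le> c"
  shows "ind (map lvar t @ \<kappa>) v \<le> c * lcmx t v + ind \<kappa> v"
proof (cases "v \<in> lvar ` set t")
  case True
  then obtain m where m: "m \<in> set t" "v = lvar m" by blast
  then have "0 < m v" using lvar_pos assms(1) by auto
  then have "1 \<le> lcmx t v" using lcmx_ge[OF m(1), of v] by linarith
  then have "1 \<le> c * lcmx t v" using assms(2) by simp
  then show ?thesis by (simp add: ind_def)
qed (simp add: ind_def)

text \<open>A generator \<open>m\<close> whose smallest variable is largest among those of \<open>t\<close> involves, having degree
  at least 2, either a larger variable or a square.\<close>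

lemma ind_lvar_neq:
  assumes "set t \<subseteq> G" "1 \<le> c" "t \<noteq> []"
  shows "\<exists>v. ind (map lvar t @ \<kappa>) v < c * lcmx t v + ind \<kappa> v"
proof (rule ccontr)
  assume "\<not> ?thesis"
  then have eq: "c * lcmx t v + ind \<kappa> v \<le> ind (map lvar t @ \<kappa>) v" for v
    by (simp add: not_less)
  define M where "M = Max ((\<lambda>m. to_nat (lvar m)) ` set t)"
  have "M \<in> (\<lambda>m. to_nat (lvar m)) ` set t"
    unfolding M_def using assms(3) by (intro Max_in) auto
  then obtain m where m: "m \<in> set t" "M = to_nat (lvar m)" by blast
  have max: "to_nat (lvar m') \<le> to_nat (lvar m)" if "m' \<in> set t" for m'
    unfolding m(2)[symmetric] M_def using that by (intro Max_ge) auto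
  have mG: "m \<in> G" using m assms by auto
  have le: "m v \<le> ind (map lvar t @ \<kappa>) v" for v
  proof -
    have "m v \<le> lcmx t v" using lcmx_ge[OF m(1)] .
    also have "\<dots> \<le> c * lcmx t v" using assms(2) by simp
    finally show ?thesis using eq[of v] by linarith
  qed
  have "m (lvar m) \<le> 1"
    using le[of "lvar m"] by (simp add: ind_def split: if_splits)
  moreover have "(\<Sum>v\<in>UNIV. m v) = m (lvar m) + (\<Sum>v\<in>UNIV - {lvar m}. m v)"
    by (rule sum.remove) auto
  ultimately have "(\<Sum>v\<in>UNIV - {lvar m}. m v) \<noteq> 0" using two_le[OF mG] by linarith
  then obtain w where "w \<in> UNIV - {lvar m}" "m w \<noteq> 0" by (meson sum.neutral)
  then have w: "w \<noteq> lvar m" "0 < m w" by auto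
  have "to_nat (lvar m) < to_nat w"
    using lvar(2)[of m w] w inj_to_nat by (metis injD le_neq_implies_less)
  then have "w \<notin> lvar ` set t" using max by (auto simp: not_le[symmetric])
  then have "ind (map lvar t @ \<kappa>) w = ind \<kappa> w" by (simp add: ind_def)
  moreover have "0 < lcmx t w" using lcmx_ge[OF m(1), of w] w(2) by linarith
  ultimately show False using eq[of w] assms(2) by simp
qed

text \<open>The Leibniz rule on supports: either an entry of \<open>t\<close> is deleted, or the
  term comes from the differential of \<open>q\<close> and has \<open>t\<close> multiplied onto its
  first factor.\<close>

lemma keys_dext:
  assumes "y \<in> keys (dext t q z)"
  shows "(\<exists>t'. y = (t', q) \<and> set t' \<subseteq> set t \<and> Suc (length t') = length t \<and> (\<forall>v. lcmx t' v \<le> lcmx t v)) \<or>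
    (\<exists>y'\<in>keys z. y = (t @ fst y', snd y'))"
  using assms
proof (induction t arbitrary: y)
  case (Cons m t)
  from Cons.prems have "y = (t, q) \<or> y \<in> addl m ` keys (dext t q z)"
    using keys_pmap[of "addl m" "dext t q z"] by (auto elim!: keys_diffE split: if_splits)
  then show ?case
  proof
    assume "y \<in> addl m ` keys (dext t q z)"
    then obtain y' where y': "y' \<in> keys (dext t q z)" "y = addl m y'" by blast
    from Cons.IH[OF y'(1)] show ?case
    proof (elim disjE exE bexE conjE)
      fix t' assume "y' = (t', q)" "set t' \<subseteq> set t" "Suc (length t') = length t"
        "\<forall>v. lcmx t' v \<le> lcmx t v"
      then have "y = (m # t', q) \<and> set (m # t') \<subseteq> set (m # t) \<and> Suc (length (m # t')) = length (m # t) \<and>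
        (\<forall>v. lcmx (m # t') v \<le> lcmx (m # t) v)"
        using y' by (auto simp: addl_def le_max_iff_disj) (metis le_trans linorder_le_cases)
      then show ?case by blast
    qed (use y' in \<open>auto simp: addl_def intro!: bexI\<close>)
  qed auto
qed auto

text \<open>The last clause says when a term of the differential can have the degree of \<open>(ts, \<kappa>)\<close>.\<close>

lemma keys_dB:
  assumes "wfQ G (ts, \<kappa>)" "y \<in> keys (dB ts \<kappa> :: _ \<Rightarrow>\<^sub>0 'k::comm_ring_1)"
  shows "wfX G y \<and> Suc (xh y) = qh (ts, \<kappa>) \<and> (\<forall>c\<ge>1. \<forall>v. xdeg c y v \<le> qdeg c (ts, \<kappa>) v) \<and>
    (set (snd (snd y)) = set \<kappa> \<or> (fst y = [] \<and> lq (fst (snd y)) = lq ts) \<or>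
     (\<forall>c\<ge>1. \<exists>v. xdeg c y v < qdeg c (ts, \<kappa>) v))"
  using assms
proof (induction ts arbitrary: y)
  case Nil
  have *: "\<kappa>' \<in> keys (dK \<kappa> :: _ \<Rightarrow>\<^sub>0 'k) \<Longrightarrow> Suc (length \<kappa>') = length \<kappa> \<and> set \<kappa>' \<subseteq> set \<kappa>" for \<kappa>' :: "'v list"
  proof (induction \<kappa> arbitrary: \<kappa>')
    case (Cons v \<kappa>)
    then have "\<kappa>' = \<kappa> \<or> \<kappa>' \<in> Cons v ` keys (dK \<kappa> :: _ \<Rightarrow>\<^sub>0 'k)"
      using keys_pmap[of "Cons v" "dK \<kappa> :: _ \<Rightarrow>\<^sub>0 'k"] by (auto elim!: keys_diffE split: if_splits)
    with Cons.IH show ?case by fastforce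
  qed auto
  from Nil obtain \<kappa>' where y: "y = kword \<kappa>'" "\<kappa>' \<in> keys (dK \<kappa> :: _ \<Rightarrow>\<^sub>0 'k)"
    using keys_pmap[of kword "dK \<kappa> :: _ \<Rightarrow>\<^sub>0 'k"] by auto
  then show ?case
    using *[OF y(2)] by (auto simp: kword_def wfX_def wfQ_def xh_def qh_def xdeg_def qdeg_def ind_def)
next
  case (Cons t ts)
  have t: "set t \<subseteq> G" "t \<noteq> []" and ts: "wfQ G (ts, \<kappa>)" using Cons.prems(1) by (auto simp: wfQ_def)
  \<comment> \<open>The three summands of \<open>dB\<close>: the first bar is opened, its content
    acts on K, or a term of the differential of the opened word is closed up again.\<close>
  consider "y = (t, ts, \<kappa>)" | "ts = []" "y = kword (map lvar t @ \<kappa>)"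
    | z where "z \<in> keys (dext t (ts, \<kappa>) (dB ts \<kappa> :: _ \<Rightarrow>\<^sub>0 'k))" "fst z \<noteq> []"
        "y = ([], fst z # fst (snd z), snd (snd z))"
    using Cons.prems(2)
    by (auto simp: sX_def iX_def elim!: keys_diffE keys_lextE split: if_splits)
  then show ?case
  proof cases
    case 1
    with t ts show ?thesis by (auto simp: wfX_def xh_def qh_def xdeg_def qdeg_def algebra_simps)
  next
    \<comment> \<open>This is the only place where T acts on K, and the degree drops strictly for
      every \<open>c\<close>.\<close>
    case 2
    with t ts show ?thesis
      using ind_lvar_le[OF t(1)] ind_lvar_neq[OF t(1) _ t(2)]
      by (auto simp: kword_def wfX_def wfQ_def xh_def qh_def xdeg_def qdeg_def)
  next
    case 3
    from keys_dext[OF 3(1)] show ?thesis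
    proof (elim disjE exE bexE conjE)
      fix t' assume t': "z = (t', ts, \<kappa>)" "set t' \<subseteq> set t" "Suc (length t') = length t"
        "\<forall>v. lcmx t' v \<le> lcmx t v"
      with 3 t ts show ?thesis
        by (auto simp: wfX_def wfQ_def xh_def qh_def xdeg_def qdeg_def intro!: add_mono mult_le_mono2)
    next
      fix y' assume y': "y' \<in> keys (dB ts \<kappa> :: _ \<Rightarrow>\<^sub>0 'k)" "z = (t @ fst y', snd y')"
      obtain t' ts' \<kappa>' where y'': "y' = (t', ts', \<kappa>')" by (cases y') auto
      note IH = Cons.IH[OF ts y'(1), unfolded y'']
      have y: "y = ([], (t @ t') # ts', \<kappa>')" using 3 y' y'' by simp
      \<comment> \<open>Merging two bars replaces the sum of their degrees by the maximum.\<close>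
      have mx: "c * max (lcmx t v) (lcmx t' v) \<le> c * lcmx t v + c * lcmx t' v" for c v
        by (simp add: max_def)
      have le: "xdeg c y v \<le> c * lcmx t v + xdeg c (t', ts', \<kappa>') v" for c v
        using mx[of c v] by (simp add: y xdeg_def qdeg_def algebra_simps)
      have eq: "qdeg c (t # ts, \<kappa>) v = c * lcmx t v + qdeg c (ts, \<kappa>) v" for c v
        by (simp add: qdeg_def algebra_simps)
      have "wfX G y" "Suc (xh y) = qh (t # ts, \<kappa>)"
        using IH t by (auto simp: y wfX_def wfQ_def xh_def qh_def)
      moreover have "xdeg c y v \<le> qdeg c (t # ts, \<kappa>) v" if "1 \<le> c" for c v
        using IH that le[of c v] unfolding eq by (meson add_left_mono le_trans)
      moreover have "set \<kappa>' = set \<kappa> \<or> (t' = [] \<and> lq ts' = lq ts) \<or>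
          (\<forall>c\<ge>1. \<exists>v. xdeg c (t', ts', \<kappa>') v < qdeg c (ts, \<kappa>) v)"
        using IH by simp
      \<comment> \<open>In the second alternative \<open>t'\<close> is empty, so nothing is merged
        into the bar \<open>t\<close> and the bar degrees stay equal. This is why the induction
        statement records \<open>fst y = []\<close>.\<close>
      then have "set \<kappa>' = set \<kappa> \<or> lq ((t @ t') # ts') = lq (t # ts) \<or>
          (\<forall>c\<ge>1. \<exists>v. xdeg c y v < qdeg c (t # ts, \<kappa>) v)"
      proof (elim disjE)
        assume a: "\<forall>c\<ge>1. \<exists>v. xdeg c (t', ts', \<kappa>') v < qdeg c (ts, \<kappa>) v"
        have "\<exists>v. xdeg c y v < qdeg c (t # ts, \<kappa>) v" if "1 \<le> c" for c
          using a that le unfolding eq by (meson add_strict_left_mono le_less_trans)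
        then show ?thesis by blast
      qed (auto simp: fun_eq_iff)
      ultimately show ?thesis by (simp add: y del: lq_simps)
    qed
  qed
qed

text \<open>The last two clauses describe a filtration by the bar word: the differential keeps it or
  lowers its homological degree, and never raises its multidegree. The induction that shows the
  kernel of T over R to be acyclic runs along this filtration.\<close>

lemma keys_dXb:
  assumes "wfX G x" "y \<in> keys (dXb x :: _ \<Rightarrow>\<^sub>0 'k::comm_ring_1)"
  shows "wfX G y" "Suc (xh y) = xh x" "1 \<le> c \<Longrightarrow> xdeg c y v \<le> xdeg c x v"
    "snd y = snd x \<or> qh (snd y) < qh (snd x)" "1 \<le> c \<Longrightarrow> qdeg c (snd y) v \<le> qdeg c (snd x) v"
proof -
  obtain t ts \<kappa> where x: "x = (t, ts, \<kappa>)" by (cases x) auto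
  have "y \<in> keys (dext t (ts, \<kappa>) (dB ts \<kappa>) :: _ \<Rightarrow>\<^sub>0 'k)"
    using assms(2) by (simp add: x dXb_def)
  from keys_dext[OF this]
  have "wfX G y \<and> Suc (xh y) = xh x \<and> (\<forall>c\<ge>1. \<forall>v. xdeg c y v \<le> xdeg c x v) \<and>
    (snd y = snd x \<or> qh (snd y) < qh (snd x)) \<and> (\<forall>c\<ge>1. \<forall>v. qdeg c (snd y) v \<le> qdeg c (snd x) v)"
  proof (elim disjE exE bexE conjE)
    fix t' assume "y = (t', ts, \<kappa>)" "set t' \<subseteq> set t" "Suc (length t') = length t" "\<forall>v. lcmx t' v \<le> lcmx t v"
    then show ?thesis using assms(1) by (auto simp: x wfX_def xh_def xdeg_def)
  next
    fix y' assume y': "y' \<in> keys (dB ts \<kappa> :: _ \<Rightarrow>\<^sub>0 'k)" "y = (t @ fst y', snd y')"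
    have "wfQ G (ts, \<kappa>)" using assms(1) by (simp add: x wfX_def)
    note * = keys_dB[OF this y'(1)]
    have q: "qdeg c (snd y') v \<le> qdeg c (ts, \<kappa>) v" if "1 \<le> c" for c v
      using * that by (force simp: xdeg_def intro: add_leD2)
    have "xdeg c y v \<le> xdeg c x v" if "1 \<le> c" for c v
    proof -
      have "c * max (lcmx t v) (lcmx (fst y') v) \<le> c * lcmx t v + c * lcmx (fst y') v"
        by (simp add: max_def)
      moreover have "xdeg c y' v \<le> qdeg c (ts, \<kappa>) v" using * that by blast
      ultimately show ?thesis by (simp add: x y' xdeg_def)
    qed
    with * q show ?thesis using assms(1) by (auto simp: x y' wfX_def xh_def)
  qed
  then show "wfX G y" "Suc (xh y) = xh x" "1 \<le> c \<Longrightarrow> xdeg c y v \<le> xdeg c x v"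
    "snd y = snd x \<or> qh (snd y) < qh (snd x)" "1 \<le> c \<Longrightarrow> qdeg c (snd y) v \<le> qdeg c (snd x) v"
    by auto
qed

lemma wf_dX: "(\<And>x. x \<in> keys z \<Longrightarrow> wfX G x) \<Longrightarrow> y \<in> keys (dX z) \<Longrightarrow> wfX G y"
  unfolding dX_def by (metis keys_dXb(1) keys_lextE)

section \<open>The contraction onto K and the vanishing of the squared differential\<close>

text \<open>For nonempty \<open>t\<close> this is the definition of \<open>dB\<close> read
  backwards. For empty \<open>t\<close> the first term is 0, and \<open>sX\<close> recovers the word
  from the first summand of \<open>dB\<close>, because it kills the images of \<open>iX\<close> and
  of \<open>sX\<close>.\<close>

lemma homotopy:
  assumes "\<And>x. x \<in> keys z \<Longrightarrow> wfX G x"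
  shows "dX (sX z) + sX (dX z) = z - iX z"
proof (rule lin_ext[of "\<lambda>z. dX (sX z) + sX (dX z)" "\<lambda>z. z - iX z"])
  fix x :: "'v xword"
  assume x: "x \<in> keys z"
  obtain t ts \<kappa> where x': "x = (t, ts, \<kappa>)" by (cases x) auto
  let ?x = "Poly_Mapping.single x 1 :: _ \<Rightarrow>\<^sub>0 'a"
  show "dX (sX ?x) + sX (dX ?x) = ?x - iX ?x"
  proof (cases "t = []")
    case False
    then have "dX (sX ?x) = dB (t # ts) \<kappa>"
      by (simp add: x' dX_single dXb_Nil)
    also have "\<dots> = ?x - iX ?x - sX (dX ?x)"
      by (simp add: x' dX_single, simp add: dXb_def)
    finally show ?thesis by simp
  next
    case True
    then have "sX ?x = 0" by (simp add: x')
    moreover have "sX (dB ts \<kappa>) = ?x - iX ?x"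
    proof (cases ts)
      case Nil
      then show ?thesis using True by (simp add: sX_kword x' kword_def)
    next
      case (Cons t1 ts1)
      then have "t1 \<noteq> []" using assms[OF x] by (auto simp: x' wfX_def wfQ_def)
      then show ?thesis using True
        by (simp add: x' Cons sX_linear sX_sX sX_iX del: iX_single, simp)
    qed
    ultimately show ?thesis using True by (simp add: x' dX_single dXb_Nil dX_linear)
  qed
qed (simp_all add: opl)

lemma dd_addl: "dX (dX x) = 0 \<Longrightarrow> dX (dX (pmap (addl m) x)) = 0"
  by (simp add: dX_addl dX_linear pmap_linear)

lemma dd_dXb: "dX (dXb ([], q) :: _ \<Rightarrow>\<^sub>0 'k::comm_ring_1) = 0 \<Longrightarrow> dX (dXb (t, q) :: _ \<Rightarrow>\<^sub>0 'k) = 0"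
proof (induction t)
  case (Cons m t)
  have *: "Poly_Mapping.single (m # t, q) (1::'k) = pmap (addl m) (Poly_Mapping.single (t, q) 1)"
    by (simp add: addl_def)
  have "dX (dX (pmap (addl m) (Poly_Mapping.single (t, q) (1::'k)))) = 0"
    using Cons.IH[OF Cons.prems] by (intro dd_addl) (simp add: dX_single)
  then show ?case by (simp only: *[symmetric] dX_single scl_simps)
qed

text \<open>Induction on the number of bars. The differential of \<open>x - iX x - sX (dX x)\<close>
  is \<open>dX x - iX (dX x) - dX (sX (dX x))\<close>. By the homotopy identity at
  \<open>dX x\<close>, whose differential is 0 by induction, the last term cancels the other
  two.\<close>

lemma dd_dB: "wfQ G (ts, \<kappa>) \<Longrightarrow> dX (dB ts \<kappa>) = 0"
proof (induction ts)
  case Nil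
  then show ?case by (simp add: dX_kword dK_dK pmap_linear)
next
  case (Cons t ts)
  then have wf: "wfX G (t, ts, \<kappa>)" and ts: "wfQ G (ts, \<kappa>)" by (auto simp: wfQ_def wfX_def)
  define x :: "_ \<Rightarrow>\<^sub>0 'a" where "x = Poly_Mapping.single (t, ts, \<kappa>) 1"
  have k: "wfX G y" if "y \<in> keys x" for y using that wf by (simp add: x_def)
  have dd: "dX (dX x) = 0"
    using Cons.IH[OF ts] by (simp add: x_def dX_single dd_dXb dXb_Nil)
  have B: "dB (t # ts) \<kappa> = x - iX x - sX (dX x)"
    by (simp add: x_def dX_single, simp add: dXb_def)
  have "dX (sX (dX x)) = dX x - iX (dX x)"
    using homotopy[of "dX x", OF wf_dX[OF k]] dd by (simp add: sX_linear)
  then show ?case by (simp add: B dX_linear iX_dX del: dB.simps)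
qed

lemma dd:
  assumes "\<And>x. x \<in> keys z \<Longrightarrow> wfX G x"
  shows "dX (dX z) = 0"
proof (rule lin_ext[of "\<lambda>z. dX (dX z)" "\<lambda>_. 0"])
  fix x :: "'v xword" assume "x \<in> keys z"
  then have wf: "wfX G x" by (rule assms)
  obtain t ts \<kappa> where x: "x = (t, ts, \<kappa>)" by (cases x) auto
  have "dX (dXb ([], ts, \<kappa>)) = (0 :: _ \<Rightarrow>\<^sub>0 'a)"
    using wf by (simp add: x dXb_Nil wfX_def dd_dB)
  then have "dX (dXb (t, ts, \<kappa>)) = (0 :: _ \<Rightarrow>\<^sub>0 'a)" by (rule dd_dXb)
  then show "dX (dX (Poly_Mapping.single x 1)) = (0 :: _ \<Rightarrow>\<^sub>0 'a)"
    by (simp add: x dX_single)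
qed (simp_all add: opl)

end

subsection \<open>Exactness of the bar construction over the base ring\<close>

text \<open>The map from T to R on the first factor: elements of positive degree in T go to 0, so
  only an empty first factor survives.\<close>

definition proj :: "('v xword \<Rightarrow>\<^sub>0 'k::comm_ring_1) \<Rightarrow> 'v qword \<Rightarrow>\<^sub>0 'k" where
  "proj = lext (\<lambda>(t, q). if t = [] then Poly_Mapping.single q 1 else 0)"

text \<open>The differential of the resolution over R with variables set to 1. It does not know the
  ideal and squares to zero only modulo words whose coefficient lies in the ideal.\<close>

definition dQ :: "'v::finite qword \<Rightarrow> 'v qword \<Rightarrow>\<^sub>0 'k::comm_ring_1" where
  "dQ q = proj (dXb ([], q))"

lemma proj_single [simp]: "proj (Poly_Mapping.single (t, q) c) = (if t = [] then Poly_Mapping.single q c else 0)"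
  by (simp add: proj_def)

lemma lin_proj: "lin F \<Longrightarrow> lin (\<lambda>x. proj (F x))"
  by (simp add: proj_def lins)

lemmas proj_linear = linD[OF lin_proj[OF lins(1)]]

lemma proj_addl: "proj (pmap (addl m) x) = 0"
  by (rule lin_ext[of "\<lambda>x. proj (pmap (addl m) x)" "\<lambda>x. 0"], (intro opl lin_proj)[1], (intro opl)[1])
    (auto simp: addl_def)

lemma keys_projD: "q \<in> keys (proj x) \<Longrightarrow> ([], q) \<in> keys x"
  by (auto simp: proj_def elim!: keys_lextE split: if_splits)

lemma lookup_proj: "lookup (proj x) q = lookup x ([], q)"
proof -
  have "lookup (proj x) q = (\<Sum>a\<in>keys x. if a = ([], q) then lookup x ([], q) else 0)"
    unfolding proj_def lookup_lext by (rule sum.cong) (auto simp: lookup_single when_def split: if_splits)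
  then show ?thesis by (simp add: in_keys_iff)
qed

lemma proj_inj: "proj (pmap (Pair []) z) = z"
  by (rule lin_ext[of "\<lambda>z. proj (pmap (Pair []) z)" "\<lambda>z. z"], (intro opl lin_proj)[1], (intro opl)[1]) simp

lemma proj_dX_inj: "proj (dX (pmap (Pair []) z)) = lext dQ z"
  by (rule lin_ext[of "\<lambda>z. proj (dX (pmap (Pair []) z))" "lext dQ"], (intro opl lin_proj)[1], rule lin_lext)
    (simp add: dX_single dQ_def)

text \<open>Prepending a variable contracts K, as prepending a generator contracts T.\<close>

lemma dX_addv_K:
  "dX (pmap (addv v) (pmap kword y)) = pmap kword y - pmap (addv v) (dX (pmap kword y))"
proof -
  have "lext dK (pmap (Cons v) y) = y - pmap (Cons v) (lext dK y)"
    by (rule lin_ext[of "\<lambda>y. lext dK (pmap (Cons v) y)" "\<lambda>y. y - pmap (Cons v) (lext dK y)"],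
        (intro opl)[1], (intro opl)[1]) simp
  then show ?thesis by (simp add: addv_kword dX_kword pmap_linear)
qed

lemma keys_empty: "keys z = {} \<Longrightarrow> z = 0"
  by (metis empty_iff not_in_keys_iff_lookup_eq_zero poly_mapping_eqI lookup_zero)

context gens
begin

section \<open>The strands of a fixed multidegree\<close>

definition XA :: "nat \<Rightarrow> ('v \<Rightarrow> nat) \<Rightarrow> 'v xword set" where
  "XA c \<alpha> = {x. wfX G x \<and> (\<forall>v. xdeg c x v \<le> \<alpha> v)}"

definition QA :: "nat \<Rightarrow> ('v \<Rightarrow> nat) \<Rightarrow> 'v qword set" where
  "QA c \<alpha> = {q. wfQ G q \<and> (\<forall>v. qdeg c q v \<le> \<alpha> v)}"

text \<open>The bar words whose coefficient, the monomial of exponent \<alpha> -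
  \<open>qdeg c q\<close>, lies in the ideal. The words of \<open>QA\<close> outside
  \<open>NA\<close> form a basis of the strand over R.\<close>

definition NA :: "nat \<Rightarrow> ('v \<Rightarrow> nat) \<Rightarrow> 'v qword set" where
  "NA c \<alpha> = {q. wfQ G q \<and> (\<exists>m\<in>G. \<forall>v. qdeg c q v + c * m v \<le> \<alpha> v)}"

text \<open>The strand of the kernel of the map from T to R, tensored with the bar words: all words
  with nonempty first factor, and those with empty first factor whose coefficient lies in the
  ideal.\<close>

definition JA :: "nat \<Rightarrow> ('v \<Rightarrow> nat) \<Rightarrow> 'v xword set" where
  "JA c \<alpha> = {x \<in> XA c \<alpha>. \<exists>m\<in>G. \<forall>v. qdeg c (snd x) v + c * m v \<le> \<alpha> v}"

lemma JA_XA: "JA c \<alpha> \<subseteq> XA c \<alpha>"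
  by (auto simp: JA_def)

text \<open>The first generator of the first factor divides the least common multiple and so serves
  as the witness.\<close>

lemma XA_JA:
  assumes "x \<in> XA c \<alpha>" "fst x \<noteq> []"
  shows "x \<in> JA c \<alpha>"
proof -
  obtain m t where t: "fst x = m # t" using assms(2) by (cases "fst x") auto
  have "qdeg c (snd x) v + c * m v \<le> \<alpha> v" for v
  proof -
    have "c * m v \<le> c * lcmx (fst x) v" by (rule mult_le_mono2) (simp add: t)
    moreover have "c * lcmx (fst x) v + qdeg c (snd x) v \<le> \<alpha> v" using assms(1) by (auto simp: XA_def xdeg_def)
    ultimately show ?thesis by linarith
  qed
  moreover have "m \<in> G" using assms(1) t by (auto simp: XA_def wfX_def)
  ultimately show ?thesis using assms by (auto simp: JA_def)
qed

lemma dXb_XA: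
  assumes "1 \<le> c" "x \<in> XA c \<alpha>" "y \<in> keys (dXb x :: _ \<Rightarrow>\<^sub>0 'k::comm_ring_1)"
  shows "y \<in> XA c \<alpha>"
proof -
  have wf: "wfX G x" using assms(2) by (simp add: XA_def)
  have "xdeg c y v \<le> \<alpha> v" for v
    using keys_dXb(3)[OF wf assms(3,1), of v] assms(2) by (auto simp: XA_def intro: le_trans)
  then show ?thesis using keys_dXb(1)[OF wf assms(3)] by (simp add: XA_def)
qed

text \<open>For each variable the exponent of the new least common multiple is the old one, which
  fits already, or that of \<open>m\<close>, which fits by assumption.\<close>

lemma addl_JA:
  assumes "x \<in> XA c \<alpha>" "m \<in> G" "\<And>v. qdeg c (snd x) v + c * m v \<le> \<alpha> v"
  shows "addl m x \<in> JA c \<alpha>"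
proof -
  have "c * max (m v) (lcmx (fst x) v) + qdeg c (snd x) v \<le> \<alpha> v" for v
  proof (cases "m v \<le> lcmx (fst x) v")
    case True
    then show ?thesis using assms(1) by (simp add: max_absorb2 XA_def xdeg_def)
  next
    case False
    then show ?thesis using assms(3)[of v] by (simp add: max_absorb1 add.commute)
  qed
  then have "addl m x \<in> XA c \<alpha>"
    using assms by (cases x) (auto simp: XA_def addl_def wfX_def xdeg_def)
  then show ?thesis by (rule XA_JA) (cases x, simp add: addl_def)
qed

text \<open>Prepending a generator chosen from the degree left over by the bars contracts the first
  factor; the error involves only bar words of smaller degree.\<close>

lemma JA_acyclic:
  fixes z :: "'v xword \<Rightarrow>\<^sub>0 'k::comm_ring_1"
  assumes c: "1 \<le> c" and "keys z \<subseteq> JA c \<alpha>" "dX z = 0" "\<And>x. x \<in> keys z \<Longrightarrow> xh x = i"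
  shows "\<exists>y :: 'v xword \<Rightarrow>\<^sub>0 'k. keys y \<subseteq> JA c \<alpha> \<and> (\<forall>x\<in>keys y. xh x = Suc i) \<and> dX y = z"
proof -
  \<comment> \<open>The generator depends on the bar word only, so all words with the same bar word
    receive the same one.\<close>
  define mm where "mm q = (SOME m. m \<in> G \<and> (\<forall>v. qdeg c q v + c * m v \<le> \<alpha> v))" for q
  define hb where "hb x = addl (mm (snd x)) x" for x
  have mm: "mm (snd x) \<in> G \<and> (\<forall>v. qdeg c (snd x) v + c * mm (snd x) v \<le> \<alpha> v)" if "x \<in> JA c \<alpha>" for x
  proof -
    have "\<exists>m. m \<in> G \<and> (\<forall>v. qdeg c (snd x) v + c * m v \<le> \<alpha> v)" using that by (auto simp: JA_def)
    from someI_ex[OF this] show ?thesis unfolding mm_def .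
  qed
  have hJ: "hb x \<in> JA c \<alpha>" if "x \<in> JA c \<alpha>" for x
    unfolding hb_def using mm[OF that] that by (intro addl_JA) (auto simp: JA_def)
  have xh_addl: "xh (addl m x) = Suc (xh x)" "snd (addl m x) = snd x" for m x
    by (cases x; simp add: addl_def xh_def)+
  have "\<forall>z :: 'v xword \<Rightarrow>\<^sub>0 'k. keys z \<subseteq> JA c \<alpha> \<longrightarrow> dX z = 0 \<longrightarrow> (\<forall>x\<in>keys z. xh x = i \<and> qh (snd x) < n) \<longrightarrow>
    (\<exists>y :: 'v xword \<Rightarrow>\<^sub>0 'k. keys y \<subseteq> JA c \<alpha> \<and> (\<forall>x\<in>keys y. xh x = Suc i) \<and> dX y = z)" for n
  proof (induction n)
    case 0
    show ?case
    proof (intro allI impI)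
      fix z :: "'v xword \<Rightarrow>\<^sub>0 'k" assume "\<forall>x\<in>keys z. xh x = i \<and> qh (snd x) < 0"
      then have "z = 0" by (intro keys_empty) (meson equals0I not_less_zero)
      then show "\<exists>y :: 'v xword \<Rightarrow>\<^sub>0 'k. keys y \<subseteq> JA c \<alpha> \<and> (\<forall>x\<in>keys y. xh x = Suc i) \<and> dX y = z"
        by (intro exI[of _ 0]) (simp add: dX_linear)
    qed
  next
    case (Suc n)
    show ?case
    proof (intro allI impI)
      fix z :: "'v xword \<Rightarrow>\<^sub>0 'k"
      assume z: "keys z \<subseteq> JA c \<alpha>" "dX z = 0" "\<forall>x\<in>keys z. xh x = i \<and> qh (snd x) < Suc n"
      define hz where "hz = pmap hb z"
      define z' where "z' = z - dX hz"
      have hz: "keys hz \<subseteq> JA c \<alpha>" "\<forall>x\<in>keys hz. xh x = Suc i"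
      proof -
        have "x \<in> JA c \<alpha> \<and> xh x = Suc i" if x: "x \<in> keys hz" for x
        proof -
          from x obtain x' where "x' \<in> keys z" "x = hb x'" using keys_pmap[of hb z] unfolding hz_def by blast
          then show ?thesis using z hJ[of x'] by (auto simp: hb_def xh_addl)
        qed
        then show "keys hz \<subseteq> JA c \<alpha>" "\<forall>x\<in>keys hz. xh x = Suc i" by auto
      qed
      have "z' = lext (\<lambda>x. pmap (addl (mm (snd x))) (dXb x)) z"
        unfolding z'_def hz_def
      proof (rule lin_ext[of "\<lambda>z. z - dX (pmap hb z)" "lext (\<lambda>x. pmap (addl (mm (snd x))) (dXb x))"])
        fix a :: "'v xword"
        have "dX (pmap hb (Poly_Mapping.single a 1)) = Poly_Mapping.single a 1 -
            pmap (addl (mm (snd a))) (dXb a :: _ \<Rightarrow>\<^sub>0 'k)"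
          using dX_addl[of "mm (snd a)" "Poly_Mapping.single a (1::'k)"]
          by (simp add: hb_def) (simp add: dX_def)
        then show "Poly_Mapping.single a 1 - dX (pmap hb (Poly_Mapping.single a 1)) =
            lext (\<lambda>x. pmap (addl (mm (snd x))) (dXb x)) (Poly_Mapping.single a (1::'k))" by simp
      qed (simp_all add: opl lin_lext)
      \<comment> \<open>This sum is 0 because \<open>z\<close> is a cycle. Subtracting it cancels
        exactly the terms with unchanged bar word, so only bar words of smaller homological degree
        remain in \<open>z'\<close>.\<close>
      moreover have "lext (\<lambda>x. pmap hb (dXb x)) z = (0 :: _ \<Rightarrow>\<^sub>0 'k)"
      proof -
        have "lext (\<lambda>x. pmap hb (dXb x)) z = pmap hb (dX z)"
          by (rule lin_ext[of "lext (\<lambda>x. pmap hb (dXb x))" "\<lambda>z. pmap hb (dX z)"]) (simp_all add: opl lin_lext, simp add: dX_def)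
        then show ?thesis by (simp add: z pmap_linear)
      qed
      ultimately have z'_eq: "z' = lext (\<lambda>x. pmap (addl (mm (snd x))) (dXb x)) z - lext (\<lambda>x. pmap hb (dXb x)) z"
        by simp
      also have "\<dots> = lext (\<lambda>x. lext (\<lambda>y. Poly_Mapping.single (addl (mm (snd x)) y) 1 - Poly_Mapping.single (hb y) 1) (dXb x)) z"
      proof -
        have "pmap (addl (mm (snd x))) u - pmap hb u =
            lext (\<lambda>y. Poly_Mapping.single (addl (mm (snd x)) y) 1 - Poly_Mapping.single (hb y) 1) u"
          for x and u :: "'v xword \<Rightarrow>\<^sub>0 'k"
          by (rule lin_ext[of "\<lambda>u. pmap (addl (mm (snd x))) u - pmap hb u"
                "lext (\<lambda>y. Poly_Mapping.single (addl (mm (snd x)) y) 1 - Poly_Mapping.single (hb y) 1)"]) (simp_all add: opl lin_lext)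
        note eq = this
        have "lext (\<lambda>x. pmap (addl (mm (snd x))) (dXb x)) z - lext (\<lambda>x. pmap hb (dXb x)) z =
            lext (\<lambda>x. pmap (addl (mm (snd x))) (dXb x) - pmap hb (dXb x)) z"
          by (simp only: lext_def scl_distribs sum_subtractf)
        then show ?thesis by (simp only: eq)
      qed
      finally have z'_eq: "z' = \<dots>" .
      have z': "y' \<in> JA c \<alpha> \<and> xh y' = i \<and> qh (snd y') < n" if "y' \<in> keys z'" for y'
      proof -
        from that obtain x y where x: "x \<in> keys z" and y: "y \<in> keys (dXb x :: _ \<Rightarrow>\<^sub>0 'k)"
          and y': "y' \<in> keys (Poly_Mapping.single (addl (mm (snd x)) y) 1 - Poly_Mapping.single (hb y) (1::'k))"
          unfolding z'_eq by (elim keys_lextE)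
        have xJ: "x \<in> JA c \<alpha>" using x z(1) by blast
        then have wf: "wfX G x" by (simp add: JA_def XA_def)
        have ne: "snd y \<noteq> snd x" using y' by (auto simp: hb_def)
        have yX: "y \<in> XA c \<alpha>" using dXb_XA[OF c _ y] xJ by (simp add: JA_def)
        have le: "qdeg c (snd y) v + c * mm (snd x) v \<le> \<alpha> v" for v
          using keys_dXb(5)[OF wf y c, of v] mm[OF xJ] by (meson add_le_mono1 le_trans)
        have yJ: "y \<in> JA c \<alpha>" using yX le mm[OF xJ] by (auto simp: JA_def)
        have "addl (mm (snd x)) y \<in> JA c \<alpha>" using yX le mm[OF xJ] by (intro addl_JA) auto
        moreover have "hb y \<in> JA c \<alpha>" by (rule hJ[OF yJ])
        moreover have "y' = addl (mm (snd x)) y \<or> y' = hb y" using y' by (auto elim!: keys_diffE split: if_splits)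
        moreover have "qh (snd y) < n" using keys_dXb(4)[OF wf y] ne x z(3) by force
        moreover have "Suc (xh y) = i" using keys_dXb(2)[OF wf y] x z(3) by force
        ultimately show ?thesis by (auto simp: hb_def xh_addl)
      qed
      have "dX (dX hz) = 0" using hz(1) by (intro dd) (auto simp: JA_def XA_def)
      then have "dX z' = 0" by (simp add: z'_def dX_linear z)
      with Suc.IH z' obtain y where y: "keys y \<subseteq> JA c \<alpha>" "\<forall>x\<in>keys y. xh x = Suc i" "dX y = z'"
        by blast
      have "keys (hz + y) \<subseteq> JA c \<alpha>" "\<forall>x\<in>keys (hz + y). xh x = Suc i" "dX (hz + y) = z"
        using hz y keys_add[of hz y] by (auto simp: dX_linear z'_def)
      then show "\<exists>y :: 'v xword \<Rightarrow>\<^sub>0 'k. keys y \<subseteq> JA c \<alpha> \<and> (\<forall>x\<in>keys y. xh x = Suc i) \<and> dX y = z" by blast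
    qed
  qed
  from this[of "Suc (Max ((\<lambda>x. qh (snd x)) ` keys z))"] show ?thesis
    using assms by (auto simp: less_Suc_eq_le)
qed

text \<open>The projection fails to commute with the differentials only on a first factor consisting
  of one generator \<open>m\<close>: deleting it leaves a coefficient divisible by the corresponding
  monomial, hence in the ideal.\<close>

lemma keys_proj_dX:
  fixes w :: "'v xword \<Rightarrow>\<^sub>0 'k::comm_ring_1"
  assumes "keys w \<subseteq> XA c \<alpha>"
  shows "keys (proj (dX w) - lext dQ (proj w)) \<subseteq> NA c \<alpha>"
proof
  fix q assume q: "q \<in> keys (proj (dX w) - lext dQ (proj w))"
  have "proj (dX w) - lext dQ (proj w) = lext (\<lambda>x. proj (dXb x) - lext dQ (proj (Poly_Mapping.single x 1))) w"
    by (rule lin_ext[of "\<lambda>w. proj (dX w) - lext dQ (proj w)"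
          "lext (\<lambda>x. proj (dXb x) - lext dQ (proj (Poly_Mapping.single x 1)))"])
      (simp_all add: opl lin_lext lin_proj, simp add: dX_def)
  with q obtain x where x: "x \<in> keys w"
    and q: "q \<in> keys (proj (dXb x) - lext dQ (proj (Poly_Mapping.single x (1::'k))))"
    by (auto elim: keys_lextE)
  obtain t q' where x': "x = (t, q')" by (cases x)
  obtain m t' where t: "t = m # t'"
    using q by (cases t) (auto simp: x' dQ_def)
  have "q \<in> keys (proj (Poly_Mapping.single (t', q') (1::'k)))"
    using q by (simp add: x' t dXb_Cons proj_linear proj_addl lext_linear del: proj_single) (simp add: lext_linear)
  then have "x = ([m], q)" by (auto simp: x' t split: if_splits)
  with x assms have "([m], q) \<in> JA c \<alpha>" by (intro XA_JA) auto
  then show "q \<in> NA c \<alpha>" by (auto simp: JA_def NA_def XA_def wfX_def)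
qed

text \<open>The strand over R is the quotient of \<open>XA\<close> by \<open>JA\<close>. The former
  contracts to the strand of K, which is acyclic here, and the latter is acyclic, hence so is the
  quotient. The case \<open>i = 0\<close> with \<alpha> = 0 is left out because there K has homology
  k.\<close>

theorem exact:
  fixes z :: "'v qword \<Rightarrow>\<^sub>0 'k::comm_ring_1"
  assumes c: "1 \<le> c" and z: "keys z \<subseteq> QA c \<alpha>" "\<And>q. q \<in> keys z \<Longrightarrow> qh q = i"
    and dz: "keys (lext dQ z) \<subseteq> NA c \<alpha>" and i: "0 < i \<or> (\<exists>v. 0 < \<alpha> v)"
  obtains y :: "'v qword \<Rightarrow>\<^sub>0 'k" where "keys y \<subseteq> QA c \<alpha>" "\<And>q. q \<in> keys y \<Longrightarrow> qh q = Suc i"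
    "keys (z - lext dQ y) \<subseteq> NA c \<alpha>"
proof -
  define zt where "zt = pmap (Pair ([] :: 'v gens)) z"
  have zt: "x \<in> XA c \<alpha> \<and> xh x = i" if "x \<in> keys zt" for x
    using that keys_pmap[of "Pair ([] :: 'v gens)" z] z
    by (fastforce simp: zt_def XA_def QA_def wfX_def xdeg_def xh_def)
  have dzt: "x \<in> XA c \<alpha> \<and> Suc (xh x) = i" if x: "x \<in> keys (dX zt)" for x
  proof -
    from x obtain a where a: "a \<in> keys zt" "x \<in> keys (dXb a :: _ \<Rightarrow>\<^sub>0 'k)" by (auto simp: dX_def elim: keys_lextE)
    have "x \<in> XA c \<alpha>" using dXb_XA[OF c _ a(2)] zt[OF a(1)] by blast
    then show ?thesis using zt[OF a(1)] keys_dXb(2)[OF _ a(2)] by (auto simp: XA_def)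
  qed
  have wf: "\<And>x. x \<in> keys zt \<Longrightarrow> wfX G x" using zt by (auto simp: XA_def)
  have "\<exists>y :: 'v xword \<Rightarrow>\<^sub>0 'k. keys y \<subseteq> JA c \<alpha> \<and> (\<forall>x\<in>keys y. xh x = Suc (i - 1)) \<and> dX y = dX zt"
  proof (rule JA_acyclic[OF c])
    show "keys (dX zt) \<subseteq> JA c \<alpha>"
    proof
      fix x assume x: "x \<in> keys (dX zt)"
      show "x \<in> JA c \<alpha>"
      proof (cases "fst x = []")
        case False
        then show ?thesis using XA_JA dzt[OF x] by blast
      next
        case True
        then have "snd x \<in> keys (lext dQ z)"
          using x by (cases x) (simp add: zt_def lookup_proj in_keys_iff flip: proj_dX_inj)
        then have "snd x \<in> NA c \<alpha>" using dz by blast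
        then show ?thesis using dzt[OF x] by (auto simp: JA_def NA_def)
      qed
    qed
    show "dX (dX zt) = 0" by (rule dd[OF wf])
    show "xh x = i - 1" if "x \<in> keys (dX zt)" for x using dzt[OF that] by auto
  qed
  then obtain y :: "'v xword \<Rightarrow>\<^sub>0 'k" where y: "keys y \<subseteq> JA c \<alpha>" "\<forall>x\<in>keys y. xh x = Suc (i - 1)" "dX y = dX zt"
    by blast
  \<comment> \<open>For \<open>i = 0\<close> the truncated difference in \<open>Suc (i - 1)\<close>
    gives the wrong degree, but then \<open>dX zt\<close> is 0 and \<open>y = 0\<close>
    serves.\<close>
  have "\<exists>y :: 'v xword \<Rightarrow>\<^sub>0 'k. keys y \<subseteq> JA c \<alpha> \<and> (\<forall>x\<in>keys y. xh x = i) \<and> dX y = dX zt"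
  proof (cases "i = 0")
    case True
    then have "dX zt = 0" using dzt by (intro keys_empty) blast
    then show ?thesis by (intro exI[of _ 0]) (simp add: dX_linear)
  next
    case False
    with y show ?thesis by (intro exI[of _ y]) auto
  qed
  then obtain y :: "'v xword \<Rightarrow>\<^sub>0 'k" where y: "keys y \<subseteq> JA c \<alpha>" "\<forall>x\<in>keys y. xh x = i" "dX y = dX zt"
    by blast
  \<comment> \<open>A cycle that agrees with \<open>zt\<close> modulo the kernel strand, so a
    preimage of it projects to the desired \<open>y\<close>.\<close>
  define u where "u = zt - y"
  have u: "x \<in> XA c \<alpha> \<and> xh x = i" if "x \<in> keys u" for x
    using that zt y JA_XA keys_diffE[of x zt y] unfolding u_def by blast
  have du: "dX u = 0" by (simp add: u_def dX_linear y)
  have hom: "dX (sX u) = u - iX u"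
    using homotopy[of u] u du by (auto simp: XA_def sX_linear)
  have iu: "x \<in> XA c \<alpha> \<and> xh x = i \<and> (\<exists>\<kappa>. x = kword \<kappa>)" if x: "x \<in> keys (iX u)" for x
  proof -
    from x obtain t \<kappa> where a: "(t, [], \<kappa>) \<in> keys u" "x = kword (map lvar t @ \<kappa>)"
      by (auto simp: iX_def elim!: keys_lextE split: if_splits)
    have t: "set t \<subseteq> G" using u[OF a(1)] by (auto simp: XA_def wfX_def)
    have "xdeg c x v \<le> \<alpha> v" for v
      using u[OF a(1)] ind_lvar_le[OF t c, of \<kappa> v]
      by (auto simp: a(2) XA_def xdeg_def qdeg_def kword_def intro: le_trans)
    then show ?thesis using u[OF a(1)] by (auto simp: a(2) XA_def kword_def xh_def qh_def wfX_def wfQ_def)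
  qed
  \<comment> \<open>The part of the cycle in K is a boundary: prepend a variable that occurs in
    \<alpha>.\<close>
  have "\<exists>k :: 'v xword \<Rightarrow>\<^sub>0 'k. dX k = iX u \<and> (\<forall>x\<in>keys k. x \<in> XA c \<alpha> \<and> xh x = Suc i)"
  proof (cases "\<exists>v. 0 < \<alpha> v")
    case True
    then obtain v where v: "0 < \<alpha> v" by blast
    have "dX (pmap (addv v) (iX u)) = iX u"
      using iX_factor[of u] iX_dX[of u] du by (auto simp: iX_linear pmap_linear dX_addv_K)
    moreover have "x \<in> XA c \<alpha> \<and> xh x = Suc i" if "x \<in> keys (pmap (addv v) (iX u))" for x
    proof -
      from that keys_pmap[of "addv v" "iX u"] obtain x' where x': "x' \<in> keys (iX u)" "x = addv v x'" by blast
      then obtain \<kappa> where k: "x' = kword \<kappa>" using iu by blast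
      have "xdeg c x w \<le> \<alpha> w" for w
        using iu[OF x'(1)] v by (auto simp: x' k kword_def addv_def XA_def xdeg_def qdeg_def ind_def Suc_le_eq
            dest: spec[of _ w])
      then show ?thesis using iu[OF x'(1)]
        by (auto simp: x' k kword_def addv_def XA_def xh_def qh_def wfX_def wfQ_def)
    qed
    ultimately show ?thesis by blast
  next
    case False
    \<comment> \<open>When \<alpha> is 0 only the empty word of K fits; its homological degree is 0,
      which \<open>i\<close> excludes.\<close>
    have "x \<notin> keys (iX u)" for x
    proof
      assume x: "x \<in> keys (iX u)"
      then obtain \<kappa> where k: "x = kword \<kappa>" using iu by blast
      have "ind \<kappa> v = 0" for v
        using iu[OF x] False by (auto simp: k kword_def XA_def xdeg_def qdeg_def dest: spec[of _ v])
      from this[of "hd \<kappa>"] have "\<kappa> = []" by (cases \<kappa>) (auto simp: ind_def)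
      then show False using iu[OF x] i False by (auto simp: k kword_def xh_def qh_def)
    qed
    then have "iX u = 0" by (intro keys_empty) blast
    then show ?thesis by (intro exI[of _ 0]) (simp add: dX_linear)
  qed
  then obtain k :: "'v xword \<Rightarrow>\<^sub>0 'k" where k: "dX k = iX u" "\<forall>x\<in>keys k. x \<in> XA c \<alpha> \<and> xh x = Suc i" by blast
  define w where "w = sX u + k"
  have w: "x \<in> XA c \<alpha> \<and> xh x = Suc i" if "x \<in> keys w" for x
  proof -
    have "x \<in> XA c \<alpha> \<and> xh x = Suc i" if "x \<in> keys (sX u)"
    proof -
      from that obtain t ts \<kappa> where a: "(t, ts, \<kappa>) \<in> keys u" "t \<noteq> []" "x = ([], t # ts, \<kappa>)"
        by (auto simp: sX_def elim!: keys_lextE split: if_splits)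
      then show ?thesis using u[OF a(1)]
        by (auto simp: XA_def xh_def qh_def wfX_def wfQ_def xdeg_def qdeg_def algebra_simps)
    qed
    then show ?thesis using \<open>x \<in> keys w\<close> k(2) keys_addE[of x "sX u" k] unfolding w_def by blast
  qed
  have dw: "dX w = zt - y" by (simp add: w_def dX_linear hom k) (simp add: u_def)
  have eq: "z - lext dQ (proj w) = (proj (dX w) - lext dQ (proj w)) + proj y"
    by (simp add: dw proj_linear zt_def proj_inj)
  have "keys (proj y) \<subseteq> NA c \<alpha>"
  proof
    fix q assume "q \<in> keys (proj y)"
    then have "([], q) \<in> JA c \<alpha>" using keys_projD y(1) by blast
    then show "q \<in> NA c \<alpha>" by (auto simp: JA_def NA_def XA_def wfX_def)
  qed
  moreover have "keys (proj (dX w) - lext dQ (proj w)) \<subseteq> NA c \<alpha>"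
    using w by (intro keys_proj_dX) blast
  ultimately have "keys (z - lext dQ (proj w)) \<subseteq> NA c \<alpha>"
    unfolding eq using keys_add by fastforce
  moreover have "q \<in> QA c \<alpha> \<and> qh q = Suc i" if "q \<in> keys (proj w)" for q
    using w[OF keys_projD[OF that]] by (auto simp: XA_def QA_def wfX_def xdeg_def xh_def)
  ultimately show ?thesis by (intro that[of "proj w"]) auto
qed

text \<open>The last clause removes the dependence on \<open>c\<close>. If the degree is preserved,
  the terms that survive leave either the bar part or the K part of it unchanged; then the other
  part is unchanged too, a condition without \<open>c\<close>.\<close>

lemma keys_dQ:
  assumes "wfQ G q" "q' \<in> keys (dQ q :: _ \<Rightarrow>\<^sub>0 'k::comm_ring_1)"
  shows "wfQ G q'" "Suc (qh q') = qh q" "1 \<le> c \<Longrightarrow> qdeg c q' v \<le> qdeg c q v"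
    "1 \<le> c \<Longrightarrow> 1 \<le> c' \<Longrightarrow> qdeg c q' = qdeg c q \<Longrightarrow> qdeg c' q' = qdeg c' q"
proof -
  obtain ts \<kappa> ts' \<kappa>' where q: "q = (ts, \<kappa>)" "q' = (ts', \<kappa>')" by (cases q; cases q')
  have "([], q') \<in> keys (dB ts \<kappa> :: _ \<Rightarrow>\<^sub>0 'k)"
    using keys_projD[of q' "dXb ([], q) :: _ \<Rightarrow>\<^sub>0 'k"] assms(2) by (simp add: q dXb_Nil dQ_def)
  note * = keys_dB[OF assms(1)[unfolded q] this]
  have x: "xdeg c ([], q') = qdeg c q'" for c by (simp add: fun_eq_iff xdeg_def)
  show "wfQ G q'" "Suc (qh q') = qh q" "1 \<le> c \<Longrightarrow> qdeg c q' v \<le> qdeg c q v"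
    using * by (auto simp: wfX_def xh_def xdeg_def q)
  assume c: "1 \<le> c" "1 \<le> c'" and eq: "qdeg c q' = qdeg c q"
  have "\<not> (\<forall>c\<ge>1. \<exists>v. qdeg c q' v < qdeg c q v)" using eq c by (metis less_irrefl)
  then have "set \<kappa>' = set \<kappa> \<or> lq ts' = lq ts"
    using *[unfolded x] by (auto simp: q)
  then show "qdeg c' q' = qdeg c' q"
  proof
    assume "set \<kappa>' = set \<kappa>"
    then have i: "ind \<kappa>' v = ind \<kappa> v" for v by (simp add: ind_def)
    have "lq ts' v = lq ts v" for v
      using fun_cong[OF eq, of v] c by (simp add: q qdeg_def i)
    then show ?thesis by (simp add: fun_eq_iff q qdeg_def i)
  next
    assume l: "lq ts' = lq ts"
    have "ind \<kappa>' v = ind \<kappa> v" for v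
      using fun_cong[OF eq, of v] by (simp add: q qdeg_def l)
    then show ?thesis by (simp add: fun_eq_iff q qdeg_def l)
  qed
qed

text \<open>The full differential squares to zero exactly; the error comes from projecting after the
  first step.\<close>

lemma dQ_dQ:
  assumes "1 \<le> c" "q \<in> QA c \<alpha>"
  shows "keys (lext dQ (dQ q) :: _ \<Rightarrow>\<^sub>0 'k::comm_ring_1) \<subseteq> NA c \<alpha>"
proof -
  let ?w = "dXb ([], q) :: _ \<Rightarrow>\<^sub>0 'k"
  have x: "([], q) \<in> XA c \<alpha>" using assms(2) by (auto simp: QA_def XA_def wfX_def xdeg_def)
  have "dX ?w = 0"
    using dd_dB[of "fst q" "snd q"] assms(2) by (cases q) (auto simp: dXb_Nil QA_def)
  then have "- lext dQ (dQ q :: _ \<Rightarrow>\<^sub>0 'k) = proj (dX ?w) - lext dQ (proj ?w)"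
    by (simp add: proj_linear dQ_def)
  moreover have "keys (proj (dX ?w) - lext dQ (proj ?w)) \<subseteq> NA c \<alpha>"
    using dXb_XA[OF assms(1) x] by (intro keys_proj_dX) blast
  ultimately have "keys (- lext dQ (dQ q :: _ \<Rightarrow>\<^sub>0 'k)) \<subseteq> NA c \<alpha>" by simp
  then show ?thesis by (auto simp: in_keys_iff subset_iff)
qed

end

subsection \<open>Comparison of free resolutions\<close>

context cring
begin

lemma free_mod_simps [simp]:
  "\<zero>\<^bsub>free_mod R B\<^esub> = (\<lambda>b. \<zero>)"
  "x \<oplus>\<^bsub>free_mod R B\<^esub> y = (\<lambda>b. x b \<oplus> y b)"
  "r \<odot>\<^bsub>free_mod R B\<^esub> x = (\<lambda>b. r \<otimes> x b)"
  by (simp_all add: free_mod_def)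

lemma free_mod_carrier:
  "x \<in> carrier (free_mod R B) \<longleftrightarrow> (\<forall>b. x b \<in> carrier R) \<and> finite {b. x b \<noteq> \<zero>} \<and> {b. x b \<noteq> \<zero>} \<subseteq> B"
  by (simp add: free_mod_def)

lemma free_mod_closed:
  "x \<in> carrier (free_mod R B) \<Longrightarrow> y \<in> carrier (free_mod R B) \<Longrightarrow> (\<lambda>b. x b \<oplus> y b) \<in> carrier (free_mod R B)"
  "x \<in> carrier (free_mod R B) \<Longrightarrow> r \<in> carrier R \<Longrightarrow> (\<lambda>b. r \<otimes> x b) \<in> carrier (free_mod R B)"
  "x \<in> carrier (free_mod R B) \<Longrightarrow> (\<lambda>b. \<ominus> x b) \<in> carrier (free_mod R B)"
  "(\<lambda>b. \<zero>) \<in> carrier (free_mod R B)"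
  "x \<in> carrier (free_mod R B) \<Longrightarrow> x b \<in> carrier R"
proof -
  assume x: "x \<in> carrier (free_mod R B)"
  {
    assume y: "y \<in> carrier (free_mod R B)"
    have "{b. x b \<oplus> y b \<noteq> \<zero>} \<subseteq> {b. x b \<noteq> \<zero>} \<union> {b. y b \<noteq> \<zero>}" by auto
    with x y show "(\<lambda>b. x b \<oplus> y b) \<in> carrier (free_mod R B)"
      by (auto simp: free_mod_carrier intro: finite_subset)
  }
  {
    assume r: "r \<in> carrier R"
    then have "{b. r \<otimes> x b \<noteq> \<zero>} \<subseteq> {b. x b \<noteq> \<zero>}" by auto
    with x r show "(\<lambda>b. r \<otimes> x b) \<in> carrier (free_mod R B)"
      by (auto simp: free_mod_carrier intro: finite_subset)
  }
  have "{b. \<ominus> x b \<noteq> \<zero>} \<subseteq> {b. x b \<noteq> \<zero>}" by auto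
  with x show "(\<lambda>b. \<ominus> x b) \<in> carrier (free_mod R B)"
    by (auto simp: free_mod_carrier intro: finite_subset)
  show "x b \<in> carrier R" using x by (simp add: free_mod_carrier)
qed (simp add: free_mod_carrier)

lemma free_module: "module R (free_mod R B)"
proof (rule moduleI)
  show "abelian_group (free_mod R B)"
  proof (rule abelian_groupI)
    fix x assume "x \<in> carrier (free_mod R B)"
    then show "\<exists>y\<in>carrier (free_mod R B). y \<oplus>\<^bsub>free_mod R B\<^esub> x = \<zero>\<^bsub>free_mod R B\<^esub>"
      by (intro bexI[of _ "\<lambda>b. \<ominus> x b"]) (auto simp: free_mod_closed l_neg)
  qed (auto simp: free_mod_closed a_ac)
qed (auto simp: free_mod_closed cring_axioms l_distr r_distr m_assoc)

definition unit_vec :: "nat \<Rightarrow> nat \<Rightarrow> 'a" where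
  "unit_vec b = (\<lambda>i. if i = b then \<one> else \<zero>)"

lemma unit_vec_closed: "b \<in> B \<Longrightarrow> unit_vec b \<in> carrier (free_mod R B)"
  by (auto simp: free_mod_carrier unit_vec_def)

text \<open>Each coordinate is filled once, as \<open>y b\<close> is still zero. This lets a
  condition on the residues of the whole vector be split into one on \<open>r\<close> and one on
  \<open>y\<close>.\<close>

lemma free_induct [consumes 1, case_names zero add]:
  assumes "x \<in> carrier (free_mod R B)"
    and "P (\<lambda>b. \<zero>)"
    and step: "\<And>b r y. b \<in> B \<Longrightarrow> r \<in> carrier R \<Longrightarrow> y \<in> carrier (free_mod R B) \<Longrightarrow>
      y b = \<zero> \<Longrightarrow> P y \<Longrightarrow> P (\<lambda>i. y i \<oplus> r \<otimes> unit_vec b i)"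
  shows "P x"
proof -
  have "\<forall>x. x \<in> carrier (free_mod R B) \<longrightarrow> {b. x b \<noteq> \<zero>} \<subseteq> S \<longrightarrow> P x" if "finite S" for S
    using that
  proof (induction S)
    case empty
    have "x = (\<lambda>b. \<zero>)" if "{b. x b \<noteq> \<zero>} \<subseteq> {}" for x using that by auto
    with assms(2) show ?case by auto
  next
    case (insert b S)
    show ?case
    proof (intro allI impI)
      fix x assume x: "x \<in> carrier (free_mod R B)" "{b. x b \<noteq> \<zero>} \<subseteq> insert b S"
      show "P x"
      proof (cases "x b = \<zero>")
        case True
        then have "{b. x b \<noteq> \<zero>} \<subseteq> S" using x(2) by auto
        then show ?thesis using insert.IH x by blast
      next
        case False
        let ?y = "x(b := \<zero>)"
        have "{b. ?y b \<noteq> \<zero>} \<subseteq> {b. x b \<noteq> \<zero>}" by auto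
        then have y: "?y \<in> carrier (free_mod R B)" using x by (auto simp: free_mod_carrier intro: finite_subset)
        have Py: "P ?y" by (rule insert.IH[rule_format]) (use y x(2) in auto)
        have "x b \<in> carrier R" "b \<in> B" using False x(1) by (auto simp: free_mod_carrier)
        then have "P (\<lambda>i. ?y i \<oplus> x b \<otimes> unit_vec b i)" using y Py by (intro step[of b "x b" ?y]) (fact | simp)+
        moreover have "(\<lambda>i. ?y i \<oplus> x b \<otimes> unit_vec b i) = x"
          using x by (auto simp: unit_vec_def free_mod_carrier)
        ultimately show ?thesis by simp
      qed
    qed
  qed
  then show ?thesis using assms(1) by (auto simp: free_mod_carrier)
qed

lemma module_homD:
  assumes "f \<in> module_hom R M N"
  shows "x \<in> carrier M \<Longrightarrow> f x \<in> carrier N"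
    "x \<in> carrier M \<Longrightarrow> y \<in> carrier M \<Longrightarrow> f (x \<oplus>\<^bsub>M\<^esub> y) = f x \<oplus>\<^bsub>N\<^esub> f y"
    "x \<in> carrier M \<Longrightarrow> r \<in> carrier R \<Longrightarrow> f (r \<odot>\<^bsub>M\<^esub> x) = r \<odot>\<^bsub>N\<^esub> f x"
  using assms by (auto simp: module_hom_def)

lemma module_hom_zero:
  assumes "f \<in> module_hom R M N" "module R M" "module R N"
  shows "f \<zero>\<^bsub>M\<^esub> = \<zero>\<^bsub>N\<^esub>"
proof -
  interpret M: module R M by fact
  interpret N: module R N by fact
  have "f (\<zero> \<odot>\<^bsub>M\<^esub> \<zero>\<^bsub>M\<^esub>) = \<zero> \<odot>\<^bsub>N\<^esub> f \<zero>\<^bsub>M\<^esub>" by (rule module_homD(3)[OF assms(1)]) auto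
  then show ?thesis using module_homD(1)[OF assms(1)] by (simp add: N.smult_l_null)
qed

lemma module_hom_comp: "f \<in> module_hom R M N \<Longrightarrow> g \<in> module_hom R N L \<Longrightarrow> (\<lambda>x. g (f x)) \<in> module_hom R M L"
  by (auto simp: module_hom_def Pi_def)

lemma module_hom_id: "(\<lambda>x. x) \<in> module_hom R M M"
  by (auto simp: module_hom_def)

lemma module_hom_comb:
  assumes "module R N" "f \<in> module_hom R M N" "g \<in> module_hom R M N" "c \<in> carrier R"
  shows "(\<lambda>x. f x \<oplus>\<^bsub>N\<^esub> c \<odot>\<^bsub>N\<^esub> g x) \<in> module_hom R M N"
proof -
  interpret N: module R N by fact
  have cl: "f x \<in> carrier N" "g x \<in> carrier N" if "x \<in> carrier M" for x
    using that assms module_homD(1) by metis+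
  have "c \<odot>\<^bsub>N\<^esub> (r \<odot>\<^bsub>N\<^esub> u) = r \<odot>\<^bsub>N\<^esub> (c \<odot>\<^bsub>N\<^esub> u)" if "r \<in> carrier R" "u \<in> carrier N" for r u
    using that assms(4) by (simp flip: N.smult_assoc1 add: m_comm)
  then show ?thesis
    using cl assms(4) unfolding module_hom_def
    by (auto simp: module_homD[OF assms(2)] module_homD[OF assms(3)] N.smult_r_distr N.a_ac)
qed

lemma free_hom_eqI:
  assumes "module R N" "f \<in> module_hom R (free_mod R B) N" "g \<in> module_hom R (free_mod R B) N"
    and "\<And>b. b \<in> B \<Longrightarrow> f (unit_vec b) = g (unit_vec b)" "x \<in> carrier (free_mod R B)"
  shows "f x = g x"
  using assms(5)
proof (induction rule: free_induct)
  case zero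
  show ?case using module_hom_zero[OF assms(2) free_module assms(1)] module_hom_zero[OF assms(3) free_module assms(1)]
    by simp
next
  case (add b r y)
  have *: "h (\<lambda>i. y i \<oplus> r \<otimes> unit_vec b i) = h y \<oplus>\<^bsub>N\<^esub> r \<odot>\<^bsub>N\<^esub> h (unit_vec b)"
    if h: "h \<in> module_hom R (free_mod R B) N" for h
    using module_homD(2)[OF h, of y "\<lambda>i. r \<otimes> unit_vec b i"] module_homD(3)[OF h, of "unit_vec b" r]
      add unit_vec_closed[of b B] free_mod_closed(2)[of "unit_vec b" B r] by simp
  show ?case using *[OF assms(2)] *[OF assms(3)] assms(4) add by simp
qed

lemma free_extend:
  assumes "module R M" "\<And>b. b \<in> B \<Longrightarrow> \<phi> b \<in> carrier M"
  shows "\<exists>g. g \<in> module_hom R (free_mod R B) M \<and> (\<forall>b\<in>B. g (unit_vec b) = \<phi> b)"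
proof -
  interpret M: module R M by fact
  define g where "g x = (\<Oplus>\<^bsub>M\<^esub> b\<in>{b. x b \<noteq> \<zero>}. x b \<odot>\<^bsub>M\<^esub> \<phi> b)" for x
  have g: "g x = (\<Oplus>\<^bsub>M\<^esub> b\<in>S. x b \<odot>\<^bsub>M\<^esub> \<phi> b)"
    if "x \<in> carrier (free_mod R B)" "finite S" "{b. x b \<noteq> \<zero>} \<subseteq> S" "S \<subseteq> B" for x S
    unfolding g_def using that assms(2)
    by (intro M.add.finprod_mono_neutral_cong_left) (auto simp: free_mod_carrier M.smult_l_null subset_iff Pi_def)
  have "g \<in> module_hom R (free_mod R B) M"
    unfolding module_hom_def
  proof (intro CollectI conjI allI impI Pi_I; (elim conjE)?)
    fix x assume x: "x \<in> carrier (free_mod R B)"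
    then show "g x \<in> carrier M"
      unfolding g_def using assms(2) by (intro M.finsum_closed) (auto simp: free_mod_carrier Pi_def subset_iff)
    fix y assume y: "y \<in> carrier (free_mod R B)"
    let ?S = "{b. x b \<noteq> \<zero>} \<union> {b. y b \<noteq> \<zero>}"
    have S: "finite ?S" "?S \<subseteq> B" "{b. x b \<oplus> y b \<noteq> \<zero>} \<subseteq> ?S"
      using x y by (auto simp: free_mod_carrier)
    have \<phi>: "\<phi> b \<in> carrier M" if "b \<in> ?S" for b using that S(2) assms(2) by blast
    have "g (x \<oplus>\<^bsub>free_mod R B\<^esub> y) = (\<Oplus>\<^bsub>M\<^esub> b\<in>?S. (x b \<oplus> y b) \<odot>\<^bsub>M\<^esub> \<phi> b)"
      using g[of "\<lambda>b. x b \<oplus> y b" ?S] free_mod_closed(1)[OF x y] S by simp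
    also have "\<dots> = (\<Oplus>\<^bsub>M\<^esub> b\<in>?S. x b \<odot>\<^bsub>M\<^esub> \<phi> b \<oplus>\<^bsub>M\<^esub> y b \<odot>\<^bsub>M\<^esub> \<phi> b)"
      by (rule M.finsum_cong') (use \<phi> free_mod_closed(5)[OF x] free_mod_closed(5)[OF y] in \<open>auto simp: M.smult_l_distr\<close>)
    also have "\<dots> = g x \<oplus>\<^bsub>M\<^esub> g y"
      using g[OF x S(1) _ S(2)] g[OF y S(1) _ S(2)] \<phi> free_mod_closed(5)[OF x] free_mod_closed(5)[OF y]
      by (subst M.finsum_addf) auto
    finally show "g (x \<oplus>\<^bsub>free_mod R B\<^esub> y) = g x \<oplus>\<^bsub>M\<^esub> g y" .
  next
    fix r x assume r: "r \<in> carrier R" and x: "x \<in> carrier (free_mod R B)"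
    let ?S = "{b. x b \<noteq> \<zero>}"
    have S: "finite ?S" "?S \<subseteq> B" "{b. r \<otimes> x b \<noteq> \<zero>} \<subseteq> ?S"
      using x r by (auto simp: free_mod_carrier)
    have \<phi>: "\<phi> b \<in> carrier M" if "b \<in> ?S" for b using that S(2) assms(2) by blast
    have "g (r \<odot>\<^bsub>free_mod R B\<^esub> x) = (\<Oplus>\<^bsub>M\<^esub> b\<in>?S. (r \<otimes> x b) \<odot>\<^bsub>M\<^esub> \<phi> b)"
      using g[of "\<lambda>b. r \<otimes> x b" ?S] free_mod_closed(2)[OF x r] S by simp
    also have "\<dots> = (\<Oplus>\<^bsub>M\<^esub> b\<in>?S. r \<odot>\<^bsub>M\<^esub> (x b \<odot>\<^bsub>M\<^esub> \<phi> b))"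
      by (rule M.finsum_cong') (use r \<phi> free_mod_closed(5)[OF x] in \<open>auto simp: M.smult_assoc1\<close>)
    also have "\<dots> = r \<odot>\<^bsub>M\<^esub> g x"
      using g[OF x S(1) _ S(2)] r \<phi> free_mod_closed(5)[OF x] S(1)
      by (subst M.finsum_smult_ldistr[symmetric]) auto
    finally show "g (r \<odot>\<^bsub>free_mod R B\<^esub> x) = r \<odot>\<^bsub>M\<^esub> g x" .
  qed
  moreover have "g (unit_vec b) = \<phi> b" if "b \<in> B" for b
    using that assms(2) by (subst g[of _ "{b}"]) (auto simp: unit_vec_closed, auto simp: unit_vec_def Pi_def split: if_splits)
  ultimately show ?thesis by blast
qed

text \<open>Projectivity of free modules: preimages are chosen on the basis and extended
  linearly.\<close>

lemma free_lift:
  assumes "module R N" "h \<in> module_hom R (free_mod R B) N" "p \<in> module_hom R (free_mod R B') N"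
    and "\<And>b. b \<in> B \<Longrightarrow> h (unit_vec b) \<in> p ` carrier (free_mod R B')"
  shows "\<exists>g. g \<in> module_hom R (free_mod R B) (free_mod R B') \<and> (\<forall>x\<in>carrier (free_mod R B). p (g x) = h x)"
proof -
  have "\<forall>b\<in>B. \<exists>u. u \<in> carrier (free_mod R B') \<and> h (unit_vec b) = p u" using assms(4) by blast
  from bchoice[OF this] obtain \<phi> where \<phi>: "\<forall>b\<in>B. \<phi> b \<in> carrier (free_mod R B') \<and> h (unit_vec b) = p (\<phi> b)" ..
  have "\<exists>g. g \<in> module_hom R (free_mod R B) (free_mod R B') \<and> (\<forall>b\<in>B. g (unit_vec b) = \<phi> b)"
    by (rule free_extend[OF free_module]) (simp add: \<phi>)
  then obtain g where g: "g \<in> module_hom R (free_mod R B) (free_mod R B')" "\<forall>b\<in>B. g (unit_vec b) = \<phi> b"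
    by auto
  have hom: "(\<lambda>x. p (g x)) \<in> module_hom R (free_mod R B) N" by (rule module_hom_comp[OF g(1) assms(3)])
  have "p (g x) = h x" if "x \<in> carrier (free_mod R B)" for x
    by (rule free_hom_eqI[OF assms(1) hom assms(2) _ that]) (simp add: g(2) \<phi>)
  with g(1) show ?thesis by auto
qed

lemma (in module) add_neg_one_cancel:
  assumes "x \<in> carrier M" "y \<in> carrier M"
  shows "y \<oplus>\<^bsub>M\<^esub> (x \<oplus>\<^bsub>M\<^esub> (\<ominus> \<one>) \<odot>\<^bsub>M\<^esub> y) = x"
proof -
  have "(\<ominus> \<one>) \<odot>\<^bsub>M\<^esub> y = \<ominus>\<^bsub>M\<^esub> y" using assms by (simp add: smult_l_minus)
  moreover have "y \<oplus>\<^bsub>M\<^esub> (x \<oplus>\<^bsub>M\<^esub> \<ominus>\<^bsub>M\<^esub> y) = x \<oplus>\<^bsub>M\<^esub> (y \<oplus>\<^bsub>M\<^esub> \<ominus>\<^bsub>M\<^esub> y)"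
    using assms by (intro M.a_lcomm) auto
  ultimately show ?thesis using assms by (simp add: M.r_neg)
qed

section \<open>Lifting chain maps and homotopies\<close>

text \<open>In degree 0 the augmentation takes the place of the differential; with \<open>z\<close>
  the zero of its target, exactness becomes one equation for all degrees.\<close>

definition cyc :: "(nat \<Rightarrow> nat set) \<Rightarrow> (nat \<Rightarrow> (nat \<Rightarrow> 'a) \<Rightarrow> nat \<Rightarrow> 'a) \<Rightarrow> ((nat \<Rightarrow> 'a) \<Rightarrow> 'm) \<Rightarrow> 'm \<Rightarrow> nat \<Rightarrow> (nat \<Rightarrow> 'a) set" where
  "cyc B d e z i = {x \<in> carrier (free_mod R (B i)). case i of 0 \<Rightarrow> e x = z | Suc j \<Rightarrow> d j x = (\<lambda>b. \<zero>)}"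

lemma cyc_Suc: "x \<in> cyc B d e z (Suc i) \<longleftrightarrow> x \<in> carrier (free_mod R (B (Suc i))) \<and> d i x = (\<lambda>b. \<zero>)"
  and cyc_0: "x \<in> cyc B d e z 0 \<longleftrightarrow> x \<in> carrier (free_mod R (B 0)) \<and> e x = z"
  by (simp_all add: cyc_def)

lemma free_resolutionD:
  assumes "free_resolution R M B d e"
  shows "e \<in> module_hom R (free_mod R (B 0)) M"
    "d i \<in> module_hom R (free_mod R (B (Suc i))) (free_mod R (B i))"
    "e ` carrier (free_mod R (B 0)) = carrier M"
    "cyc B d e \<zero>\<^bsub>M\<^esub> i = d i ` carrier (free_mod R (B (Suc i)))"
  using assms by (cases i; auto simp: free_resolution_def cyc_def)+

lemma chain_lift:
  assumes M: "module R M" and "free_resolution R M B d e" "free_resolution R M B' d' e'"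
  shows "\<exists>f. (\<forall>i. f i \<in> module_hom R (free_mod R (B i)) (free_mod R (B' i))) \<and>
    (\<forall>x\<in>carrier (free_mod R (B 0)). e' (f 0 x) = e x) \<and>
    (\<forall>i. \<forall>x\<in>carrier (free_mod R (B (Suc i))). d' i (f (Suc i) x) = f i (d i x))"
proof -
  note r = free_resolutionD[OF assms(2)] and r' = free_resolutionD[OF assms(3)]
  \<comment> \<open>Preservation of cycles belongs to the invariant, since it puts
    \<open>f (d i x)\<close> into the image of \<open>d' i\<close> and so permits the next
    lift.\<close>
  define P where "P i f \<longleftrightarrow> f \<in> module_hom R (free_mod R (B i)) (free_mod R (B' i)) \<and>
    f ` cyc B d e \<zero>\<^bsub>M\<^esub> i \<subseteq> cyc B' d' e' \<zero>\<^bsub>M\<^esub> i \<and>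
    (i = 0 \<longrightarrow> (\<forall>x\<in>carrier (free_mod R (B 0)). e' (f x) = e x))" for i f
  have "\<exists>f. \<forall>i. P i (f i) \<and> (\<forall>x\<in>carrier (free_mod R (B (Suc i))). d' i (f (Suc i) x) = f i (d i x))"
  proof (rule dependent_nat_choice)
    obtain g where g: "g \<in> module_hom R (free_mod R (B 0)) (free_mod R (B' 0))"
      "\<forall>x\<in>carrier (free_mod R (B 0)). e' (g x) = e x"
      using free_lift[OF M r(1) r'(1)] r'(3) module_homD(1)[OF r(1)] unit_vec_closed by blast
    then have "P 0 g" using module_homD(1)[OF g(1)] by (simp add: P_def cyc_0 image_subset_iff)
    then show "\<exists>f. P 0 f" by blast
  next
    fix f i assume f: "P i f"
    then have hom: "f \<in> module_hom R (free_mod R (B i)) (free_mod R (B' i))" by (simp add: P_def)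
    have "f (d i x) \<in> d' i ` carrier (free_mod R (B' (Suc i)))" if "x \<in> carrier (free_mod R (B (Suc i)))" for x
      using f that unfolding P_def r(4) r'(4) by blast
    then obtain g where g: "g \<in> module_hom R (free_mod R (B (Suc i))) (free_mod R (B' (Suc i)))"
      "\<forall>x\<in>carrier (free_mod R (B (Suc i))). d' i (g x) = f (d i x)"
      using free_lift[OF free_module module_hom_comp[OF r(2) hom] r'(2)] unit_vec_closed by blast
    have "f (\<lambda>b. \<zero>) = (\<lambda>b. \<zero>)"
      using module_hom_zero[OF hom free_module free_module] by simp
    then have "P (Suc i) g" using g module_homD(1)[OF g(1)] by (simp add: P_def cyc_Suc image_subset_iff)
    with g(2) show "\<exists>g. P (Suc i) g \<and> (\<forall>x\<in>carrier (free_mod R (B (Suc i))). d' i (g x) = f (d i x))" by blast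
  qed
  then obtain f where f: "\<And>i. P i (f i)"
    "\<And>i x. x \<in> carrier (free_mod R (B (Suc i))) \<Longrightarrow> d' i (f (Suc i) x) = f i (d i x)" by blast
  from f(1) have "f i \<in> module_hom R (free_mod R (B i)) (free_mod R (B' i))" for i
    by (simp add: P_def)
  moreover have "\<forall>x\<in>carrier (free_mod R (B 0)). e' (f 0 x) = e x"
    using f(1)[of 0] by (simp add: P_def)
  ultimately show ?thesis using f(2) by (intro exI[of _ f]) simp
qed

lemma chain_homotopy:
  assumes M: "module R M" and "free_resolution R M B d e" "free_resolution R M B' d' e'"
    and f: "\<And>i. f i \<in> module_hom R (free_mod R (B i)) (free_mod R (B' i))"
      "\<And>i x. x \<in> carrier (free_mod R (B (Suc i))) \<Longrightarrow> d' i (f (Suc i) x) = f i (d i x)"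
    and g: "\<And>i. g i \<in> module_hom R (free_mod R (B i)) (free_mod R (B' i))"
      "\<And>i x. x \<in> carrier (free_mod R (B (Suc i))) \<Longrightarrow> d' i (g (Suc i) x) = g i (d i x)"
    and fg: "\<And>x. x \<in> carrier (free_mod R (B 0)) \<Longrightarrow> e' (f 0 x) = e' (g 0 x)"
  shows "\<exists>s. (\<forall>i. s i \<in> module_hom R (free_mod R (B i)) (free_mod R (B' (Suc i)))) \<and>
    (\<forall>x\<in>carrier (free_mod R (B 0)). f 0 x = g 0 x \<oplus>\<^bsub>free_mod R (B' 0)\<^esub> d' 0 (s 0 x)) \<and>
    (\<forall>i. \<forall>x\<in>carrier (free_mod R (B (Suc i))). f (Suc i) x =
      (g (Suc i) x \<oplus>\<^bsub>free_mod R (B' (Suc i))\<^esub> s i (d i x)) \<oplus>\<^bsub>free_mod R (B' (Suc i))\<^esub> d' (Suc i) (s (Suc i) x))"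
proof -
  note r = free_resolutionD[OF assms(2)] and r' = free_resolutionD[OF assms(3)]
  let ?F = "\<lambda>i. free_mod R (B i)" and ?F' = "\<lambda>i. free_mod R (B' i)"
  note F = free_module
  \<comment> \<open>On cycles the term with \<open>d\<close> drops out, so the identity mentions
    only the current \<open>s\<close> and can be carried along in the dependent choice. The next
    step needs it only at the cycle \<open>d i x\<close>.\<close>
  define P where "P i s \<longleftrightarrow> s \<in> module_hom R (?F i) (?F' (Suc i)) \<and>
    (\<forall>x\<in>cyc B d e \<zero>\<^bsub>M\<^esub> i. f i x = g i x \<oplus>\<^bsub>?F' i\<^esub> d' i (s x)) \<and>
    (i = 0 \<longrightarrow> (\<forall>x\<in>carrier (?F 0). f 0 x = g 0 x \<oplus>\<^bsub>?F' 0\<^esub> d' 0 (s x)))" for i s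
  define Q where "Q i s s' \<longleftrightarrow> (\<forall>x\<in>carrier (?F (Suc i)).
    f (Suc i) x = (g (Suc i) x \<oplus>\<^bsub>?F' (Suc i)\<^esub> s (d i x)) \<oplus>\<^bsub>?F' (Suc i)\<^esub> d' (Suc i) (s' x))" for i s s'
  have one: "\<ominus> \<one> \<in> carrier R" by simp
  have "\<exists>s. \<forall>i. P i (s i) \<and> Q i (s i) (s (Suc i))"
  proof (rule dependent_nat_choice)
    define h where "h x = f 0 x \<oplus>\<^bsub>?F' 0\<^esub> (\<ominus> \<one>) \<odot>\<^bsub>?F' 0\<^esub> g 0 x" for x
    have h: "h \<in> module_hom R (?F 0) (?F' 0)" unfolding h_def by (rule module_hom_comb[OF F f(1) g(1) one])
    have "h x \<in> d' 0 ` carrier (?F' (Suc 0))" if x: "x \<in> carrier (?F 0)" for x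
    proof -
      interpret M: module R M by fact
      have fx: "f 0 x \<in> carrier (?F' 0)" "g 0 x \<in> carrier (?F' 0)"
        using module_homD(1)[OF f(1) x] module_homD(1)[OF g(1) x] by auto
      have gx: "(\<ominus> \<one>) \<odot>\<^bsub>?F' 0\<^esub> g 0 x \<in> carrier (?F' 0)"
        by (rule module.smult_closed[OF F one fx(2)])
      have "e' (h x) = e' (g 0 x) \<oplus>\<^bsub>M\<^esub> (\<ominus> \<one>) \<odot>\<^bsub>M\<^esub> e' (g 0 x)"
        unfolding h_def module_homD(2)[OF r'(1) fx(1) gx] module_homD(3)[OF r'(1) fx(2) one] fg[OF x] ..
      also have "\<dots> = \<zero>\<^bsub>M\<^esub>"
        using module_homD(1)[OF r'(1) fx(2)] by (simp add: M.smult_l_minus M.M.r_neg)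
      finally have "h x \<in> cyc B' d' e' \<zero>\<^bsub>M\<^esub> 0" using module_homD(1)[OF h x] by (simp add: cyc_0)
      then show ?thesis unfolding r'(4) .
    qed
    then obtain s where s: "s \<in> module_hom R (?F 0) (?F' (Suc 0))" "\<forall>x\<in>carrier (?F 0). d' 0 (s x) = h x"
      using free_lift[OF F h r'(2)] unit_vec_closed by blast
    have "f 0 x = g 0 x \<oplus>\<^bsub>?F' 0\<^esub> d' 0 (s x)" if x: "x \<in> carrier (?F 0)" for x
      using module.add_neg_one_cancel[OF F, of "f 0 x" "B' 0" "g 0 x"] module_homD(1)[OF f(1) x]
        module_homD(1)[OF g(1) x] s(2) x by (simp add: h_def)
    with s have "P 0 s" by (auto simp: P_def cyc_0)
    then show "\<exists>s. P 0 s" by blast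
  next
    fix s i assume s: "P i s"
    then have hom: "s \<in> module_hom R (?F i) (?F' (Suc i))"
      and sc: "\<And>x. x \<in> cyc B d e \<zero>\<^bsub>M\<^esub> i \<Longrightarrow> f i x = g i x \<oplus>\<^bsub>?F' i\<^esub> d' i (s x)" by (auto simp: P_def)
    have sd: "(\<lambda>x. s (d i x)) \<in> module_hom R (?F (Suc i)) (?F' (Suc i))" by (rule module_hom_comp[OF r(2) hom])
    define k where "k x = g (Suc i) x \<oplus>\<^bsub>?F' (Suc i)\<^esub> \<one> \<odot>\<^bsub>?F' (Suc i)\<^esub> s (d i x)" for x
    have k: "k \<in> module_hom R (?F (Suc i)) (?F' (Suc i))"
      unfolding k_def by (rule module_hom_comb[OF F g(1) sd one_closed])
    have k_eq: "k x = g (Suc i) x \<oplus>\<^bsub>?F' (Suc i)\<^esub> s (d i x)" if "x \<in> carrier (?F (Suc i))" for x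
      using module.smult_one[OF F] module_homD(1)[OF sd that] by (simp add: k_def free_mod_carrier)
    define h where "h x = f (Suc i) x \<oplus>\<^bsub>?F' (Suc i)\<^esub> (\<ominus> \<one>) \<odot>\<^bsub>?F' (Suc i)\<^esub> k x" for x
    have h: "h \<in> module_hom R (?F (Suc i)) (?F' (Suc i))" unfolding h_def by (rule module_hom_comb[OF F f(1) k one])
    have "h x \<in> d' (Suc i) ` carrier (?F' (Suc (Suc i)))" if x: "x \<in> carrier (?F (Suc i))" for x
    proof -
      interpret F': module R "?F' i" by (rule F)
      have c: "d i x \<in> cyc B d e \<zero>\<^bsub>M\<^esub> i" unfolding r(4) using x by blast
      have fx: "f (Suc i) x \<in> carrier (?F' (Suc i))" "k x \<in> carrier (?F' (Suc i))"
        "g (Suc i) x \<in> carrier (?F' (Suc i))" "s (d i x) \<in> carrier (?F' (Suc i))"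
        using module_homD(1)[OF f(1) x] module_homD(1)[OF k x] module_homD(1)[OF g(1) x] module_homD(1)[OF sd x] by auto
      have gx: "(\<ominus> \<one>) \<odot>\<^bsub>?F' (Suc i)\<^esub> k x \<in> carrier (?F' (Suc i))"
        by (rule module.smult_closed[OF F one fx(2)])
      have dk: "d' i (k x) = d' i (f (Suc i) x)"
        unfolding k_eq[OF x] module_homD(2)[OF r'(2) fx(3,4)] f(2)[OF x] g(2)[OF x] sc[OF c] ..
      have "d' i (h x) = d' i (f (Suc i) x) \<oplus>\<^bsub>?F' i\<^esub> (\<ominus> \<one>) \<odot>\<^bsub>?F' i\<^esub> d' i (f (Suc i) x)"
        unfolding h_def module_homD(2)[OF r'(2) fx(1) gx] module_homD(3)[OF r'(2) fx(2) one] dk ..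
      also have "\<dots> = \<zero>\<^bsub>?F' i\<^esub>"
        using module_homD(1)[OF r'(2) fx(1)] F'.smult_l_minus[of \<one>] F'.M.r_neg by (simp del: free_mod_simps)
      finally have "h x \<in> cyc B' d' e' \<zero>\<^bsub>M\<^esub> (Suc i)" using module_homD(1)[OF h x] by (simp add: cyc_Suc)
      then show ?thesis unfolding r'(4) .
    qed
    then obtain s' where s': "s' \<in> module_hom R (?F (Suc i)) (?F' (Suc (Suc i)))"
      "\<forall>x\<in>carrier (?F (Suc i)). d' (Suc i) (s' x) = h x"
      using free_lift[OF F h r'(2)] unit_vec_closed by blast
    have Q: "f (Suc i) x = (g (Suc i) x \<oplus>\<^bsub>?F' (Suc i)\<^esub> s (d i x)) \<oplus>\<^bsub>?F' (Suc i)\<^esub> d' (Suc i) (s' x)"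
      if x: "x \<in> carrier (?F (Suc i))" for x
      using module.add_neg_one_cancel[OF F, of "f (Suc i) x" "B' (Suc i)" "k x"] module_homD(1)[OF f(1) x]
        module_homD(1)[OF k x] s'(2) x by (simp add: h_def k_eq del: free_mod_simps)
    have "f (Suc i) x = g (Suc i) x \<oplus>\<^bsub>?F' (Suc i)\<^esub> d' (Suc i) (s' x)"
      if "x \<in> cyc B d e \<zero>\<^bsub>M\<^esub> (Suc i)" for x
    proof -
      have x: "x \<in> carrier (?F (Suc i))" "d i x = (\<lambda>b. \<zero>)" using that by (auto simp: cyc_Suc)
      have "s (d i x) = (\<lambda>b. \<zero>)" using module_hom_zero[OF hom F F] x by simp
      then show ?thesis using Q[OF x(1)] module_homD(1)[OF g(1) x(1)] by (simp add: free_mod_carrier)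
    qed
    then have "P (Suc i) s'" using s' by (auto simp: P_def)
    with Q show "\<exists>s'. P (Suc i) s' \<and> Q i s s'" unfolding Q_def by blast
  qed
  then obtain s where s: "\<And>i. P i (s i)" "\<And>i. Q i (s i) (s (Suc i))" by blast
  have "s i \<in> module_hom R (?F i) (?F' (Suc i))" for i
    using s(1)[of i] by (simp add: P_def)
  moreover have "\<forall>x\<in>carrier (?F 0). f 0 x = g 0 x \<oplus>\<^bsub>?F' 0\<^esub> d' 0 (s 0 x)"
    using s(1)[of 0] unfolding P_def by blast
  ultimately show ?thesis using s(2) unfolding Q_def by (intro exI[of _ s]) blast
qed

end

section \<open>Complexes of free modules modulo the residue map\<close>

locale residue_map = cring R for R (structure) +
  fixes \<epsilon> :: "'a \<Rightarrow> 'k::field"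
  assumes \<epsilon>_add: "x \<in> carrier R \<Longrightarrow> y \<in> carrier R \<Longrightarrow> \<epsilon> (x \<oplus> y) = \<epsilon> x + \<epsilon> y"
    and \<epsilon>_mult: "x \<in> carrier R \<Longrightarrow> y \<in> carrier R \<Longrightarrow> \<epsilon> (x \<otimes> y) = \<epsilon> x * \<epsilon> y"
begin

lemma \<epsilon>_zero [simp]: "\<epsilon> \<zero> = 0"
proof -
  have "\<epsilon> \<zero> + 0 = \<epsilon> \<zero> + \<epsilon> \<zero>" using \<epsilon>_add[OF zero_closed zero_closed] by (simp only: l_zero[OF zero_closed] add_0_right)
  then show ?thesis by (simp only: add_left_cancel)
qed

text \<open>The coordinates of the image of \<open>x\<close> in the free module tensored with k.
  Homology after tensoring is studied on elements of the free module, compared through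
  \<open>red\<close>.\<close>

definition red :: "(nat \<Rightarrow> 'a) \<Rightarrow> nat \<Rightarrow> 'k" where
  "red x = (\<lambda>b. \<epsilon> (x b))"

lemma red_add:
  "x \<in> carrier (free_mod R B) \<Longrightarrow> y \<in> carrier (free_mod R B) \<Longrightarrow>
    red (\<lambda>b. x b \<oplus> y b) b = red x b + red y b"
  by (simp add: red_def \<epsilon>_add free_mod_closed)

text \<open>Homomorphisms act on residues by a matrix. The formula is claimed for every large enough
  finite \<open>S\<close>, because two elements with equal residues may have different supports and
  need a common index set.\<close>

lemma red_hom_formula:
  assumes f: "f \<in> module_hom R (free_mod R B) (free_mod R B')" and x: "x \<in> carrier (free_mod R B)"
  shows "\<exists>S0. finite S0 \<and> (\<forall>S. finite S \<longrightarrow> S0 \<subseteq> S \<longrightarrow> S \<subseteq> B \<longrightarrow> red (f x) i = (\<Sum>b\<in>S. red x b * red (f (unit_vec b)) i)) \<and> S0 \<subseteq> B"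
  using x
proof (induction rule: free_induct)
  case zero
  show ?case using module_hom_zero[OF f free_module free_module] by (intro exI[of _ "{}"]) (simp add: red_def)
next
  case (add b r y)
  then obtain S0 where S0: "finite S0" "S0 \<subseteq> B"
    "\<And>S. finite S \<Longrightarrow> S0 \<subseteq> S \<Longrightarrow> S \<subseteq> B \<Longrightarrow> red (f y) i = (\<Sum>b\<in>S. red y b * red (f (unit_vec b)) i)" by blast
  have cl: "f y \<in> carrier (free_mod R B')" "f (unit_vec b) \<in> carrier (free_mod R B')"
    using module_homD(1)[OF f] add(1,3) unit_vec_closed by auto
  have "f (\<lambda>i. y i \<oplus> r \<otimes> unit_vec b i) = (\<lambda>i. f y i \<oplus> r \<otimes> f (unit_vec b) i)"
    using module_homD(2)[OF f, of y "\<lambda>i. r \<otimes> unit_vec b i"] module_homD(3)[OF f, of "unit_vec b" r]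
      add(1-3) unit_vec_closed[of b B] free_mod_closed(2)[of "unit_vec b" B r] by simp
  then have fi: "red (f (\<lambda>i. y i \<oplus> r \<otimes> unit_vec b i)) i = red (f y) i + \<epsilon> r * red (f (unit_vec b)) i"
    using free_mod_closed(5)[OF cl(1), of i] free_mod_closed(5)[OF cl(2), of i] add(2)
    by (simp add: red_def \<epsilon>_add \<epsilon>_mult)
  have yb: "red (\<lambda>i. y i \<oplus> r \<otimes> unit_vec b i) j = red y j + (if j = b then \<epsilon> r else 0)" for j
    using free_mod_closed(5)[OF add(3), of j] add(2) by (simp add: red_def unit_vec_def \<epsilon>_add)
  show ?case
  proof (intro exI[of _ "insert b S0"] conjI allI impI)
    fix S assume S: "finite S" "insert b S0 \<subseteq> S" "S \<subseteq> B"
    have "(\<Sum>j\<in>S. (if j = b then \<epsilon> r else 0) * red (f (unit_vec j)) i) =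
        (\<Sum>j\<in>S. if j = b then \<epsilon> r * red (f (unit_vec b)) i else 0)"
      by (rule sum.cong) auto
    then show "red (f (\<lambda>i. y i \<oplus> r \<otimes> unit_vec b i)) i =
        (\<Sum>j\<in>S. red (\<lambda>i. y i \<oplus> r \<otimes> unit_vec b i) j * red (f (unit_vec j)) i)"
      using S S0(3)[of S] by (simp add: fi yb distrib_right sum.distrib)
  qed (simp_all add: S0(1,2) add(1))
qed

lemma red_hom_cong:
  assumes f: "f \<in> module_hom R (free_mod R B) (free_mod R B')"
    and x: "x \<in> carrier (free_mod R B)" "y \<in> carrier (free_mod R B)" and eq: "red x = red y"
  shows "red (f x) = red (f y)"
proof
  fix i
  from red_hom_formula[OF f x(1), of i] obtain S where S: "finite S \<and> (\<forall>T. finite T \<longrightarrow> S \<subseteq> T \<longrightarrow> T \<subseteq> B \<longrightarrow>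
      red (f x) i = (\<Sum>b\<in>T. red x b * red (f (unit_vec b)) i)) \<and> S \<subseteq> B" ..
  from red_hom_formula[OF f x(2), of i] obtain T where T: "finite T \<and> (\<forall>U. finite U \<longrightarrow> T \<subseteq> U \<longrightarrow> U \<subseteq> B \<longrightarrow>
      red (f y) i = (\<Sum>b\<in>U. red y b * red (f (unit_vec b)) i)) \<and> T \<subseteq> B" ..
  have "red (f x) i = (\<Sum>b\<in>S \<union> T. red x b * red (f (unit_vec b)) i)"
    "red (f y) i = (\<Sum>b\<in>S \<union> T. red y b * red (f (unit_vec b)) i)"
    using S T by simp_all
  then show "red (f x) i = red (f y) i" by (simp only: eq)
qed

lemma red_hom_0:
  assumes f: "f \<in> module_hom R (free_mod R B) (free_mod R B')"
    and x: "x \<in> carrier (free_mod R B)" and eq: "red x = (\<lambda>b. 0)"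
  shows "red (f x) = (\<lambda>b. 0)"
  using red_hom_cong[OF f x free_mod_closed(4)] module_hom_zero[OF f free_module free_module] eq
  by (simp add: red_def)

text \<open>Representatives of the cycles after tensoring with k: the differential need vanish only
  in residues.\<close>

definition mcyc :: "(nat \<Rightarrow> nat set) \<Rightarrow> (nat \<Rightarrow> (nat \<Rightarrow> 'a) \<Rightarrow> nat \<Rightarrow> 'a) \<Rightarrow> nat \<Rightarrow> (nat \<Rightarrow> 'a) set" where
  "mcyc B d i = {x \<in> carrier (free_mod R (B i)). case i of 0 \<Rightarrow> True | Suc j \<Rightarrow> red (d j x) = (\<lambda>b. 0)}"

definition mbd :: "(nat \<Rightarrow> nat set) \<Rightarrow> (nat \<Rightarrow> (nat \<Rightarrow> 'a) \<Rightarrow> nat \<Rightarrow> 'a) \<Rightarrow> nat \<Rightarrow> (nat \<Rightarrow> 'a) set" where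
  "mbd B d i = {x \<in> carrier (free_mod R (B i)). \<exists>y\<in>carrier (free_mod R (B (Suc i))). red x = red (d i y)}"

text \<open>In the chain homotopy the term through \<open>d\<close> has residue 0, because
  \<open>d\<close> of such an element has residue 0 and homomorphisms preserve this.\<close>

lemma mcyc_homotopic:
  assumes M: "module R M" and "free_resolution R M B d e" "free_resolution R M B' d' e'"
    and f: "\<And>i. f i \<in> module_hom R (free_mod R (B i)) (free_mod R (B' i))"
      "\<And>i x. x \<in> carrier (free_mod R (B (Suc i))) \<Longrightarrow> d' i (f (Suc i) x) = f i (d i x)"
    and g: "\<And>i. g i \<in> module_hom R (free_mod R (B i)) (free_mod R (B' i))"
      "\<And>i x. x \<in> carrier (free_mod R (B (Suc i))) \<Longrightarrow> d' i (g (Suc i) x) = g i (d i x)"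
    and fg: "\<And>x. x \<in> carrier (free_mod R (B 0)) \<Longrightarrow> e' (f 0 x) = e' (g 0 x)"
    and x: "x \<in> mcyc B d i"
  shows "\<exists>y\<in>carrier (free_mod R (B' (Suc i))). \<forall>b. red (f i x) b = red (g i x) b + red (d' i y) b"
proof -
  note r = free_resolutionD[OF assms(2)] and r' = free_resolutionD[OF assms(3)]
  from chain_homotopy[where f = f and g = g, OF M assms(2,3) f g fg]
  obtain s where "(\<forall>i. s i \<in> module_hom R (free_mod R (B i)) (free_mod R (B' (Suc i)))) \<and>
    (\<forall>x\<in>carrier (free_mod R (B 0)). f 0 x = g 0 x \<oplus>\<^bsub>free_mod R (B' 0)\<^esub> d' 0 (s 0 x)) \<and>
    (\<forall>i. \<forall>x\<in>carrier (free_mod R (B (Suc i))). f (Suc i) x =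
      (g (Suc i) x \<oplus>\<^bsub>free_mod R (B' (Suc i))\<^esub> s i (d i x)) \<oplus>\<^bsub>free_mod R (B' (Suc i))\<^esub> d' (Suc i) (s (Suc i) x))" ..
  then have s: "\<And>i. s i \<in> module_hom R (free_mod R (B i)) (free_mod R (B' (Suc i)))"
    "\<And>x. x \<in> carrier (free_mod R (B 0)) \<Longrightarrow> f 0 x = g 0 x \<oplus>\<^bsub>free_mod R (B' 0)\<^esub> d' 0 (s 0 x)"
    "\<And>i x. x \<in> carrier (free_mod R (B (Suc i))) \<Longrightarrow>
      f (Suc i) x = (g (Suc i) x \<oplus>\<^bsub>free_mod R (B' (Suc i))\<^esub> s i (d i x)) \<oplus>\<^bsub>free_mod R (B' (Suc i))\<^esub> d' (Suc i) (s (Suc i) x)"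
    by blast+
  have xc: "x \<in> carrier (free_mod R (B i))" using x by (simp add: mcyc_def)
  have sx: "s i x \<in> carrier (free_mod R (B' (Suc i)))" by (rule module_homD(1)[OF s(1) xc])
  note cl = module_homD(1)[OF g(1) xc] module_homD(1)[OF r'(2) sx]
  have "\<forall>b. red (f i x) b = red (g i x) b + red (d' i (s i x)) b"
  proof (cases i)
    case 0
    show ?thesis using s(2)[of x] xc cl by (simp add: 0 red_add)
  next
    case (Suc j)
    have d: "red (d j x) = (\<lambda>b. 0)" using x by (simp add: mcyc_def Suc)
    have dc: "d j x \<in> carrier (free_mod R (B j))" using module_homD(1)[OF r(2)] xc by (simp add: Suc)
    have "red (s j (d j x)) = (\<lambda>b. 0)" by (rule red_hom_0[OF s(1) dc d])
    moreover have "s j (d j x) \<in> carrier (free_mod R (B' i))" using module_homD(1)[OF s(1) dc] by (simp add: Suc)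
    ultimately show ?thesis
      using s(3)[of x j] xc cl free_mod_closed(1)[of "g i x" "B' i" "s j (d j x)"] by (simp add: Suc red_add)
  qed
  with sx show ?thesis by blast
qed

text \<open>Lifts of the identity of \<open>M\<close> in both directions are inverse up to homotopy,
  so they induce inverse maps on the homology of the reduced complexes. Surjectivity on homology
  takes the form that a cycle is hit up to a boundary and up to residues.\<close>

theorem compare_resolutions:
  assumes M: "module R M" and res: "free_resolution R M B d e" "free_resolution R M B' d' e'"
  shows "\<exists>f. f \<in> module_hom R (free_mod R (B i)) (free_mod R (B' i)) \<and>
    (\<forall>x\<in>mcyc B d i. f x \<in> mcyc B' d' i \<and> (f x \<in> mbd B' d' i \<longleftrightarrow> x \<in> mbd B d i)) \<and>
    (\<forall>z\<in>mcyc B' d' i. \<exists>x\<in>mcyc B d i. \<exists>y\<in>carrier (free_mod R (B' (Suc i))).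
        \<forall>b. red z b = red (f x) b + red (d' i y) b)"
proof -
  note r = free_resolutionD[OF res(1)] and r' = free_resolutionD[OF res(2)]
  from chain_lift[OF M res] obtain f where "(\<forall>i. f i \<in> module_hom R (free_mod R (B i)) (free_mod R (B' i))) \<and>
    (\<forall>x\<in>carrier (free_mod R (B 0)). e' (f 0 x) = e x) \<and>
    (\<forall>i. \<forall>x\<in>carrier (free_mod R (B (Suc i))). d' i (f (Suc i) x) = f i (d i x))" ..
  then have f: "\<And>i. f i \<in> module_hom R (free_mod R (B i)) (free_mod R (B' i))"
    "\<And>x. x \<in> carrier (free_mod R (B 0)) \<Longrightarrow> e' (f 0 x) = e x"
    "\<And>i x. x \<in> carrier (free_mod R (B (Suc i))) \<Longrightarrow> d' i (f (Suc i) x) = f i (d i x)"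
    by simp_all
  from chain_lift[OF M res(2,1)] obtain g where "(\<forall>i. g i \<in> module_hom R (free_mod R (B' i)) (free_mod R (B i))) \<and>
    (\<forall>x\<in>carrier (free_mod R (B' 0)). e (g 0 x) = e' x) \<and>
    (\<forall>i. \<forall>x\<in>carrier (free_mod R (B' (Suc i))). d i (g (Suc i) x) = g i (d' i x))" ..
  then have g: "\<And>i. g i \<in> module_hom R (free_mod R (B' i)) (free_mod R (B i))"
    "\<And>x. x \<in> carrier (free_mod R (B' 0)) \<Longrightarrow> e (g 0 x) = e' x"
    "\<And>i x. x \<in> carrier (free_mod R (B' (Suc i))) \<Longrightarrow> d i (g (Suc i) x) = g i (d' i x)"
    by simp_all
  note fc = module_homD(1)[OF f(1)] and gc = module_homD(1)[OF g(1)]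
  have dc: "\<And>i x. x \<in> carrier (free_mod R (B (Suc i))) \<Longrightarrow> d i x \<in> carrier (free_mod R (B i))"
    "\<And>i x. x \<in> carrier (free_mod R (B' (Suc i))) \<Longrightarrow> d' i x \<in> carrier (free_mod R (B' i))"
    using module_homD(1)[OF r(2)] module_homD(1)[OF r'(2)] by auto
  have fm: "f i x \<in> mcyc B' d' i" if "x \<in> mcyc B d i" for i x
    using that fc red_hom_0[OF f(1)] dc f(3) by (cases i) (auto simp: mcyc_def)
  have gm: "g i x \<in> mcyc B d i" if "x \<in> mcyc B' d' i" for i x
    using that gc red_hom_0[OF g(1)] dc g(3) by (cases i) (auto simp: mcyc_def)
  \<comment> \<open>The identity and the composite both lift the identity of \<open>M\<close>, hence
    are homotopic.\<close>
  have gf: "\<exists>y\<in>carrier (free_mod R (B (Suc i))). \<forall>b. red x b = red (g i (f i x)) b + red (d i y) b"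
    if "x \<in> mcyc B d i" for x
    by (rule mcyc_homotopic[OF M res(1,1), where f = "\<lambda>i x. x" and g = "\<lambda>i x. g i (f i x)"])
      (use that f g fc gc in \<open>auto intro!: module_hom_id module_hom_comp[OF f(1) g(1)]\<close>)
  have fg: "\<exists>y\<in>carrier (free_mod R (B' (Suc i))). \<forall>b. red x b = red (f i (g i x)) b + red (d' i y) b"
    if "x \<in> mcyc B' d' i" for x
    by (rule mcyc_homotopic[OF M res(2,2), where f = "\<lambda>i x. x" and g = "\<lambda>i x. f i (g i x)"])
      (use that f g fc gc in \<open>auto intro!: module_hom_id module_hom_comp[OF g(1) f(1)]\<close>)
  show ?thesis
  proof (intro exI[of _ "f i"] conjI ballI)
    show "f i x \<in> mcyc B' d' i" if "x \<in> mcyc B d i" for x using fm that .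
    fix x assume x: "x \<in> mcyc B d i"
    then have xc: "x \<in> carrier (free_mod R (B i))" by (simp add: mcyc_def)
    show "f i x \<in> mbd B' d' i \<longleftrightarrow> x \<in> mbd B d i"
    proof
      assume "x \<in> mbd B d i"
      then obtain y where y: "y \<in> carrier (free_mod R (B (Suc i)))" "red x = red (d i y)" by (auto simp: mbd_def)
      have "red (f i x) = red (d' i (f (Suc i) y))"
        using red_hom_cong[OF f(1) xc dc(1)[OF y(1)] y(2)] f(3)[OF y(1)] by simp
      then show "f i x \<in> mbd B' d' i" using fc[OF xc] fc[OF y(1)] by (auto simp: mbd_def)
    next
      assume "f i x \<in> mbd B' d' i"
      then obtain y where y: "y \<in> carrier (free_mod R (B' (Suc i)))" "red (f i x) = red (d' i y)" by (auto simp: mbd_def)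
      have 1: "red (g i (f i x)) = red (d i (g (Suc i) y))"
        using red_hom_cong[OF g(1) fc[OF xc] dc(2)[OF y(1)] y(2)] g(3)[OF y(1)] by simp
      obtain w where w: "w \<in> carrier (free_mod R (B (Suc i)))" "\<forall>b. red x b = red (g i (f i x)) b + red (d i w) b"
        using gf[OF x] by blast
      let ?u = "g (Suc i) y \<oplus>\<^bsub>free_mod R (B (Suc i))\<^esub> w"
      have du: "d i ?u = d i (g (Suc i) y) \<oplus>\<^bsub>free_mod R (B i)\<^esub> d i w"
        by (rule module_homD(2)[OF r(2) gc[OF y(1)] w(1)])
      have "red (d i ?u) b = red (d i (g (Suc i) y)) b + red (d i w) b" for b
        unfolding du using red_add[OF dc(1)[OF gc[OF y(1)]] dc(1)[OF w(1)]] by simp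
      then have "red x = red (d i ?u)"
        using w(2) 1 by (simp add: fun_eq_iff del: free_mod_simps)
      moreover have "?u \<in> carrier (free_mod R (B (Suc i)))" using free_mod_closed(1)[OF gc[OF y(1)] w(1)] by simp
      ultimately show "x \<in> mbd B d i" using xc by (auto simp: mbd_def)
    qed
  next
    fix z assume "z \<in> mcyc B' d' i"
    then show "\<exists>x\<in>mcyc B d i. \<exists>y\<in>carrier (free_mod R (B' (Suc i))). \<forall>b. red z b = red (f i x) b + red (d' i y) b"
      using fg gm by blast
  qed (rule f(1))
qed

end

section \<open>Tensor products as cosets of the bilinearity relations\<close>

lemma tensor_free_simps [simp]:
  "monoid.mult (tensor_free M N) = (+)" "\<one>\<^bsub>tensor_free M N\<^esub> = 0"
  by (simp_all add: tensor_free_def fun_eq_iff)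

lemma tensor_free_carrier: "a \<in> carrier (tensor_free M N) \<longleftrightarrow> Poly_Mapping.keys a \<subseteq> carrier M \<times> carrier N"
  by (simp add: tensor_free_def carrier_free_Abelian_group_iff)

lemma group_tensor_free: "group (tensor_free M N)"
  by (simp add: tensor_free_def)

lemma tensor_free_inv: "a \<in> carrier (tensor_free M N) \<Longrightarrow> inv\<^bsub>tensor_free M N\<^esub> a = - a"
  by (simp add: tensor_free_def inv_free_Abelian_group carrier_free_Abelian_group_iff)

definition tensor_gens where
  "tensor_gens R M N =
     {frag_of (x \<oplus>\<^bsub>M\<^esub> x', y) - frag_of (x, y) - frag_of (x', y) | x x' y.
         x \<in> carrier M \<and> x' \<in> carrier M \<and> y \<in> carrier N} \<union>
      {frag_of (x, y \<oplus>\<^bsub>N\<^esub> y') - frag_of (x, y) - frag_of (x, y') | x y y'.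
         x \<in> carrier M \<and> y \<in> carrier N \<and> y' \<in> carrier N} \<union>
      {frag_of (r \<odot>\<^bsub>M\<^esub> x, y) - frag_of (x, r \<odot>\<^bsub>N\<^esub> y) | r x y.
         r \<in> carrier R \<and> x \<in> carrier M \<and> y \<in> carrier N}"

lemma tensor_rels_eq: "tensor_rels R M N = generate (tensor_free M N) (tensor_gens R M N)"
  by (simp add: tensor_rels_def tensor_gens_def)

lemma keys_frag_diff: "Poly_Mapping.keys (frag_of p - frag_of q) \<subseteq> {p, q}"
  using keys_diff[of "frag_of p" "frag_of q"] by (auto simp: keys_frag_of)

lemma keys_frag_diff2: "Poly_Mapping.keys (frag_of p - frag_of q - frag_of s) \<subseteq> {p, q, s}"
  using keys_diff[of "frag_of p - frag_of q" "frag_of s"] keys_frag_diff[of p q] by (auto simp: keys_frag_of)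

lemma tensor_gens_carrier:
  assumes "module R M" "module R N"
  shows "tensor_gens R M N \<subseteq> carrier (tensor_free M N)"
proof -
  interpret M: module R M by fact
  interpret N: module R N by fact
  show ?thesis
  proof
    fix a assume "a \<in> tensor_gens R M N"
    then consider x x' y where "a = frag_of (x \<oplus>\<^bsub>M\<^esub> x', y) - frag_of (x, y) - frag_of (x', y)"
        "x \<in> carrier M" "x' \<in> carrier M" "y \<in> carrier N"
      | x y y' where "a = frag_of (x, y \<oplus>\<^bsub>N\<^esub> y') - frag_of (x, y) - frag_of (x, y')"
        "x \<in> carrier M" "y \<in> carrier N" "y' \<in> carrier N"
      | r x y where "a = frag_of (r \<odot>\<^bsub>M\<^esub> x, y) - frag_of (x, r \<odot>\<^bsub>N\<^esub> y)"
        "r \<in> carrier R" "x \<in> carrier M" "y \<in> carrier N"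
      unfolding tensor_gens_def by blast
    then show "a \<in> carrier (tensor_free M N)"
    proof cases
      case 1
      then show ?thesis
        using keys_frag_diff2[of "(x \<oplus>\<^bsub>M\<^esub> x', y)" "(x, y)" "(x', y)"] by (auto simp: tensor_free_carrier)
    next
      case 2
      then show ?thesis
        using keys_frag_diff2[of "(x, y \<oplus>\<^bsub>N\<^esub> y')" "(x, y)" "(x, y')"] by (auto simp: tensor_free_carrier)
    next
      case 3
      then show ?thesis
        using keys_frag_diff[of "(r \<odot>\<^bsub>M\<^esub> x, y)" "(x, r \<odot>\<^bsub>N\<^esub> y)"] by (auto simp: tensor_free_carrier)
    qed
  qed
qed

lemma tensor_rels_closed:
  assumes "module R M" "module R N"
  shows "0 \<in> tensor_rels R M N"
    "a \<in> tensor_rels R M N \<Longrightarrow> b \<in> tensor_rels R M N \<Longrightarrow> a + b \<in> tensor_rels R M N"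
    "a \<in> tensor_rels R M N \<Longrightarrow> - a \<in> tensor_rels R M N"
    "a \<in> tensor_rels R M N \<Longrightarrow> b \<in> tensor_rels R M N \<Longrightarrow> a - b \<in> tensor_rels R M N"
    "a \<in> tensor_rels R M N \<Longrightarrow> a \<in> carrier (tensor_free M N)"
proof -
  note c = tensor_gens_carrier[OF assms]
  show "0 \<in> tensor_rels R M N"
    using generate.one[of "tensor_free M N"] by (simp add: tensor_rels_eq)
  show add: "a + b \<in> tensor_rels R M N" if "a \<in> tensor_rels R M N" "b \<in> tensor_rels R M N" for a b
    using generate.eng[of a "tensor_free M N" _ b] that by (simp add: tensor_rels_eq)
  show car: "a \<in> carrier (tensor_free M N)" if "a \<in> tensor_rels R M N" for a
    using group.generate_in_carrier[OF group_tensor_free c] that by (simp add: tensor_rels_eq)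
  show neg: "- a \<in> tensor_rels R M N" if "a \<in> tensor_rels R M N" for a
    using group.generate_m_inv_closed[OF group_tensor_free c, of a] car[OF that] that
    by (simp add: tensor_rels_eq tensor_free_inv)
  show "a - b \<in> tensor_rels R M N" if "a \<in> tensor_rels R M N" "b \<in> tensor_rels R M N" for a b
    using add[OF that(1) neg[OF that(2)]] by simp
qed

text \<open>Zero and differences already give negatives and sums, so one closure condition covers
  the generated subgroup.\<close>

lemma tensor_rels_induct [consumes 3, case_names zero incl diff]:
  assumes "module R M" "module R N" "h \<in> tensor_rels R M N"
    and "P 0" "\<And>a. a \<in> tensor_gens R M N \<Longrightarrow> P a" "\<And>a b. P a \<Longrightarrow> P b \<Longrightarrow> P (a - b)"
  shows "P h"
proof -
  note c = tensor_gens_carrier[OF assms(1,2)]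
  have neg: "P (- a)" if "P a" for a using assms(6)[OF assms(4) that] by simp
  from assms(3)[unfolded tensor_rels_eq] show ?thesis
  proof (induction rule: generate.induct)
    case (inv h)
    then show ?case using neg assms(5) c by (auto simp: tensor_free_inv)
  next
    case (eng h1 h2)
    then show ?case using assms(6)[OF eng.IH(1) neg[OF eng.IH(2)]] by simp
  qed (use assms in auto)
qed

definition tcoset where
  "tcoset R M N a = r_coset (tensor_free M N) (tensor_rels R M N) a"

lemma tcoset_eq: "tcoset R M N a = {h + a | h. h \<in> tensor_rels R M N}"
  by (auto simp: tcoset_def r_coset_def)

lemma tcoset_eq_iff:
  assumes "module R M" "module R N"
  shows "tcoset R M N a = tcoset R M N b \<longleftrightarrow> a - b \<in> tensor_rels R M N"
proof
  assume "tcoset R M N a = tcoset R M N b"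
  moreover have "a \<in> tcoset R M N a" using tensor_rels_closed(1)[OF assms] by (force simp: tcoset_eq)
  ultimately show "a - b \<in> tensor_rels R M N" by (auto simp: tcoset_eq)
next
  assume ab: "a - b \<in> tensor_rels R M N"
  have "h + a \<in> tcoset R M N b" if "h \<in> tensor_rels R M N" for h
  proof -
    have "h + a = (h + (a - b)) + b" by simp
    then show ?thesis using tensor_rels_closed(2)[OF assms that ab] unfolding tcoset_eq by blast
  qed
  moreover have "h + b \<in> tcoset R M N a" if "h \<in> tensor_rels R M N" for h
  proof -
    have "h + b = (h - (a - b)) + a" by simp
    then show ?thesis using tensor_rels_closed(4)[OF assms that ab] unfolding tcoset_eq by blast
  qed
  ultimately show "tcoset R M N a = tcoset R M N b" by (auto simp: tcoset_eq)
qed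

lemma tensor_product_simps:
  "carrier (tensor_product R M N) = tcoset R M N ` carrier (tensor_free M N)"
  "\<zero>\<^bsub>tensor_product R M N\<^esub> = tcoset R M N 0"
  by (auto simp: tensor_product_def FactGroup_def RCOSETS_def tcoset_eq r_coset_def)

lemma tensor_product_add:
  assumes "module R M" "module R N"
  shows "tcoset R M N a \<oplus>\<^bsub>tensor_product R M N\<^esub> tcoset R M N b = tcoset R M N (a + b)"
proof -
  note c = tensor_rels_closed[OF assms]
  have "set_mult (tensor_free M N) (tcoset R M N a) (tcoset R M N b) = tcoset R M N (a + b)"
  proof (intro equalityI subsetI)
    fix z assume "z \<in> set_mult (tensor_free M N) (tcoset R M N a) (tcoset R M N b)"
    then obtain h k where "h \<in> tensor_rels R M N" "k \<in> tensor_rels R M N" "z = (h + a) + (k + b)"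
      by (auto simp: set_mult_def tcoset_eq)
    then have "h + k \<in> tensor_rels R M N" "z = (h + k) + (a + b)" using c(2) by (auto simp: algebra_simps)
    then show "z \<in> tcoset R M N (a + b)" unfolding tcoset_eq by blast
  next
    fix z assume "z \<in> tcoset R M N (a + b)"
    then obtain h where h: "h \<in> tensor_rels R M N" "z = (h + a) + (0 + b)" by (auto simp: tcoset_eq algebra_simps)
    then show "z \<in> set_mult (tensor_free M N) (tcoset R M N a) (tcoset R M N b)"
      using c(1) unfolding set_mult_def tcoset_eq by fastforce
  qed
  then show ?thesis by (simp add: tensor_product_def FactGroup_def)
qed

text \<open>The map on formal sums takes generating relations to generating relations, so the
  resulting coset does not depend on the representative.\<close>

lemma tensor_map_tcoset:
  assumes "module R M" "module R M'" "module R N" and f: "f \<in> module_hom R M M'"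
  shows "tensor_map R M' N f (tcoset R M N a) = tcoset R M' N (frag_extend (\<lambda>(x, y). frag_of (f x, y)) a)"
proof -
  interpret M: module R M by fact
  interpret M': module R M' by fact
  let ?g = "frag_extend (\<lambda>(x, y). frag_of (f x, y))"
  note c = tensor_rels_closed[OF assms(2,3)]
  have fc: "x \<in> carrier M \<Longrightarrow> f x \<in> carrier M'" for x using M.module_homD(1)[OF f] .
  have g: "?g h \<in> tensor_rels R M' N" if "h \<in> tensor_rels R M N" for h
    using assms(1,3) that
  proof (induction rule: tensor_rels_induct)
    case (incl a)
    then have "?g a \<in> tensor_gens R M' N"
      unfolding tensor_gens_def
      apply (elim UnE CollectE exE conjE)
        apply (auto simp: frag_extend_diff M.module_homD(2,3)[OF f] fc)
      using fc by metis+
    then show ?case unfolding tensor_rels_eq by (rule generate.incl)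
  qed (auto simp: frag_extend_diff c)
  have "set_mult (tensor_free M' N) (tensor_rels R M' N) (?g ` tcoset R M N a) = tcoset R M' N (?g a)"
  proof (intro equalityI subsetI)
    fix z assume "z \<in> set_mult (tensor_free M' N) (tensor_rels R M' N) (?g ` tcoset R M N a)"
    then obtain h k where hk: "h \<in> tensor_rels R M' N" "k \<in> tensor_rels R M N" "z = h + ?g (k + a)"
      by (auto simp: set_mult_def tcoset_eq)
    then have "z = (h + ?g k) + ?g a" by (simp add: frag_extend_add algebra_simps)
    then show "z \<in> tcoset R M' N (?g a)" using c(2)[OF hk(1) g[OF hk(2)]] unfolding tcoset_eq by blast
  next
    fix z assume "z \<in> tcoset R M' N (?g a)"
    then obtain h where h: "h \<in> tensor_rels R M' N" "z = h + ?g (0 + a)" by (auto simp: tcoset_eq)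
    moreover have "0 + a \<in> tcoset R M N a" using tensor_rels_closed(1)[OF assms(1,3)] unfolding tcoset_eq by blast
    ultimately show "z \<in> set_mult (tensor_free M' N) (tensor_rels R M' N) (?g ` tcoset R M N a)"
      unfolding set_mult_def by auto
  qed
  then show ?thesis by (simp add: tensor_map_def)
qed

lemma tensor_product_smult: "r \<odot>\<^bsub>tensor_product R M N\<^esub> Y = tensor_map R M N (\<lambda>x. r \<odot>\<^bsub>M\<^esub> x) Y"
  by (simp add: tensor_product_def tensor_map_def)

lemma (in module) smult_hom: "r \<in> carrier R \<Longrightarrow> (\<lambda>x. r \<odot>\<^bsub>M\<^esub> x) \<in> module_hom R M M"
  unfolding module_hom_def by (auto simp: smult_r_distr simp flip: smult_assoc1) (simp add: R.m_comm)

subsection \<open>Tensoring free modules with the residue field\<close>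

lemma (in cring) neg_one_cancel:
  "x \<in> carrier R \<Longrightarrow> y \<in> carrier R \<Longrightarrow> (x \<oplus> (\<ominus> \<one>) \<otimes> y) \<oplus> y = x"
  "y \<in> carrier R \<Longrightarrow> (\<ominus> \<one>) \<otimes> y \<oplus> y = \<zero>"
  by (simp_all add: l_minus a_assoc l_neg)

text \<open>These conditions say that \<open>N\<close> is a copy of k: generated by
  \<open>u\<close>, with the kernel of \<epsilon> killing \<open>u\<close>, and with \<eta> as
  coordinate. They suffice to identify the tensor product of a free module and \<open>N\<close> with
  the residues of the free module.\<close>

locale residue_tensor = residue_map R \<epsilon> + N?: module R N for R (structure) and \<epsilon> :: "'a \<Rightarrow> 'k::field" and N :: "('a, 'n, 'z) module_scheme" +
  fixes u and \<eta> :: "'n \<Rightarrow> 'k"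
  assumes u: "u \<in> carrier N"
    and cyclic: "y \<in> carrier N \<Longrightarrow> \<exists>r\<in>carrier R. y = r \<odot>\<^bsub>N\<^esub> u"
    and \<eta>_add: "y \<in> carrier N \<Longrightarrow> y' \<in> carrier N \<Longrightarrow> \<eta> (y \<oplus>\<^bsub>N\<^esub> y') = \<eta> y + \<eta> y'"
    and \<eta>_smult: "r \<in> carrier R \<Longrightarrow> y \<in> carrier N \<Longrightarrow> \<eta> (r \<odot>\<^bsub>N\<^esub> y) = \<epsilon> r * \<eta> y"
    and \<eta>_u: "\<eta> u = 1"
    and annih: "r \<in> carrier R \<Longrightarrow> \<epsilon> r = 0 \<Longrightarrow> r \<odot>\<^bsub>N\<^esub> u = \<zero>\<^bsub>N\<^esub>"
begin

abbreviation "FB \<equiv> free_mod R"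
abbreviation "TR B \<equiv> tensor_rels R (FB B) N"

definition ten :: "nat set \<Rightarrow> (nat \<Rightarrow> 'a) \<Rightarrow> ((nat \<Rightarrow> 'a) \<times> 'n \<Rightarrow>\<^sub>0 int) set" where
  "ten B x = tcoset R (FB B) N (frag_of (x, u))"

lemmas trc = tensor_rels_closed[OF free_module N.module_axioms]

lemma tensor_gen_rel: "a \<in> tensor_gens R (FB B) N \<Longrightarrow> a \<in> TR B"
  unfolding tensor_rels_eq by (rule generate.incl)

lemma rel_add:
  assumes "x \<in> carrier (FB B)" "x' \<in> carrier (FB B)" "y \<in> carrier N"
  shows "frag_of (x \<oplus>\<^bsub>FB B\<^esub> x', y) - frag_of (x, y) - frag_of (x', y) \<in> TR B"
  by (rule tensor_gen_rel) (use assms in \<open>auto simp: tensor_gens_def simp del: free_mod_simps\<close>)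

lemma rel_smult:
  assumes "r \<in> carrier R" "x \<in> carrier (FB B)" "y \<in> carrier N"
  shows "frag_of (r \<odot>\<^bsub>FB B\<^esub> x, y) - frag_of (x, r \<odot>\<^bsub>N\<^esub> y) \<in> TR B"
  by (rule tensor_gen_rel) (use assms in \<open>auto simp: tensor_gens_def simp del: free_mod_simps\<close>)

lemma rel_zero_right:
  assumes "x \<in> carrier (FB B)"
  shows "frag_of (x, \<zero>\<^bsub>N\<^esub>) \<in> TR B"
proof -
  have "frag_of (x, \<zero>\<^bsub>N\<^esub> \<oplus>\<^bsub>N\<^esub> \<zero>\<^bsub>N\<^esub>) - frag_of (x, \<zero>\<^bsub>N\<^esub>) - frag_of (x, \<zero>\<^bsub>N\<^esub>) \<in> TR B"
    by (rule tensor_gen_rel) (use assms in \<open>unfold tensor_gens_def, blast intro: N.M.zero_closed\<close>)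
  then have "- frag_of (x, \<zero>\<^bsub>N\<^esub>) \<in> TR B" by simp
  from trc(3)[OF this] show ?thesis by simp
qed

text \<open>The bilinear form sending \<open>(x, y)\<close> to the product of the residue of
  \<open>x b\<close> and the coordinate of \<open>y\<close>, extended to formal sums. It kills the
  relations and so detects residues of tensors.\<close>

definition pairing :: "nat \<Rightarrow> ((nat \<Rightarrow> 'a) \<times> 'n \<Rightarrow>\<^sub>0 int) \<Rightarrow> 'k" where
  "pairing b a = (\<Sum>p\<in>Poly_Mapping.keys a. of_int (Poly_Mapping.lookup a p) * (\<epsilon> (fst p b) * \<eta> (snd p)))"

lemma pairing_superset:
  assumes "finite S" "Poly_Mapping.keys a \<subseteq> S"
  shows "pairing b a = (\<Sum>p\<in>S. of_int (Poly_Mapping.lookup a p) * (\<epsilon> (fst p b) * \<eta> (snd p)))"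
  unfolding pairing_def using assms by (intro sum.mono_neutral_left) (auto simp: in_keys_iff)

lemma pairing_diff: "pairing b (a - a') = pairing b a - pairing b a'"
proof -
  let ?S = "Poly_Mapping.keys a \<union> Poly_Mapping.keys a'"
  have "Poly_Mapping.keys (a - a') \<subseteq> ?S" by (rule keys_diff)
  then show ?thesis
    by (simp add: pairing_superset[of ?S] lookup_minus left_diff_distrib sum_subtractf)
qed

lemma pairing_frag_of: "pairing b (frag_of (x, y)) = \<epsilon> (x b) * \<eta> y"
  by (simp add: pairing_def)

lemma pairing_rels:
  assumes "h \<in> TR B"
  shows "pairing b h = 0"
  using free_module N.module_axioms assms
proof (induction rule: tensor_rels_induct)
  case (incl a)
  then show ?case
    unfolding tensor_gens_def
    by (auto simp: pairing_diff pairing_frag_of \<epsilon>_add \<epsilon>_mult \<eta>_add \<eta>_smult free_mod_closed distrib_left distrib_right)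
qed (simp_all add: pairing_diff, simp add: pairing_def)

text \<open>Such an \<open>x\<close> is a sum of multiples of unit vectors with coefficients of
  residue 0; each coefficient moves across the tensor sign and annihilates \<open>u\<close>.\<close>

lemma rel_null:
  assumes "x \<in> carrier (FB B)" "red x = (\<lambda>b. 0)"
  shows "frag_of (x, u) \<in> TR B"
  using assms
proof (induction rule: free_induct)
  case zero
  have "frag_of (\<zero> \<odot>\<^bsub>FB B\<^esub> (\<lambda>b. \<zero>), u) - frag_of (\<lambda>b. \<zero>, \<zero> \<odot>\<^bsub>N\<^esub> u) \<in> TR B"
    by (rule rel_smult) (simp_all add: u free_mod_closed)
  then have "frag_of (\<lambda>b. \<zero>, u) - frag_of (\<lambda>b. \<zero>, \<zero>\<^bsub>N\<^esub>) \<in> TR B" using u by simp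
  from trc(2)[OF this rel_zero_right[OF free_mod_closed(4)]] show ?case by simp
next
  case (add b r y)
  have y: "red y i = 0 \<and> (i = b \<longrightarrow> \<epsilon> r = 0)" for i
    using fun_cong[OF add.prems, of i] add(2,4) free_mod_closed(5)[OF add(3), of i]
    by (cases "i = b") (auto simp: red_def unit_vec_def \<epsilon>_add)
  have r: "\<epsilon> r = 0" using y[of b] by simp
  have v: "unit_vec b \<in> carrier (FB B)" using add(1) by (rule unit_vec_closed)
  have rv: "r \<odot>\<^bsub>FB B\<^esub> unit_vec b \<in> carrier (FB B)" using v add(2) by (simp add: free_mod_closed)
  have "frag_of (r \<odot>\<^bsub>FB B\<^esub> unit_vec b, u) - frag_of (unit_vec b, r \<odot>\<^bsub>N\<^esub> u) \<in> TR B"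
    by (rule rel_smult[OF add(2) v u])
  then have "frag_of (r \<odot>\<^bsub>FB B\<^esub> unit_vec b, u) - frag_of (unit_vec b, \<zero>\<^bsub>N\<^esub>) \<in> TR B"
    unfolding annih[OF add(2) r] .
  from trc(2)[OF this rel_zero_right[OF v]] have 1: "frag_of (r \<odot>\<^bsub>FB B\<^esub> unit_vec b, u) \<in> TR B" by simp
  have 2: "frag_of (y, u) \<in> TR B" using add y by auto
  from trc(2)[OF trc(2)[OF rel_add[OF add(3) rv u] 2] 1]
  show ?case by simp
qed

lemma ten_add:
  assumes "x \<in> carrier (FB B)" "y \<in> carrier (FB B)"
  shows "ten B (x \<oplus>\<^bsub>FB B\<^esub> y) = ten B x \<oplus>\<^bsub>tensor_product R (FB B) N\<^esub> ten B y"
  unfolding ten_def tensor_product_add[OF free_module N.module_axioms] tcoset_eq_iff[OF free_module N.module_axioms]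
  using rel_add[OF assms u] by (simp add: diff_diff_eq del: free_mod_simps)

lemma ten_map:
  assumes f: "f \<in> module_hom R (FB B) (FB B')"
  shows "tensor_map R (FB B') N f (ten B x) = ten B' (f x)"
  unfolding ten_def tensor_map_tcoset[OF free_module free_module N.module_axioms f] by simp

lemma ten_smult:
  assumes "r \<in> carrier R"
  shows "r \<odot>\<^bsub>tensor_product R (FB B) N\<^esub> ten B x = ten B (r \<odot>\<^bsub>FB B\<^esub> x)"
  unfolding tensor_product_smult by (rule ten_map[OF module.smult_hom[OF free_module assms]])

lemma ten_zero: "\<zero>\<^bsub>tensor_product R (FB B) N\<^esub> = ten B (\<lambda>b. \<zero>)"
  unfolding ten_def tensor_product_simps tcoset_eq_iff[OF free_module N.module_axioms]
  using trc(3)[OF rel_null[OF free_mod_closed(4)]] by (simp add: red_def)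

text \<open>The pairing shows that equal tensors have equal residues; conversely
  \<open>x - y\<close> has residue 0 and its tensor with \<open>u\<close> is a relation.\<close>

lemma ten_eq_iff:
  assumes x: "x \<in> carrier (FB B)" and y: "y \<in> carrier (FB B)"
  shows "ten B x = ten B y \<longleftrightarrow> red x = red y"
proof
  assume "ten B x = ten B y"
  then have "frag_of (x, u) - frag_of (y, u) \<in> TR B"
    unfolding ten_def tcoset_eq_iff[OF free_module N.module_axioms] .
  from pairing_rels[OF this] show "red x = red y"
    by (simp add: pairing_diff pairing_frag_of \<eta>_u red_def fun_eq_iff)
next
  assume eq: "red x = red y"
  let ?z = "\<lambda>b. x b \<oplus> (\<ominus> \<one>) \<otimes> y b"
  have m1: "\<ominus> \<one> \<in> carrier R" by simp
  have ym: "(\<lambda>b. (\<ominus> \<one>) \<otimes> y b) \<in> carrier (FB B)" using y m1 by (rule free_mod_closed)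
  have z: "?z \<in> carrier (FB B)" using x ym by (rule free_mod_closed)
  have cx: "x b \<in> carrier R" "y b \<in> carrier R" for b using x y by (simp_all add: free_mod_closed)
  have "red ?z = (\<lambda>b. 0)"
  proof
    fix b
    have "\<epsilon> (x b \<oplus> (\<ominus> \<one>) \<otimes> y b) + \<epsilon> (y b) = \<epsilon> ((x b \<oplus> (\<ominus> \<one>) \<otimes> y b) \<oplus> y b)"
      using cx by (simp add: \<epsilon>_add)
    also have "(x b \<oplus> (\<ominus> \<one>) \<otimes> y b) \<oplus> y b = x b"
      using cx[of b] by (simp add: neg_one_cancel)
    finally show "red ?z b = 0" using fun_cong[OF eq, of b] by (simp add: red_def)
  qed
  then have 1: "frag_of (?z, u) \<in> TR B" by (rule rel_null[OF z])
  have "?z \<oplus>\<^bsub>FB B\<^esub> y = x"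
    using cx by (simp add: fun_eq_iff neg_one_cancel)
  then have "frag_of (x, u) - frag_of (?z, u) - frag_of (y, u) \<in> TR B"
    using rel_add[OF z y u] by simp
  from trc(2)[OF this 1] show "ten B x = ten B y"
    unfolding ten_def tcoset_eq_iff[OF free_module N.module_axioms] by simp
qed

text \<open>A second factor has the form \<open>r\<close> times \<open>u\<close>. Moving
  \<open>r\<close> to the left makes all second factors equal, and a formal sum collapses to one
  tensor.\<close>

lemma ten_surj: "carrier (tensor_product R (FB B) N) = ten B ` carrier (FB B)"
proof (intro equalityI subsetI)
  fix Y assume "Y \<in> carrier (tensor_product R (FB B) N)"
  then obtain a where a: "Poly_Mapping.keys a \<subseteq> carrier (FB B) \<times> carrier N" "Y = tcoset R (FB B) N a"
    by (auto simp: tensor_product_simps tensor_free_carrier)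
  from a(1) have "\<exists>x\<in>carrier (FB B). a - frag_of (x, u) \<in> TR B"
  proof (induction rule: frag_induction)
    case zero
    show ?case using trc(3)[OF rel_null[OF free_mod_closed(4)]]
      by (intro bexI[of _ "\<lambda>b. \<zero>"]) (auto simp: red_def free_mod_closed)
  next
    case (one p)
    then obtain x r where p: "p = (x, r \<odot>\<^bsub>N\<^esub> u)" "x \<in> carrier (FB B)" "r \<in> carrier R"
      using cyclic by (cases p) auto
    show ?case
      using trc(3)[OF rel_smult[OF p(3,2) u]] free_mod_closed(2)[OF p(2,3)]
      by (intro bexI[of _ "r \<odot>\<^bsub>FB B\<^esub> x"]) (simp_all add: p(1))
  next
    case (diff a b)
    then obtain x y where x: "x \<in> carrier (FB B)" "a - frag_of (x, u) \<in> TR B"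
      and y: "y \<in> carrier (FB B)" "b - frag_of (y, u) \<in> TR B" by blast
    have m1: "\<ominus> \<one> \<in> carrier R" by simp
    let ?y = "\<lambda>b. (\<ominus> \<one>) \<otimes> y b"
    have ym: "?y \<in> carrier (FB B)" using y(1) m1 by (rule free_mod_closed)
    have cy: "y b \<in> carrier R" for b using y by (simp add: free_mod_closed)
    have z: "x \<oplus>\<^bsub>FB B\<^esub> ?y \<in> carrier (FB B)" using free_mod_closed(1)[OF x(1) ym] by simp
    have "?y \<oplus>\<^bsub>FB B\<^esub> y = (\<lambda>b. \<zero>)" using cy by (simp add: fun_eq_iff neg_one_cancel)
    then have "frag_of (\<lambda>b. \<zero>, u) - frag_of (?y, u) - frag_of (y, u) \<in> TR B"
      using rel_add[OF ym y(1) u] by simp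
    from trc(4)[OF this rel_null[OF free_mod_closed(4)]]
    have 1: "- frag_of (?y, u) - frag_of (y, u) \<in> TR B" by (simp add: red_def)
    have 2: "frag_of (x \<oplus>\<^bsub>FB B\<^esub> ?y, u) - frag_of (x, u) - frag_of (?y, u) \<in> TR B"
      by (rule rel_add[OF x(1) ym u])
    have "(a - frag_of (x, u)) - (b - frag_of (y, u)) - (frag_of (x \<oplus>\<^bsub>FB B\<^esub> ?y, u) - frag_of (x, u) - frag_of (?y, u))
        + (- frag_of (?y, u) - frag_of (y, u)) = a - b - frag_of (x \<oplus>\<^bsub>FB B\<^esub> ?y, u)"
      by (simp del: free_mod_simps)
    with trc(2)[OF trc(4)[OF trc(4)[OF x(2) y(2)] 2] 1]
    have "a - b - frag_of (x \<oplus>\<^bsub>FB B\<^esub> ?y, u) \<in> TR B" by (simp only:)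
    with z show ?case by blast
  qed
  then show "Y \<in> ten B ` carrier (FB B)"
    unfolding a(2) ten_def image_iff tcoset_eq_iff[OF free_module N.module_axioms] .
next
  fix Y assume "Y \<in> ten B ` carrier (FB B)"
  then show "Y \<in> carrier (tensor_product R (FB B) N)"
    using u by (auto simp: tensor_product_simps ten_def tensor_free_carrier keys_frag_of)
qed

end

subsection \<open>Computing Tor from a free resolution\<close>

lemma quotient_module_simps:
  "carrier (quotient_module M S) = A_RCOSETS M S"
  "ring.zero (quotient_module M S) = S"
  "ring.add (quotient_module M S) T Y = set_add M T Y"
  "module.smult (quotient_module M S) r Y = set_add M S (module.smult M r ` Y)"
  by (simp_all add: quotient_module_def)

locale residue_complex = residue_tensor R \<epsilon> N u \<eta>
  for R (structure) and \<epsilon> :: "'a \<Rightarrow> 'k::field" and N :: "('a, 'n, 'z) module_scheme" and u and \<eta> :: "'n \<Rightarrow> 'k" +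
  fixes B :: "nat \<Rightarrow> nat set" and d
  assumes d: "d i \<in> module_hom R (free_mod R (B (Suc i))) (free_mod R (B i))"
begin

abbreviation "CN j \<equiv> tensor_product R (free_mod R (B j)) N"
abbreviation "DN j \<equiv> tensor_map R (free_mod R (B j)) N (d j)"
abbreviation "HN i \<equiv> homology CN DN i"

text \<open>The homology class of \<open>x\<close> tensored with \<open>u\<close>, written out as
  the coset of all boundaries. It makes sense for every \<open>x\<close>, so its additivity and
  linearity need no cycle condition.\<close>

definition hcl :: "nat \<Rightarrow> (nat \<Rightarrow> 'a) \<Rightarrow> ((nat \<Rightarrow> 'a) \<times> 'n \<Rightarrow>\<^sub>0 int) set set" where
  "hcl i x = (\<lambda>y. ten (B i) (d i y \<oplus>\<^bsub>free_mod R (B i)\<^esub> x)) ` carrier (free_mod R (B (Suc i)))"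

lemma dc: "x \<in> carrier (free_mod R (B (Suc i))) \<Longrightarrow> d i x \<in> carrier (free_mod R (B i))"
  using module_homD(1)[OF d] .

lemma mcyc_carrier: "x \<in> mcyc B d i \<Longrightarrow> x \<in> carrier (free_mod R (B i))"
  by (simp add: mcyc_def)

lemma chain_cycles_eq: "chain_cycles CN DN i = ten (B i) ` mcyc B d i"
proof (cases i)
  case 0
  then show ?thesis by (simp add: ten_surj mcyc_def)
next
  case (Suc j)
  have "DN j (ten (B (Suc j)) x) = \<zero>\<^bsub>CN j\<^esub> \<longleftrightarrow> red (d j x) = (\<lambda>b. 0)" if "x \<in> carrier (free_mod R (B (Suc j)))" for x
    unfolding ten_map[OF d] ten_zero ten_eq_iff[OF dc[OF that] free_mod_closed(4)] by (simp add: red_def)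
  then show ?thesis by (auto simp: Suc ten_surj mcyc_def)
qed

lemma boundaries_eq: "DN i ` carrier (CN (Suc i)) = (\<lambda>y. ten (B i) (d i y)) ` carrier (free_mod R (B (Suc i)))"
  by (simp add: ten_surj image_image ten_map[OF d])

lemma coset_eq:
  assumes "x \<in> carrier (free_mod R (B i))"
  shows "(DN i ` carrier (CN (Suc i))) +>\<^bsub>CN i\<lparr>carrier := Z\<rparr>\<^esub> ten (B i) x = hcl i x"
proof -
  let ?A = "carrier (free_mod R (B (Suc i)))"
  have "(DN i ` carrier (CN (Suc i))) +>\<^bsub>CN i\<lparr>carrier := Z\<rparr>\<^esub> ten (B i) x =
      (\<lambda>y. ten (B i) (d i y) \<oplus>\<^bsub>CN i\<^esub> ten (B i) x) ` ?A"
    unfolding a_r_coset_def' boundaries_eq by auto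
  also have "\<dots> = hcl i x"
    unfolding hcl_def by (intro image_cong refl) (simp only: ten_add[OF dc assms])
  finally show ?thesis .
qed

lemma homology_carrier: "carrier (HN i) = hcl i ` mcyc B d i"
proof -
  have "carrier (HN i) = (\<Union>x\<in>mcyc B d i. {(DN i ` carrier (CN (Suc i))) +>\<^bsub>CN i\<lparr>carrier := chain_cycles CN DN i\<rparr>\<^esub> ten (B i) x})"
    unfolding homology_def quotient_module_simps A_RCOSETS_def' by (simp add: chain_cycles_eq)
  also have "\<dots> = hcl i ` mcyc B d i"
    using coset_eq[OF mcyc_carrier] by auto
  finally show ?thesis .
qed

lemma homology_zero: "\<zero>\<^bsub>HN i\<^esub> = hcl i (\<lambda>b. \<zero>)"
proof -
  have "d i y \<oplus>\<^bsub>free_mod R (B i)\<^esub> (\<lambda>b. \<zero>) = d i y" if "y \<in> carrier (free_mod R (B (Suc i)))" for y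
    using dc[OF that] by (simp add: free_mod_closed)
  then have "hcl i (\<lambda>b. \<zero>) = (\<lambda>y. ten (B i) (d i y)) ` carrier (free_mod R (B (Suc i)))"
    unfolding hcl_def by (intro image_cong refl) (simp only:)
  then show ?thesis by (simp only: homology_def quotient_module_simps boundaries_eq)
qed

lemma homology_add:
  assumes x: "x \<in> carrier (free_mod R (B i))" and y: "y \<in> carrier (free_mod R (B i))"
  shows "hcl i x \<oplus>\<^bsub>HN i\<^esub> hcl i y = hcl i (x \<oplus>\<^bsub>free_mod R (B i)\<^esub> y)"
proof -
  let ?F = "free_mod R (B i)" and ?F' = "free_mod R (B (Suc i))"
  interpret F: module R ?F by (rule free_module)
  interpret F': module R ?F' by (rule free_module)
  have e: "ten (B i) (d i a \<oplus>\<^bsub>?F\<^esub> x) \<oplus>\<^bsub>CN i\<^esub> ten (B i) (d i b \<oplus>\<^bsub>?F\<^esub> y) =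
      ten (B i) (d i (a \<oplus>\<^bsub>?F'\<^esub> b) \<oplus>\<^bsub>?F\<^esub> (x \<oplus>\<^bsub>?F\<^esub> y))" if "a \<in> carrier ?F'" "b \<in> carrier ?F'" for a b
  proof -
    have "(d i a \<oplus>\<^bsub>?F\<^esub> x) \<oplus>\<^bsub>?F\<^esub> (d i b \<oplus>\<^bsub>?F\<^esub> y) = d i (a \<oplus>\<^bsub>?F'\<^esub> b) \<oplus>\<^bsub>?F\<^esub> (x \<oplus>\<^bsub>?F\<^esub> y)"
      unfolding module_homD(2)[OF d that] using that x y dc by (simp only: F.M.a_closed F.M.a_assoc F.M.a_lcomm)
    then show ?thesis using that x y dc by (simp only: ten_add[symmetric] F.M.a_closed)
  qed
  have "hcl i x \<oplus>\<^bsub>HN i\<^esub> hcl i y = (\<Union>T\<in>hcl i x. \<Union>Y\<in>hcl i y. {T \<oplus>\<^bsub>CN i\<^esub> Y})"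
    unfolding homology_def quotient_module_simps set_add_def' by simp
  also have "\<dots> = hcl i (x \<oplus>\<^bsub>?F\<^esub> y)"
  proof (intro equalityI subsetI)
    fix W assume "W \<in> (\<Union>T\<in>hcl i x. \<Union>Y\<in>hcl i y. {T \<oplus>\<^bsub>CN i\<^esub> Y})"
    then obtain a b where ab: "a \<in> carrier ?F'" "b \<in> carrier ?F'"
      and W: "W = ten (B i) (d i a \<oplus>\<^bsub>?F\<^esub> x) \<oplus>\<^bsub>CN i\<^esub> ten (B i) (d i b \<oplus>\<^bsub>?F\<^esub> y)" unfolding hcl_def by blast
    show "W \<in> hcl i (x \<oplus>\<^bsub>?F\<^esub> y)"
      unfolding W e[OF ab] hcl_def using F'.M.a_closed[OF ab] by blast
  next
    fix W assume "W \<in> hcl i (x \<oplus>\<^bsub>?F\<^esub> y)"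
    then obtain a where a: "a \<in> carrier ?F'" and W: "W = ten (B i) (d i a \<oplus>\<^bsub>?F\<^esub> (x \<oplus>\<^bsub>?F\<^esub> y))"
      unfolding hcl_def by blast
    have "W = ten (B i) (d i a \<oplus>\<^bsub>?F\<^esub> x) \<oplus>\<^bsub>CN i\<^esub> ten (B i) (d i \<zero>\<^bsub>?F'\<^esub> \<oplus>\<^bsub>?F\<^esub> y)"
      unfolding W e[OF a F'.M.zero_closed] F'.M.r_zero[OF a] ..
    then show "W \<in> (\<Union>T\<in>hcl i x. \<Union>Y\<in>hcl i y. {T \<oplus>\<^bsub>CN i\<^esub> Y})"
      using a F'.M.zero_closed unfolding hcl_def by blast
  qed
  finally show ?thesis .
qed

lemma homology_smult:
  assumes x: "x \<in> carrier (free_mod R (B i))" and r: "r \<in> carrier R"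
  shows "r \<odot>\<^bsub>HN i\<^esub> hcl i x = hcl i (r \<odot>\<^bsub>free_mod R (B i)\<^esub> x)"
proof -
  let ?F = "free_mod R (B i)" and ?F' = "free_mod R (B (Suc i))"
  interpret F: module R ?F by (rule free_module)
  interpret F': module R ?F' by (rule free_module)
  have e: "ten (B i) (d i a) \<oplus>\<^bsub>CN i\<^esub> (r \<odot>\<^bsub>CN i\<^esub> ten (B i) (d i b \<oplus>\<^bsub>?F\<^esub> x)) =
      ten (B i) (d i (a \<oplus>\<^bsub>?F'\<^esub> r \<odot>\<^bsub>?F'\<^esub> b) \<oplus>\<^bsub>?F\<^esub> r \<odot>\<^bsub>?F\<^esub> x)" if "a \<in> carrier ?F'" "b \<in> carrier ?F'" for a b
  proof -
    have "d i (a \<oplus>\<^bsub>?F'\<^esub> r \<odot>\<^bsub>?F'\<^esub> b) \<oplus>\<^bsub>?F\<^esub> r \<odot>\<^bsub>?F\<^esub> x = d i a \<oplus>\<^bsub>?F\<^esub> r \<odot>\<^bsub>?F\<^esub> (d i b \<oplus>\<^bsub>?F\<^esub> x)"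
      unfolding module_homD(2)[OF d that(1) F'.smult_closed[OF r that(2)]] module_homD(3)[OF d that(2) r]
      using that x r dc by (simp only: F.smult_r_distr F.M.a_assoc F.smult_closed)
    then show ?thesis using that x r dc by (simp only: ten_smult ten_add[symmetric] F.M.a_closed F.smult_closed)
  qed
  have "r \<odot>\<^bsub>HN i\<^esub> hcl i x = (\<Union>T\<in>DN i ` carrier (CN (Suc i)). \<Union>Y\<in>(\<lambda>Y. r \<odot>\<^bsub>CN i\<^esub> Y) ` hcl i x. {T \<oplus>\<^bsub>CN i\<^esub> Y})"
    unfolding homology_def quotient_module_simps set_add_def' by simp
  also have "\<dots> = hcl i (r \<odot>\<^bsub>?F\<^esub> x)"
    unfolding boundaries_eq
  proof (intro equalityI subsetI)
    fix W assume "W \<in> (\<Union>T\<in>(\<lambda>y. ten (B i) (d i y)) ` carrier ?F'. \<Union>Y\<in>(\<lambda>Y. r \<odot>\<^bsub>CN i\<^esub> Y) ` hcl i x. {T \<oplus>\<^bsub>CN i\<^esub> Y})"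
    then obtain a b where ab: "a \<in> carrier ?F'" "b \<in> carrier ?F'"
      and W: "W = ten (B i) (d i a) \<oplus>\<^bsub>CN i\<^esub> (r \<odot>\<^bsub>CN i\<^esub> ten (B i) (d i b \<oplus>\<^bsub>?F\<^esub> x))" unfolding hcl_def by blast
    show "W \<in> hcl i (r \<odot>\<^bsub>?F\<^esub> x)"
      unfolding W e[OF ab] hcl_def using F'.M.a_closed[OF ab(1) F'.smult_closed[OF r ab(2)]] by blast
  next
    fix W assume "W \<in> hcl i (r \<odot>\<^bsub>?F\<^esub> x)"
    then obtain a where a: "a \<in> carrier ?F'" and W: "W = ten (B i) (d i a \<oplus>\<^bsub>?F\<^esub> r \<odot>\<^bsub>?F\<^esub> x)"
      unfolding hcl_def by blast
    have "W = ten (B i) (d i a) \<oplus>\<^bsub>CN i\<^esub> (r \<odot>\<^bsub>CN i\<^esub> ten (B i) (d i \<zero>\<^bsub>?F'\<^esub> \<oplus>\<^bsub>?F\<^esub> x))"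
      unfolding W e[OF a F'.M.zero_closed] F'.smult_r_null[OF r] F'.M.r_zero[OF a] ..
    then show "W \<in> (\<Union>T\<in>(\<lambda>y. ten (B i) (d i y)) ` carrier ?F'. \<Union>Y\<in>(\<lambda>Y. r \<odot>\<^bsub>CN i\<^esub> Y) ` hcl i x. {T \<oplus>\<^bsub>CN i\<^esub> Y})"
      using a F'.M.zero_closed unfolding hcl_def by blast
  qed
  finally show ?thesis .
qed

lemma homology_kernel:
  assumes x: "x \<in> carrier (free_mod R (B i))"
  shows "hcl i x = \<zero>\<^bsub>HN i\<^esub> \<longleftrightarrow> x \<in> mbd B d i"
proof -
  let ?F = "free_mod R (B i)" and ?F' = "free_mod R (B (Suc i))"
  interpret F: module R ?F by (rule free_module)
  interpret F': module R ?F' by (rule free_module)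
  have z: "hcl i (\<lambda>b. \<zero>) = (\<lambda>y. ten (B i) (d i y)) ` carrier ?F'"
    using homology_zero[of i] by (simp only: homology_def quotient_module_simps boundaries_eq)
  have add: "ten (B i) (d i a \<oplus>\<^bsub>?F\<^esub> x) = ten (B i) (d i (a \<oplus>\<^bsub>?F'\<^esub> w))"
    if "a \<in> carrier ?F'" "w \<in> carrier ?F'" "ten (B i) x = ten (B i) (d i w)" for a w
    unfolding module_homD(2)[OF d that(1,2)] ten_add[OF dc[OF that(1)] x] ten_add[OF dc[OF that(1)] dc[OF that(2)]] that(3) ..
  show ?thesis
  proof
    assume h0: "hcl i x = \<zero>\<^bsub>HN i\<^esub>"
    have "d i \<zero>\<^bsub>?F'\<^esub> \<oplus>\<^bsub>?F\<^esub> x = x"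
      unfolding module_hom_zero[OF d free_module free_module] by (rule F.M.l_zero[OF x])
    then have t0: "ten (B i) x = ten (B i) (d i \<zero>\<^bsub>?F'\<^esub> \<oplus>\<^bsub>?F\<^esub> x)" by (simp only:)
    have "ten (B i) x \<in> hcl i x" unfolding hcl_def by (rule rev_image_eqI[OF F'.M.zero_closed]) (rule t0)
    then obtain y where y: "y \<in> carrier ?F'" "ten (B i) x = ten (B i) (d i y)"
      unfolding h0 homology_zero z by blast
    then show "x \<in> mbd B d i" using x ten_eq_iff[OF x dc[OF y(1)]] by (auto simp: mbd_def)
  next
    assume "x \<in> mbd B d i"
    then obtain w where w: "w \<in> carrier ?F'" "ten (B i) x = ten (B i) (d i w)"
      using ten_eq_iff[OF x dc] by (auto simp: mbd_def)
    show "hcl i x = \<zero>\<^bsub>HN i\<^esub>"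
      unfolding homology_zero z
    proof (intro equalityI subsetI)
      fix W assume "W \<in> hcl i x"
      then obtain a where a: "a \<in> carrier ?F'" "W = ten (B i) (d i a \<oplus>\<^bsub>?F\<^esub> x)" unfolding hcl_def by blast
      then show "W \<in> (\<lambda>y. ten (B i) (d i y)) ` carrier ?F'"
        using add[OF a(1) w] F'.M.a_closed[OF a(1) w(1)] by blast
    next
      fix W assume "W \<in> (\<lambda>y. ten (B i) (d i y)) ` carrier ?F'"
      then obtain a where a: "a \<in> carrier ?F'" "W = ten (B i) (d i a)" by blast
      let ?a = "a \<ominus>\<^bsub>?F'\<^esub> w"
      have c: "?a \<in> carrier ?F'" using a(1) w(1) by (rule F'.M.minus_closed)
      have "?a \<oplus>\<^bsub>?F'\<^esub> w = a"
        unfolding a_minus_def using a(1) w(1) by (simp only: F'.M.a_assoc F'.M.a_inv_closed F'.M.l_neg F'.M.r_zero)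
      then have "W = ten (B i) (d i ?a \<oplus>\<^bsub>?F\<^esub> x)" using add[OF c w] a(2) by (simp only:)
      then show "W \<in> hcl i x" unfolding hcl_def using c by blast
    qed
  qed
qed

end

context residue_tensor
begin

text \<open>The choice inside \<open>Tor\<close> is known only to be some resolution, and it is one
  because \<open>P\<close> exhibits a resolution. The map sends \<open>x\<close> to the class of its
  image under a comparison map into the chosen resolution.\<close>

theorem Tor_presentation:
  assumes M: "module R M" and P: "free_resolution R M B d e"
  shows "\<exists>\<Theta>. \<Theta> ` mcyc B d i = carrier (Tor R M N i) \<and>
    (\<forall>x\<in>carrier (free_mod R (B i)). \<forall>y\<in>carrier (free_mod R (B i)).
      \<Theta> (x \<oplus>\<^bsub>free_mod R (B i)\<^esub> y) = \<Theta> x \<oplus>\<^bsub>Tor R M N i\<^esub> \<Theta> y) \<and>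
    (\<forall>x\<in>carrier (free_mod R (B i)). \<forall>r\<in>carrier R.
      \<Theta> (r \<odot>\<^bsub>free_mod R (B i)\<^esub> x) = r \<odot>\<^bsub>Tor R M N i\<^esub> \<Theta> x) \<and>
    (\<forall>x\<in>mcyc B d i. \<Theta> x = \<zero>\<^bsub>Tor R M N i\<^esub> \<longleftrightarrow> x \<in> mbd B d i)"
proof -
  obtain B' d' e' where some: "(SOME (B, d, e). free_resolution R M B d e) = (B', d', e')"
    by (cases "SOME (B, d, e). free_resolution R M B d e") auto
  have "case (B, d, e) of (B, d, e) \<Rightarrow> free_resolution R M B d e" using P by simp
  from someI[of "\<lambda>(B, d, e). free_resolution R M B d e", OF this]
  have F: "free_resolution R M B' d' e'" unfolding some by simp
  interpret C: residue_complex R \<epsilon> N u \<eta> B' d'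
    by unfold_locales (rule free_resolutionD(2)[OF F])
  have Tor: "Tor R M N i = C.HN i" by (simp add: Tor_def some)
  from compare_resolutions[OF M P F, of i]
  obtain f where "f \<in> module_hom R (free_mod R (B i)) (free_mod R (B' i)) \<and>
    (\<forall>x\<in>mcyc B d i. f x \<in> mcyc B' d' i \<and> (f x \<in> mbd B' d' i \<longleftrightarrow> x \<in> mbd B d i)) \<and>
    (\<forall>z\<in>mcyc B' d' i. \<exists>x\<in>mcyc B d i. \<exists>y\<in>carrier (free_mod R (B' (Suc i))).
        \<forall>b. red z b = red (f x) b + red (d' i y) b)" ..
  then have f: "f \<in> module_hom R (free_mod R (B i)) (free_mod R (B' i))"
    "\<And>x. x \<in> mcyc B d i \<Longrightarrow> f x \<in> mcyc B' d' i"
    "\<And>x. x \<in> mcyc B d i \<Longrightarrow> f x \<in> mbd B' d' i \<longleftrightarrow> x \<in> mbd B d i"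
    "\<And>z. z \<in> mcyc B' d' i \<Longrightarrow> \<exists>x\<in>mcyc B d i. \<exists>y\<in>carrier (free_mod R (B' (Suc i))).
        \<forall>b. red z b = red (f x) b + red (d' i y) b"
    by simp_all
  note fc = module_homD(1)[OF f(1)]
  interpret F: module R "free_mod R (B' i)" by (rule free_module)
  have car: "C.hcl i (f x) \<in> carrier (C.HN i)" if "x \<in> mcyc B d i" for x
    using f(2)[OF that] by (simp add: C.homology_carrier)
  have surj: "\<exists>x\<in>mcyc B d i. C.hcl i (f x) = C.hcl i z" if z: "z \<in> mcyc B' d' i" for z
  proof -
    obtain x y where x: "x \<in> mcyc B d i" and y: "y \<in> carrier (free_mod R (B' (Suc i)))"
      and eq: "\<forall>b. red z b = red (f x) b + red (d' i y) b" using f(4)[OF z] by blast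
    have fx: "f x \<in> carrier (free_mod R (B' i))" by (rule C.mcyc_carrier[OF f(2)[OF x]])
    have dy: "d' i y \<in> carrier (free_mod R (B' i))" by (rule C.dc[OF y])
    have zc: "z \<in> carrier (free_mod R (B' i))" by (rule C.mcyc_carrier[OF z])
    have dyb: "d' i y \<in> mbd B' d' i" using dy y by (auto simp: mbd_def)
    have "red z = red (f x \<oplus>\<^bsub>free_mod R (B' i)\<^esub> d' i y)"
      using eq red_add[OF fx dy] by (simp add: fun_eq_iff)
    then have "ten (B' i) z = ten (B' i) (f x \<oplus>\<^bsub>free_mod R (B' i)\<^esub> d' i y)"
      unfolding ten_eq_iff[OF zc F.M.a_closed[OF fx dy]] .
    then have "C.hcl i z = C.hcl i (f x \<oplus>\<^bsub>free_mod R (B' i)\<^esub> d' i y)"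
      unfolding C.hcl_def
      by (intro image_cong refl) (simp only: ten_add[OF C.dc zc] ten_add[OF C.dc F.M.a_closed[OF fx dy]])
    also have "\<dots> = C.hcl i (f x) \<oplus>\<^bsub>C.HN i\<^esub> C.hcl i (d' i y)"
      by (rule C.homology_add[OF fx dy, symmetric])
    also have "C.hcl i (d' i y) = C.hcl i (\<lambda>b. \<zero>)"
      using C.homology_kernel[OF dy] dyb C.homology_zero by simp
    also have "C.hcl i (f x) \<oplus>\<^bsub>C.HN i\<^esub> C.hcl i (\<lambda>b. \<zero>) = C.hcl i (f x)"
      using C.homology_add[OF fx free_mod_closed(4)] fx by (simp add: free_mod_closed)
    finally show ?thesis using x by auto
  qed
  show ?thesis
  proof (intro exI[of _ "\<lambda>x. C.hcl i (f x)"] conjI ballI)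
    show "(\<lambda>x. C.hcl i (f x)) ` mcyc B d i = carrier (Tor R M N i)"
    proof (intro equalityI subsetI)
      fix T assume "T \<in> carrier (Tor R M N i)"
      then obtain z where z: "z \<in> mcyc B' d' i" "T = C.hcl i z" unfolding Tor C.homology_carrier by blast
      from surj[OF z(1)] show "T \<in> (\<lambda>x. C.hcl i (f x)) ` mcyc B d i" unfolding z(2) by (metis image_iff)
    qed (use car Tor in auto)
    show "C.hcl i (f (x \<oplus>\<^bsub>free_mod R (B i)\<^esub> y)) = C.hcl i (f x) \<oplus>\<^bsub>Tor R M N i\<^esub> C.hcl i (f y)"
      if "x \<in> carrier (free_mod R (B i))" "y \<in> carrier (free_mod R (B i))" for x y
      unfolding Tor C.homology_add[OF fc[OF that(1)] fc[OF that(2)]] module_homD(2)[OF f(1) that] ..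
    show "C.hcl i (f (r \<odot>\<^bsub>free_mod R (B i)\<^esub> x)) = r \<odot>\<^bsub>Tor R M N i\<^esub> C.hcl i (f x)"
      if "x \<in> carrier (free_mod R (B i))" "r \<in> carrier R" for r x
      unfolding Tor C.homology_smult[OF fc[OF that(1)] that(2)] module_homD(3)[OF f(1) that] ..
    show "C.hcl i (f x) = \<zero>\<^bsub>Tor R M N i\<^esub> \<longleftrightarrow> x \<in> mbd B d i" if "x \<in> mcyc B d i" for x
      unfolding Tor using C.homology_kernel[OF C.mcyc_carrier[OF f(2)[OF that]]] f(3)[OF that] by simp
  qed
qed

end

section \<open>Dimensions of spaces given by a common presentation\<close>

lemma vectorspace_dim_cong:
  fixes V :: "('k, 'v, 'm) module_scheme" and W :: "('k, 'w, 'n) module_scheme"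
  assumes V: "vectorspace K V" and W: "vectorspace K W"
    and h: "h \<in> module_hom K V W" "bij_betw h (carrier V) (carrier W)"
  shows "vectorspace.dim K V = vectorspace.dim K W"
proof -
  interpret V: vectorspace K V by fact
  interpret W: vectorspace K W by fact
  have lm: "linear_map K V W h"
    by (intro linear_map.intro V W mod_hom.intro V.module_axioms W.module_axioms mod_hom_axioms.intro h(1))
  let ?g = "inv_into (carrier V) h"
  have inj: "inj_on h (carrier V)" and surj: "h ` carrier V = carrier W" using h(2) by (auto simp: bij_betw_def)
  have gc: "?g w \<in> carrier V" "h (?g w) = w" if "w \<in> carrier W" for w
    using that surj by (auto intro: inv_into_into f_inv_into_f)
  have gh: "?g (h v) = v" if "v \<in> carrier V" for v using inj that by simp
  have hD: "h (x \<oplus>\<^bsub>V\<^esub> y) = h x \<oplus>\<^bsub>W\<^esub> h y" "h (r \<odot>\<^bsub>V\<^esub> x) = r \<odot>\<^bsub>W\<^esub> h x"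
    if "x \<in> carrier V" "y \<in> carrier V" "r \<in> carrier K" for x y r
    using h(1) that by (auto simp: module_hom_def)
  have g: "?g \<in> module_hom K W V"
    unfolding module_hom_def
  proof (intro CollectI conjI allI impI Pi_I; (elim conjE)?)
    fix x y assume "x \<in> carrier W" "y \<in> carrier W"
    then show "?g (x \<oplus>\<^bsub>W\<^esub> y) = ?g x \<oplus>\<^bsub>V\<^esub> ?g y"
      using hD(1)[of "?g x" "?g y" "\<one>\<^bsub>K\<^esub>"] gc gh[of "?g x \<oplus>\<^bsub>V\<^esub> ?g y"] by simp
  next
    fix r x assume "r \<in> carrier K" "x \<in> carrier W"
    then show "?g (r \<odot>\<^bsub>W\<^esub> x) = r \<odot>\<^bsub>V\<^esub> ?g x"
      using hD(2)[of "?g x" "?g x" r] gc gh[of "r \<odot>\<^bsub>V\<^esub> ?g x"] by simp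
  qed (use gc in auto)
  have lm': "linear_map K W V ?g"
    by (intro linear_map.intro V W mod_hom.intro V.module_axioms W.module_axioms mod_hom_axioms.intro g)
  have surj': "?g ` carrier W = carrier V" using bij_betw_inv_into[OF h(2)] by (simp add: bij_betw_def)
  show ?thesis
  proof (cases "V.fin_dim")
    case True
    then show ?thesis by (rule linear_map.dim_eq[OF lm _ inj surj])
  next
    \<comment> \<open>The dimension is the least size of a finite generating set. If there is none,
      the two predicates are both constantly false, so their least elements coincide.\<close>
    case False
    then have "\<not> W.fin_dim" using linear_map.surj_fin_dim[OF lm' _ surj'] by blast
    with False have "(\<lambda>n. \<exists>A. finite A \<and> card A = n \<and> A \<subseteq> carrier V \<and> V.gen_set A) =
        (\<lambda>n. \<exists>A. finite A \<and> card A = n \<and> A \<subseteq> carrier W \<and> W.gen_set A)"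
      unfolding V.fin_dim_def W.fin_dim_def by (intro ext iffI; blast)
    then show ?thesis by (simp add: V.dim_def W.dim_def)
  qed
qed

text \<open>Both spaces are quotients of \<open>Z\<close> by the same kernel. Their vector space
  axioms are inherited from \<open>Z\<close> along the surjections, so Tor need not be shown to be a
  vector space separately.\<close>

lemma vectorspace_dim_eq:
  fixes V :: "('k::field, 'v) module" and W :: "('k, 'w) module" and Z :: "('a \<Rightarrow>\<^sub>0 'k) set"
  assumes Z: "0 \<in> Z" "\<And>x y. x \<in> Z \<Longrightarrow> y \<in> Z \<Longrightarrow> x + y \<in> Z" "\<And>c x. x \<in> Z \<Longrightarrow> scl c x \<in> Z"
    and f: "f ` Z = carrier V" "\<And>x y. x \<in> Z \<Longrightarrow> y \<in> Z \<Longrightarrow> f (x + y) = f x \<oplus>\<^bsub>V\<^esub> f y"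
      "\<And>c x. x \<in> Z \<Longrightarrow> f (scl c x) = c \<odot>\<^bsub>V\<^esub> f x" "f 0 = \<zero>\<^bsub>V\<^esub>"
    and g: "g ` Z = carrier W" "\<And>x y. x \<in> Z \<Longrightarrow> y \<in> Z \<Longrightarrow> g (x + y) = g x \<oplus>\<^bsub>W\<^esub> g y"
      "\<And>c x. x \<in> Z \<Longrightarrow> g (scl c x) = c \<odot>\<^bsub>W\<^esub> g x" "g 0 = \<zero>\<^bsub>W\<^esub>"
    and ker: "\<And>x. x \<in> Z \<Longrightarrow> f x = \<zero>\<^bsub>V\<^esub> \<longleftrightarrow> g x = \<zero>\<^bsub>W\<^esub>"
  shows "vectorspace.dim (ring_of_type_algebra :: 'k ring) V = vectorspace.dim ring_of_type_algebra W"
proof -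
  have K [simp]: "carrier (ring_of_type_algebra :: 'k ring) = UNIV" "\<zero>\<^bsub>ring_of_type_algebra\<^esub> = (0::'k)"
    "\<one>\<^bsub>ring_of_type_algebra\<^esub> = (1::'k)" "monoid.mult ring_of_type_algebra = ((*) :: 'k \<Rightarrow> _)"
    "add ring_of_type_algebra = ((+) :: 'k \<Rightarrow> _)"
    by (simp_all add: ring_of_type_algebra_def)
  have vs: "vectorspace (ring_of_type_algebra :: 'k ring) U"
    if h: "h ` Z = carrier U" "\<And>x y. x \<in> Z \<Longrightarrow> y \<in> Z \<Longrightarrow> h (x + y) = h x \<oplus>\<^bsub>U\<^esub> h y"
      "\<And>c x. x \<in> Z \<Longrightarrow> h (scl c x) = c \<odot>\<^bsub>U\<^esub> h x" "h 0 = \<zero>\<^bsub>U\<^esub>"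
    for h :: "('a \<Rightarrow>\<^sub>0 'k) \<Rightarrow> 'u" and U :: "('k, 'u) module"
  proof -
    have car: "\<And>T. T \<in> carrier U \<longleftrightarrow> (\<exists>x\<in>Z. T = h x)" using h(1) by auto
    have "module (ring_of_type_algebra :: 'k ring) U"
    proof (rule moduleI)
      show "cring (ring_of_type_algebra :: 'k ring)" by (rule cring_from_type_algebra)
      show "abelian_group U"
      proof (rule abelian_groupI)
        show "T \<oplus>\<^bsub>U\<^esub> Y \<in> carrier U" if "T \<in> carrier U" "Y \<in> carrier U" for T Y
          using that Z(2) unfolding car by (metis h(2))
        show "\<zero>\<^bsub>U\<^esub> \<in> carrier U" using Z(1) h(4) unfolding car by metis
        show "T \<oplus>\<^bsub>U\<^esub> Y \<oplus>\<^bsub>U\<^esub> S = T \<oplus>\<^bsub>U\<^esub> (Y \<oplus>\<^bsub>U\<^esub> S)"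
          if "T \<in> carrier U" "Y \<in> carrier U" "S \<in> carrier U" for T Y S
          using that unfolding car by (elim bexE) (simp only: h(2)[symmetric] Z(2) add.assoc)
        show "T \<oplus>\<^bsub>U\<^esub> Y = Y \<oplus>\<^bsub>U\<^esub> T" if "T \<in> carrier U" "Y \<in> carrier U" for T Y
          using that unfolding car by (elim bexE) (simp only: h(2)[symmetric] add.commute)
        show "\<zero>\<^bsub>U\<^esub> \<oplus>\<^bsub>U\<^esub> T = T" if "T \<in> carrier U" for T
          using that unfolding car h(4)[symmetric] by (elim bexE) (simp only: h(2)[symmetric] Z(1) add_0)
        show "\<exists>Y\<in>carrier U. Y \<oplus>\<^bsub>U\<^esub> T = \<zero>\<^bsub>U\<^esub>" if "T \<in> carrier U" for T
        proof -
          from that obtain x where x: "x \<in> Z" "T = h x" unfolding car by blast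
          have "scl (- 1) x + x = 0" by (rule poly_mapping_eqI) (simp add: lookup_add)
          then have "h (scl (- 1) x) \<oplus>\<^bsub>U\<^esub> T = \<zero>\<^bsub>U\<^esub>"
            using h(2)[OF Z(3)[OF x(1), of "- 1"] x(1)] h(4) x(2) by simp
          moreover have "h (scl (- 1) x) \<in> carrier U" unfolding car using Z(3)[OF x(1)] by blast
          ultimately show ?thesis by blast
        qed
      qed
      show "c \<odot>\<^bsub>U\<^esub> T \<in> carrier U" if "T \<in> carrier U" for c T
        using that Z(3) unfolding car by (metis h(3))
      show "(c \<oplus>\<^bsub>ring_of_type_algebra\<^esub> c') \<odot>\<^bsub>U\<^esub> T = c \<odot>\<^bsub>U\<^esub> T \<oplus>\<^bsub>U\<^esub> c' \<odot>\<^bsub>U\<^esub> T"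
        if "T \<in> carrier U" for c c' T
        using that unfolding car K by (elim bexE) (simp only: h(3)[symmetric] scl_distribs h(2) Z(3))
      show "c \<odot>\<^bsub>U\<^esub> (T \<oplus>\<^bsub>U\<^esub> Y) = c \<odot>\<^bsub>U\<^esub> T \<oplus>\<^bsub>U\<^esub> c \<odot>\<^bsub>U\<^esub> Y"
        if "T \<in> carrier U" "Y \<in> carrier U" for c T Y
        using that unfolding car by (elim bexE) (simp only: h(2)[symmetric] h(3)[symmetric] Z(2,3) scl_distribs)
      show "(c \<otimes>\<^bsub>ring_of_type_algebra\<^esub> c') \<odot>\<^bsub>U\<^esub> T = c \<odot>\<^bsub>U\<^esub> (c' \<odot>\<^bsub>U\<^esub> T)"
        if "T \<in> carrier U" for c c' T
        using that unfolding car K by (elim bexE) (simp only: h(3)[symmetric] Z(3) scl_simps)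
      show "\<one>\<^bsub>ring_of_type_algebra\<^esub> \<odot>\<^bsub>U\<^esub> T = T" if "T \<in> carrier U" for T
        using that unfolding car K by (elim bexE) (simp only: h(3)[symmetric] scl_simps)
    qed
    then show ?thesis
      by (intro vectorspace.intro field_from_type_algebra)
  qed
  have eq_iff: "h x = h y \<longleftrightarrow> h (x + scl (- 1) y) = \<zero>\<^bsub>U\<^esub>"
    if h: "\<And>x y. x \<in> Z \<Longrightarrow> y \<in> Z \<Longrightarrow> h (x + y) = h x \<oplus>\<^bsub>U\<^esub> h y" "h 0 = \<zero>\<^bsub>U\<^esub>" and xy: "x \<in> Z" "y \<in> Z"
    for h :: "('a \<Rightarrow>\<^sub>0 'k) \<Rightarrow> 'u" and U :: "('k, 'u) module" and x y
  proof -
    have ny: "scl (- 1) y \<in> Z" by (rule Z(3)[OF xy(2)])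
    have 1: "y + scl (- 1) y = 0" and 2: "(x + scl (- 1) y) + y = x"
      by (rule poly_mapping_eqI, simp add: lookup_add)+
    show ?thesis
    proof
      assume "h x = h y"
      then have "h (x + scl (- 1) y) = h (y + scl (- 1) y)" by (simp only: h(1)[OF xy(1) ny] h(1)[OF xy(2) ny])
      then show "h (x + scl (- 1) y) = \<zero>\<^bsub>U\<^esub>" by (simp only: 1 h(2))
    next
      assume "h (x + scl (- 1) y) = \<zero>\<^bsub>U\<^esub>"
      then have "h x = h 0 \<oplus>\<^bsub>U\<^esub> h y" using h(1)[OF Z(2)[OF xy(1) ny] xy(2)] by (simp only: 2 h(2))
      also have "\<dots> = h y" using h(1)[OF Z(1) xy(2)] by simp
      finally show "h x = h y" .
    qed
  qed
  have dif: "f x = f y \<longleftrightarrow> g x = g y" if "x \<in> Z" "y \<in> Z" for x y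
    using eq_iff[of f V, OF f(2,4) that] eq_iff[of g W, OF g(2,4) that]
      ker[OF Z(2)[OF that(1) Z(3)[OF that(2)]]] by simp
  \<comment> \<open>Well defined by \<open>dif\<close>: the maps \<open>f\<close> and
    \<open>g\<close> identify the same pairs of elements.\<close>
  define h where "h T = g (SOME x. x \<in> Z \<and> f x = T)" for T
  have hf: "h (f x) = g x" if "x \<in> Z" for x
  proof -
    have "\<exists>y. y \<in> Z \<and> f y = f x" using that by blast
    from someI_ex[OF this] show ?thesis unfolding h_def using dif that by blast
  qed
  have carV: "\<And>T. T \<in> carrier V \<longleftrightarrow> (\<exists>x\<in>Z. T = f x)" and carW: "\<And>T. T \<in> carrier W \<longleftrightarrow> (\<exists>x\<in>Z. T = g x)"
    using f(1) g(1) by auto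
  have hom: "h \<in> module_hom (ring_of_type_algebra :: 'k ring) V W"
    unfolding module_hom_def
  proof (intro CollectI conjI allI impI Pi_I; (elim conjE)?)
    show "h T \<in> carrier W" if "T \<in> carrier V" for T
      using that unfolding carV carW using hf by blast
    show "h (T \<oplus>\<^bsub>V\<^esub> Y) = h T \<oplus>\<^bsub>W\<^esub> h Y" if "T \<in> carrier V" "Y \<in> carrier V" for T Y
      using that unfolding carV by (elim bexE) (simp only: f(2)[symmetric] hf Z(2) g(2))
    show "h (c \<odot>\<^bsub>V\<^esub> T) = c \<odot>\<^bsub>W\<^esub> h T" if "T \<in> carrier V" for c T
      using that unfolding carV by (elim bexE) (simp only: f(3)[symmetric] hf Z(3) g(3))
  qed
  have inj: "inj_on h (carrier V)"
    by (rule inj_onI) (metis carV hf dif)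
  have "h ` carrier V = carrier W"
  proof (intro equalityI subsetI)
    fix T assume "T \<in> carrier W"
    then obtain x where x: "x \<in> Z" "T = g x" unfolding carW by blast
    then have "T = h (f x)" "f x \<in> carrier V" using hf[OF x(1)] carV[of "f x"] by auto
    then show "T \<in> h ` carrier V" by (rule image_eqI)
  next
    fix T assume "T \<in> h ` carrier V"
    then obtain S where "S \<in> carrier V" "T = h S" by (rule imageE)
    then show "T \<in> carrier W" using hom by (simp add: module_hom_def Pi_iff)
  qed
  with inj have bij: "bij_betw h (carrier V) (carrier W)" by (simp add: bij_betw_def)
  have V: "vectorspace (ring_of_type_algebra :: 'k ring) V"
    by (rule vs[of f V]) (simp_all add: f)
  have W: "vectorspace (ring_of_type_algebra :: 'k ring) W"
    by (rule vs[of g W]) (simp_all add: g)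
  show ?thesis using V W hom bij by (rule vectorspace_dim_cong)
qed

subsection \<open>Quotients of the polynomial ring by monomial ideals\<close>

lemma mpoly_ring_simps [simp]:
  "carrier (mpoly_ring :: ('v::finite, 'k::field) mpoly ring) = UNIV"
  "\<zero>\<^bsub>(mpoly_ring :: ('v, 'k) mpoly ring)\<^esub> = 0"
  "\<one>\<^bsub>(mpoly_ring :: ('v, 'k) mpoly ring)\<^esub> = 1"
  "p \<oplus>\<^bsub>(mpoly_ring :: ('v, 'k) mpoly ring)\<^esub> r = p + r"
  "p \<otimes>\<^bsub>(mpoly_ring :: ('v, 'k) mpoly ring)\<^esub> r = p * r"
  by (simp_all add: mpoly_ring_def ring_of_type_algebra_def)

lemma cring_mpoly_ring: "cring (mpoly_ring :: ('v::finite, 'k::field) mpoly ring)"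
  unfolding mpoly_ring_def by (rule cring_from_type_algebra)

definition dvdm :: "('v \<Rightarrow>\<^sub>0 nat) \<Rightarrow> ('v \<Rightarrow>\<^sub>0 nat) \<Rightarrow> bool" where
  "dvdm a u \<longleftrightarrow> (\<forall>v. lookup a v \<le> lookup u v)"

lemma dvdm_iff: "dvdm a u \<longleftrightarrow> (\<exists>w. u = a + w)"
proof
  assume a: "dvdm a u"
  have "u = a + (u - a)"
    using a by (intro poly_mapping_eqI) (simp add: lookup_add lookup_minus dvdm_def)
  then show "\<exists>w. u = a + w" ..
qed (auto simp: dvdm_def lookup_add)

text \<open>For monomial ideals membership can be read off the support; this form replaces the
  generated ideal from here on.\<close>

definition mspan :: "('v \<Rightarrow>\<^sub>0 nat) set \<Rightarrow> ('v, 'k::field) mpoly set" where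
  "mspan E = {p. \<forall>u\<in>keys p. \<exists>a\<in>E. dvdm a u}"

lemma mspan_closed:
  fixes p q :: "('v, 'k::field) mpoly"
  shows "0 \<in> (mspan E :: ('v, 'k) mpoly set)" "p \<in> mspan E \<Longrightarrow> q \<in> mspan E \<Longrightarrow> p + q \<in> mspan E"
    "p \<in> mspan E \<Longrightarrow> - p \<in> mspan E" "p \<in> mspan E \<Longrightarrow> q \<in> mspan E \<Longrightarrow> p - q \<in> mspan E"
    "p \<in> mspan E \<Longrightarrow> q * p \<in> mspan E"
proof -
  show "0 \<in> (mspan E :: ('v, 'k) mpoly set)" by (simp add: mspan_def)
  show "p \<in> mspan E \<Longrightarrow> q \<in> mspan E \<Longrightarrow> p + q \<in> mspan E"
    using keys_add[of p q] unfolding mspan_def by blast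
  show "p \<in> mspan E \<Longrightarrow> - p \<in> mspan E" by (simp add: mspan_def in_keys_iff)
  show "p \<in> mspan E \<Longrightarrow> q \<in> mspan E \<Longrightarrow> p - q \<in> mspan E"
    using keys_diffE[of _ p q] unfolding mspan_def by blast
  show "q * p \<in> mspan E" if "p \<in> mspan E"
    unfolding mspan_def
  proof (intro CollectI ballI)
    fix u assume "u \<in> keys (q * p)"
    then obtain b c where "u = b + c" "c \<in> keys p" using keys_mult[of q p] by auto
    moreover from that this(2) obtain a where "a \<in> E" "dvdm a c" unfolding mspan_def by blast
    ultimately show "\<exists>a\<in>E. dvdm a u" unfolding dvdm_def by (metis lookup_add trans_le_add2)
  qed
qed

lemma mspan_sum: "(\<And>i. i \<in> S \<Longrightarrow> f i \<in> mspan E) \<Longrightarrow> sum f S \<in> mspan E"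
  by (induction S rule: infinite_finite_induct) (auto simp: mspan_closed)

lemma ideal_mspan: "ideal (mspan E) (mpoly_ring :: ('v::finite, 'k::field) mpoly ring)"
proof (rule idealI)
  show "ring (mpoly_ring :: ('v, 'k) mpoly ring)" using cring_mpoly_ring cring.axioms(1) by blast
  show "subgroup (mspan E) (add_monoid (mpoly_ring :: ('v, 'k) mpoly ring))"
  proof (rule group.subgroupI)
    show g: "group (add_monoid (mpoly_ring :: ('v, 'k) mpoly ring))"
      using cring_mpoly_ring cring.axioms(1) ring.axioms(1) abelian_group.a_group by blast
    show "inv\<^bsub>add_monoid mpoly_ring\<^esub> a \<in> mspan E" if "a \<in> mspan E" for a :: "('v, 'k) mpoly"
    proof -
      have "inv\<^bsub>add_monoid mpoly_ring\<^esub> a = - a"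
        by (rule group.inv_equality[OF g]) simp_all
      then show ?thesis using mspan_closed(3)[OF that] by simp
    qed
    show "(mspan E :: ('v, 'k) mpoly set) \<noteq> {}" using mspan_closed(1) by blast
  qed (simp_all add: mspan_closed)
next
  fix a x :: "('v, 'k) mpoly" assume "a \<in> mspan E"
  then show "x \<otimes>\<^bsub>mpoly_ring\<^esub> a \<in> mspan E" "a \<otimes>\<^bsub>mpoly_ring\<^esub> x \<in> mspan E"
    using mspan_closed(5)[of a E x] by (simp_all add: mult.commute)
qed

lemma ideal_mpolyD:
  fixes J :: "('v::finite, 'k::field) mpoly set"
  assumes "ideal J mpoly_ring"
  shows "0 \<in> J" "p \<in> J \<Longrightarrow> q \<in> J \<Longrightarrow> p + q \<in> J" "p \<in> J \<Longrightarrow> q * p \<in> J"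
    "p \<in> J \<Longrightarrow> q \<in> J \<Longrightarrow> p - q \<in> J"
proof -
  show "0 \<in> J" using additive_subgroup.zero_closed[OF ideal.axioms(1)[OF assms]] by simp
  show add: "p \<in> J \<Longrightarrow> q \<in> J \<Longrightarrow> p + q \<in> J" for p q
    using additive_subgroup.a_closed[OF ideal.axioms(1)[OF assms], of p q] by simp
  show mult: "p \<in> J \<Longrightarrow> q * p \<in> J" for p q
    using ideal.I_l_closed[OF assms, of p q] by simp
  show "p - q \<in> J" if "p \<in> J" "q \<in> J"
    using add[OF that(1) mult[OF that(2), of "- 1"]] by simp
qed

lemma genideal_monomials:
  "Idl\<^bsub>(mpoly_ring :: ('v::finite, 'k::field) mpoly ring)\<^esub> (monomial ` E) = mspan E"
proof -
  interpret A: cring "mpoly_ring :: ('v, 'k) mpoly ring" by (rule cring_mpoly_ring)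
  let ?I = "Idl\<^bsub>(mpoly_ring :: ('v, 'k) mpoly ring)\<^esub> (monomial ` E)"
  note I = ideal_mpolyD[OF A.genideal_ideal[of "monomial ` E"], simplified]
  show ?thesis
  proof
    show "?I \<subseteq> mspan E"
      by (rule A.genideal_minimal[OF ideal_mspan]) (auto simp: mspan_def monomial_def dvdm_def)
    show "mspan E \<subseteq> ?I"
    proof
      fix p :: "('v, 'k) mpoly" assume p: "p \<in> mspan E"
      have t: "scl (lookup p u) (Poly_Mapping.single u 1) \<in> ?I" if u: "u \<in> keys p" for u
      proof -
        obtain a w where a: "a \<in> E" "u = a + w" using p u unfolding mspan_def dvdm_iff by blast
        have "monomial a \<in> ?I" using A.genideal_self[of "monomial ` E"] a(1) by auto
        from I(3)[OF this, of "Poly_Mapping.single w (lookup p u)"]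
        show ?thesis by (simp add: a(2) monomial_def mult_single add.commute)
      qed
      have sumI: "sum f S \<in> ?I" if "\<And>u. u \<in> S \<Longrightarrow> f u \<in> ?I" for f :: "_ \<Rightarrow> ('v, 'k) mpoly" and S :: "('v \<Rightarrow>\<^sub>0 nat) set"
        using that
      proof (induction S rule: infinite_finite_induct)
        case (insert x F)
        then show ?case using I(2)[of "f x" "sum f F"] by simp
      qed (use I(1) in simp_all)
      have "(\<Sum>u\<in>keys p. scl (lookup p u) (Poly_Mapping.single u 1)) \<in> ?I" by (rule sumI) (rule t)
      then show "p \<in> ?I" by (simp only: expand_single[symmetric])
    qed
  qed
qed

lemma max_ideal_eq: "(max_ideal :: ('v::finite, 'k::field) mpoly set) = {p. lookup p 0 = 0}"
proof -
  have "(max_ideal :: ('v, 'k) mpoly set) = mspan (range (\<lambda>v. Poly_Mapping.single v 1))"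
    unfolding max_ideal_def genideal_monomials[symmetric] by (simp add: mvar_def image_image)
  moreover have "(\<exists>v. dvdm (Poly_Mapping.single v 1) u) \<longleftrightarrow> u \<noteq> 0" for u :: "'v \<Rightarrow>\<^sub>0 nat"
  proof -
    have "dvdm (Poly_Mapping.single v 1) u \<longleftrightarrow> lookup u v \<noteq> 0" for v
      by (auto simp: dvdm_def lookup_single when_def Suc_le_eq)
    then show ?thesis by (auto simp: poly_mapping_eq_iff fun_eq_iff)
  qed
  ultimately have "p \<in> max_ideal \<longleftrightarrow> 0 \<notin> keys p" for p :: "('v, 'k) mpoly" by (simp add: mspan_def) blast
  then show ?thesis by (auto simp: in_keys_iff)
qed

text \<open>An exponent in a product of two elements without constant term is a sum of two nonzero
  exponents.\<close>

lemma degree_ideal_prod: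
  assumes "p \<in> ideal_prod mpoly_ring max_ideal max_ideal" "u \<in> keys (p :: ('v::finite, 'k::field) mpoly)"
  shows "2 \<le> (\<Sum>v\<in>UNIV. lookup u v)"
  using assms
proof (induction arbitrary: u rule: ideal_prod.induct)
  case (prod i j)
  then obtain a b where u: "u = a + b" "a \<in> keys i" "b \<in> keys j" using keys_mult[of i j] by auto
  have "a \<noteq> 0" "b \<noteq> 0" using prod u by (auto simp: max_ideal_eq in_keys_iff)
  moreover have "1 \<le> (\<Sum>v\<in>UNIV. lookup w v)" if "w \<noteq> 0" for w :: "'v \<Rightarrow>\<^sub>0 nat"
  proof -
    from that obtain v where "lookup w v \<noteq> 0" by (auto simp: poly_mapping_eq_iff fun_eq_iff)
    then have "(\<Sum>v\<in>UNIV. lookup w v) \<noteq> 0" by auto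
    then show ?thesis by linarith
  qed
  ultimately have "1 \<le> (\<Sum>v\<in>UNIV. lookup a v)" "1 \<le> (\<Sum>v\<in>UNIV. lookup b v)" by blast+
  then show ?case by (simp add: u(1) lookup_add sum.distrib)
next
  case (sum s1 s2)
  then show ?case using keys_add[of s1 s2] by auto
qed

section \<open>The ring A/I and the residue field as a module over it\<close>

definition coset :: "('v::finite, 'k::field) mpoly set \<Rightarrow> ('v, 'k) mpoly \<Rightarrow> ('v, 'k) mpoly set" where
  "coset I p = I +>\<^bsub>mpoly_ring\<^esub> p"

lemma coset_set: "coset I p = {i + p | i. i \<in> I}"
  by (auto simp: coset_def a_r_coset_def')

text \<open>The representative is immaterial for cosets of an ideal inside the maximal ideal. The
  same function serves as residue map on A/I and as coordinate on k.\<close>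

definition const_coeff :: "('v::finite, 'k::field) mpoly set \<Rightarrow> 'k" where
  "const_coeff Y = lookup (SOME p. p \<in> Y) 0"

locale monomial_quotient =
  fixes E :: "('v::finite \<Rightarrow>\<^sub>0 nat) set" and I :: "('v, 'k::field) mpoly set"
  assumes I_def: "I = mspan E"
    and nz: "0 \<notin> E"
begin

abbreviation "A \<equiv> (mpoly_ring :: ('v, 'k) mpoly ring)"
abbreviation "Q \<equiv> mpoly_ring Quot I"
abbreviation "\<pi> \<equiv> coset I"
abbreviation "\<mu> \<equiv> coset (max_ideal :: ('v, 'k) mpoly set)"
abbreviation "KN \<equiv> (residue_module :: (('v, 'k) mpoly set, ('v, 'k) mpoly set) module)"

lemma ideal_I: "ideal I A"
  unfolding I_def by (rule ideal_mspan)

lemma ideal_max: "ideal max_ideal A"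
  unfolding max_ideal_def using ring.genideal_ideal[of A] cring_mpoly_ring cring.axioms(1) by fastforce

lemma I_max: "I \<subseteq> max_ideal"
proof
  fix p assume p: "p \<in> I"
  have "0 \<notin> keys p"
  proof
    assume "0 \<in> keys p"
    then obtain a where "a \<in> E" "dvdm a 0" using p unfolding I_def mspan_def by blast
    then have "a = 0" by (auto simp: dvdm_def intro: poly_mapping_eqI)
    with \<open>a \<in> E\<close> nz show False by simp
  qed
  then show "p \<in> max_ideal" by (simp add: max_ideal_eq in_keys_iff)
qed

lemma Q_carrier: "carrier Q = range \<pi>"
  by (auto simp: FactRing_def A_RCOSETS_def' coset_def)

lemma Q_simps: "\<pi> p \<oplus>\<^bsub>Q\<^esub> \<pi> q = \<pi> (p + q)" "\<pi> p \<otimes>\<^bsub>Q\<^esub> \<pi> q = \<pi> (p * q)" "\<zero>\<^bsub>Q\<^esub> = \<pi> 0" "\<one>\<^bsub>Q\<^esub> = \<pi> 1"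
proof -
  interpret I: ideal I A by (rule ideal_I)
  show "\<pi> p \<oplus>\<^bsub>Q\<^esub> \<pi> q = \<pi> (p + q)"
    using I.a_rcos_sum[of p q] by (simp add: FactRing_def coset_def)
  show "\<pi> p \<otimes>\<^bsub>Q\<^esub> \<pi> q = \<pi> (p * q)"
    using I.rcoset_mult_add[of p q] by (simp add: FactRing_def coset_def)
  show "\<zero>\<^bsub>Q\<^esub> = \<pi> 0" by (simp add: FactRing_def coset_set)
  show "\<one>\<^bsub>Q\<^esub> = \<pi> 1" by (simp add: FactRing_def coset_def)
qed

lemma cring_Q: "cring Q"
  by (rule ideal.quotient_is_cring[OF ideal_I cring_mpoly_ring])

lemma coset_eq_iff:
  assumes "J = I \<or> J = max_ideal"
  shows "coset J p = coset J q \<longleftrightarrow> p - q \<in> J"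
proof -
  have J: "ideal J A" using assms ideal_I ideal_max by blast
  note cl = ideal_mpolyD(1)[OF J] ideal_mpolyD(2)[OF J] ideal_mpolyD(4)[OF J]
  show ?thesis
  proof
    assume "coset J p = coset J q"
    moreover have "p \<in> coset J p" using cl(1) by (force simp: coset_set)
    ultimately show "p - q \<in> J" by (auto simp: coset_set)
  next
    assume pq: "p - q \<in> J"
    have "i + p \<in> coset J q" if "i \<in> J" for i
    proof -
      have "i + p = (i + (p - q)) + q" by simp
      then show ?thesis using cl(2)[OF that pq] unfolding coset_set by blast
    qed
    moreover have "i + q \<in> coset J p" if "i \<in> J" for i
    proof -
      have "i + q = (i - (p - q)) + p" by simp
      then show ?thesis using cl(3)[OF that pq] unfolding coset_set by blast
    qed
    ultimately show "coset J p = coset J q" by (auto simp: coset_set)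
  qed
qed

lemma const_coeff_coset:
  assumes "J = I \<or> J = max_ideal"
  shows "const_coeff (coset J p) = lookup p 0"
proof -
  have "0 \<in> J" using assms mspan_closed(1)[of E] by (auto simp: I_def max_ideal_eq)
  then have "\<exists>q. q \<in> coset J p" by (auto simp: coset_set)
  from someI_ex[OF this] obtain i where i: "i \<in> J" "(SOME q. q \<in> coset J p) = i + p"
    by (auto simp: coset_set)
  have "lookup i 0 = 0" using i(1) assms I_max by (auto simp: max_ideal_eq)
  then show ?thesis by (simp add: const_coeff_def i(2) lookup_add)
qed

lemma KN_carrier: "carrier KN = range \<mu>"
  by (auto simp: residue_module_def FactRing_def A_RCOSETS_def' coset_def)

lemma KN_simps: "\<mu> p \<oplus>\<^bsub>KN\<^esub> \<mu> q = \<mu> (p + q)" "\<zero>\<^bsub>KN\<^esub> = \<mu> 0" "\<pi> p \<odot>\<^bsub>KN\<^esub> \<mu> q = \<mu> (p * q)"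
proof -
  interpret m: ideal max_ideal A by (rule ideal_max)
  show "\<mu> p \<oplus>\<^bsub>KN\<^esub> \<mu> q = \<mu> (p + q)"
    using m.a_rcos_sum[of p q] by (simp add: residue_module_def FactRing_def coset_def)
  show "\<zero>\<^bsub>KN\<^esub> = \<mu> 0" by (simp add: residue_module_def FactRing_def coset_set)
  have *: "\<mu> (p' * q') = \<mu> (p * q)" if p': "p' \<in> \<pi> p" and q': "q' \<in> \<mu> q" for p' q'
  proof -
    obtain i j where i: "i \<in> I" "p' = i + p" and j: "j \<in> max_ideal" "q' = j + q"
      using p' q' by (auto simp: coset_set)
    have "p' * q' - p * q = q' * i + p * j" by (simp add: i j algebra_simps)
    also have "\<dots> \<in> max_ideal"
      using i(1) j(1) I_max by (intro ideal_mpolyD[OF ideal_max]) auto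
    finally show ?thesis using coset_eq_iff[of max_ideal] by simp
  qed
  have pq: "p \<in> \<pi> p" "q \<in> \<mu> q"
    using mspan_closed(1)[of E] by (auto simp: coset_set I_def max_ideal_eq)
  have "\<pi> p \<odot>\<^bsub>KN\<^esub> \<mu> q = (\<Union>p'\<in>\<pi> p. \<Union>q'\<in>\<mu> q. \<mu> (p' * q'))"
    by (simp add: residue_module_def rcoset_mult_def coset_def)
  also have "\<dots> = (\<Union>p'\<in>\<pi> p. \<Union>q'\<in>\<mu> q. \<mu> (p * q))" using * by (intro SUP_cong refl)
  also have "\<dots> = \<mu> (p * q)" using pq by auto
  finally show "\<pi> p \<odot>\<^bsub>KN\<^esub> \<mu> q = \<mu> (p * q)" .
qed

lemma module_KN: "module Q KN"
proof (rule moduleI)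
  show "cring Q" by (rule cring_Q)
  show "abelian_group KN"
  proof (rule abelian_groupI)
    fix x assume "x \<in> carrier KN"
    then obtain p where "x = \<mu> p" by (auto simp: KN_carrier)
    then have "\<mu> (- p) \<oplus>\<^bsub>KN\<^esub> x = \<zero>\<^bsub>KN\<^esub>" by (simp add: KN_simps)
    then show "\<exists>y\<in>carrier KN. y \<oplus>\<^bsub>KN\<^esub> x = \<zero>\<^bsub>KN\<^esub>" by (auto simp: KN_carrier)
  qed (auto simp: KN_carrier KN_simps add_ac)
qed (auto simp: KN_carrier KN_simps Q_carrier Q_simps algebra_simps)

text \<open>Both factors are split into constant and remainder; every product with a remainder lies
  in the maximal ideal.\<close>

lemma lookup_times_0:
  fixes p q :: "('v, 'k) mpoly"
  shows "lookup (p * q) 0 = lookup p 0 * lookup q 0"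
proof -
  have p: "p = Poly_Mapping.single 0 (lookup p 0) + (p - Poly_Mapping.single 0 (lookup p 0))" by simp
  have q: "q = Poly_Mapping.single 0 (lookup q 0) + (q - Poly_Mapping.single 0 (lookup q 0))" by simp
  have cl: "r * s \<in> max_ideal" "s * r \<in> max_ideal" if "s \<in> max_ideal" for r s :: "('v, 'k) mpoly"
    using ideal_mpolyD(3)[OF ideal_max that, of r] by (simp_all add: mult.commute)
  have m: "r - Poly_Mapping.single 0 (lookup r 0) \<in> max_ideal" for r :: "('v, 'k) mpoly"
    by (simp add: max_ideal_eq lookup_minus)
  have "lookup (p * q) 0 = lookup (Poly_Mapping.single 0 (lookup p 0) * Poly_Mapping.single 0 (lookup q 0)
      + (Poly_Mapping.single 0 (lookup p 0) * (q - Poly_Mapping.single 0 (lookup q 0))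
      + (p - Poly_Mapping.single 0 (lookup p 0)) * q)) 0"
    by (rule arg_cong[where f = "\<lambda>r. lookup r 0"]) (simp add: algebra_simps)
  also have "\<dots> = lookup p 0 * lookup q 0"
    using cl(1)[OF m[of q], of "Poly_Mapping.single 0 (lookup p 0)"] cl(2)[OF m[of p], of q]
    by (simp add: lookup_add max_ideal_eq mult_single)
  finally show ?thesis .
qed

lemma residue_tensor_KN: "residue_tensor Q const_coeff KN (\<mu> 1) const_coeff"
proof (intro residue_tensor.intro residue_map.intro residue_map_axioms.intro residue_tensor_axioms.intro cring_Q module_KN)
  show "const_coeff (x \<oplus>\<^bsub>Q\<^esub> y) = const_coeff x + const_coeff y"
    if "x \<in> carrier Q" "y \<in> carrier Q" for x y
    using that by (auto simp: Q_carrier Q_simps const_coeff_coset lookup_add)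
  show "const_coeff (x \<otimes>\<^bsub>Q\<^esub> y) = const_coeff x * const_coeff y"
    if "x \<in> carrier Q" "y \<in> carrier Q" for x y
    using that by (auto simp: Q_carrier Q_simps const_coeff_coset lookup_times_0)
  show "\<mu> 1 \<in> carrier KN" by (auto simp: KN_carrier)
  show "\<exists>r\<in>carrier Q. y = r \<odot>\<^bsub>KN\<^esub> \<mu> 1" if "y \<in> carrier KN" for y
    using that by (auto simp: KN_carrier Q_carrier KN_simps)
  show "const_coeff (y \<oplus>\<^bsub>KN\<^esub> y') = const_coeff y + const_coeff y'"
    if "y \<in> carrier KN" "y' \<in> carrier KN" for y y'
    using that by (auto simp: KN_carrier KN_simps const_coeff_coset lookup_add)
  show "const_coeff (r \<odot>\<^bsub>KN\<^esub> y) = const_coeff r * const_coeff y"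
    if "r \<in> carrier Q" "y \<in> carrier KN" for r y
    using that by (auto simp: KN_carrier Q_carrier KN_simps const_coeff_coset lookup_times_0)
  show "const_coeff (\<mu> 1) = 1" by (simp add: const_coeff_coset lookup_one)
  show "r \<odot>\<^bsub>KN\<^esub> \<mu> 1 = \<zero>\<^bsub>KN\<^esub>" if "r \<in> carrier Q" "const_coeff r = 0" for r
  proof -
    from that(1) obtain p where p: "r = \<pi> p" unfolding Q_carrier by blast
    with that(2) have "p - 0 \<in> max_ideal" by (simp add: const_coeff_coset max_ideal_eq)
    then have "\<mu> p = \<mu> 0" using coset_eq_iff[of max_ideal p 0] by blast
    then show ?thesis unfolding p KN_simps by simp
  qed
qed

end

subsection \<open>Minimal generators\<close>

definition minexp :: "('v \<Rightarrow>\<^sub>0 nat) set \<Rightarrow> ('v \<Rightarrow>\<^sub>0 nat) set" where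
  "minexp E = {a \<in> E. \<forall>b\<in>E. dvdm b a \<longrightarrow> b = a}"

lemma dvdm_refl: "dvdm a a"
  by (simp add: dvdm_def)

lemma dvdm_trans: "dvdm a b \<Longrightarrow> dvdm b c \<Longrightarrow> dvdm a c"
  unfolding dvdm_def by (meson le_trans)

lemma dvdm_antisym: "dvdm a b \<Longrightarrow> dvdm b a \<Longrightarrow> a = b"
  by (rule poly_mapping_eqI) (simp add: dvdm_def antisym)

text \<open>A proper divisor has smaller total degree, which is finite as there are finitely many
  variables.\<close>

lemma minexp_below:
  fixes a :: "'v::finite \<Rightarrow>\<^sub>0 nat"
  assumes "a \<in> E"
  shows "\<exists>b\<in>minexp E. dvdm b a"
  using assms
proof (induction "\<Sum>v\<in>UNIV. lookup a v" arbitrary: a rule: less_induct)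
  case less
  show ?case
  proof (cases "a \<in> minexp E")
    case True
    then show ?thesis using dvdm_refl by blast
  next
    case False
    then obtain b where b: "b \<in> E" "dvdm b a" "b \<noteq> a" using less.prems by (auto simp: minexp_def)
    then obtain v where v: "lookup b v \<noteq> lookup a v" using poly_mapping_eqI[of b a] by blast
    then have "lookup b v < lookup a v" using b(2) by (simp add: dvdm_def le_neq_implies_less)
    then have "(\<Sum>v\<in>UNIV. lookup b v) < (\<Sum>v\<in>UNIV. lookup a v)"
      using b(2) by (intro sum_strict_mono_ex1) (auto simp: dvdm_def)
    from less.hyps[OF this b(1)] b(2) show ?thesis using dvdm_trans by blast
  qed
qed

lemma mspan_subset_iff:
  "mspan E \<subseteq> (mspan F :: ('v, 'k::field) mpoly set) \<longleftrightarrow> (\<forall>a\<in>E. \<exists>b\<in>F. dvdm b a)"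
proof
  assume *: "mspan E \<subseteq> (mspan F :: ('v, 'k) mpoly set)"
  show "\<forall>a\<in>E. \<exists>b\<in>F. dvdm b a"
  proof
    fix a assume "a \<in> E"
    then have "Poly_Mapping.single a (1::'k) \<in> mspan E" by (auto simp: mspan_def intro!: bexI[of _ a] dvdm_refl)
    then have "Poly_Mapping.single a (1::'k) \<in> mspan F" using * by blast
    then show "\<exists>b\<in>F. dvdm b a" by (simp add: mspan_def)
  qed
next
  assume "\<forall>a\<in>E. \<exists>b\<in>F. dvdm b a"
  then show "mspan E \<subseteq> (mspan F :: ('v, 'k) mpoly set)" unfolding mspan_def using dvdm_trans by blast
qed

lemma inj_monomial: "inj (monomial :: ('v::finite \<Rightarrow>\<^sub>0 nat) \<Rightarrow> ('v, 'k::field) mpoly)"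
proof (rule injI)
  fix a b :: "'v \<Rightarrow>\<^sub>0 nat"
  assume "monomial a = (monomial b :: ('v, 'k) mpoly)"
  then have "keys (monomial a :: ('v, 'k) mpoly) = keys (monomial b :: ('v, 'k) mpoly)" by simp
  then show "a = b" by (simp add: monomial_def)
qed

text \<open>Every monomial generating set contains the minimal exponents: a member dividing a
  minimal \<open>a\<close> is itself divided by a member of \<open>E\<close>, and minimality makes
  all three equal. As the minimal exponents already generate, they form the only irredundant
  generating set.\<close>

lemma min_gens_mspan: "min_gens (mspan E :: ('v::finite, 'k::field) mpoly set) = monomial ` minexp E"
  unfolding min_gens_def
proof (rule the_equality)
  let ?I = "mspan E :: ('v, 'k) mpoly set"
  have eqE: "(mspan F :: ('v, 'k) mpoly set) = ?I \<longleftrightarrow> (\<forall>a\<in>E. \<exists>b\<in>F. dvdm b a) \<and> (\<forall>a\<in>F. \<exists>b\<in>E. dvdm b a)" for F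
    using mspan_subset_iff[where 'k = 'k, of E F] mspan_subset_iff[where 'k = 'k, of F E] by blast
  have min: "minexp E \<subseteq> F" if mF: "(mspan F :: ('v, 'k) mpoly set) = ?I" for F
  proof
    fix a assume a: "a \<in> minexp E"
    then have "a \<in> E" by (simp add: minexp_def)
    then obtain b where b: "b \<in> F" "dvdm b a" using mF[unfolded eqE] by blast
    then obtain e where e: "e \<in> E" "dvdm e b" using mF[unfolded eqE] by blast
    then have "e = a" using a dvdm_trans[OF e(2) b(2)] by (auto simp: minexp_def)
    then have "b = a" using b(2) e(2) dvdm_antisym by blast
    with b(1) show "a \<in> F" by simp
  qed
  have minI: "(mspan (minexp E) :: ('v, 'k) mpoly set) = ?I"
    unfolding eqE using minexp_below[of _ E] dvdm_refl by (auto simp: minexp_def)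
  show "monomial ` minexp E \<subseteq> range monomial \<and> Idl\<^bsub>mpoly_ring\<^esub> (monomial ` minexp E) = ?I \<and>
      (\<forall>H. H \<subset> monomial ` minexp E \<longrightarrow> Idl\<^bsub>mpoly_ring\<^esub> H \<noteq> ?I)"
  proof (intro conjI allI impI)
    fix H assume H: "H \<subset> (monomial ` minexp E :: ('v, 'k) mpoly set)"
    then obtain F where F: "F \<subseteq> minexp E" "H = monomial ` F" by (auto simp: subset_image_iff psubset_eq)
    then have "F \<noteq> minexp E" using H by auto
    then show "Idl\<^bsub>mpoly_ring\<^esub> H \<noteq> ?I" using min[of F] F unfolding F(2) genideal_monomials by blast
  qed (auto simp: genideal_monomials minI)
  fix H :: "('v, 'k) mpoly set"
  assume H: "H \<subseteq> range monomial \<and> Idl\<^bsub>mpoly_ring\<^esub> H = ?I \<and> (\<forall>H'. H' \<subset> H \<longrightarrow> Idl\<^bsub>mpoly_ring\<^esub> H' \<noteq> ?I)"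
  then obtain F where F: "H = monomial ` F" by (auto simp: subset_image_iff)
  have "minexp E \<subseteq> F" using H by (intro min) (simp add: F genideal_monomials)
  then have "monomial ` minexp E \<subseteq> H" by (auto simp: F)
  moreover have "Idl\<^bsub>mpoly_ring\<^esub> (monomial ` minexp E) = ?I" by (simp add: genideal_monomials minI)
  ultimately show "H = monomial ` minexp E" using H by blast
qed

lemma monomial_ideal_min_gens:
  fixes I :: "('v::finite, 'k::field) mpoly set"
  assumes "monomial_ideal I"
  shows "\<exists>E. min_gens I = monomial ` E \<and> I = mspan E"
proof -
  from assms obtain S where "S \<subseteq> range monomial" "I = Idl\<^bsub>mpoly_ring\<^esub> S" by (auto simp: monomial_ideal_def)
  then obtain E where E: "I = mspan E" by (auto simp: subset_image_iff genideal_monomials)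
  have "(mspan (minexp E) :: ('v, 'k) mpoly set) = mspan E"
  proof
    show "mspan (minexp E) \<subseteq> (mspan E :: ('v, 'k) mpoly set)"
      unfolding mspan_subset_iff using dvdm_refl by (auto simp: minexp_def)
    show "mspan E \<subseteq> (mspan (minexp E) :: ('v, 'k) mpoly set)"
      unfolding mspan_subset_iff using minexp_below by blast
  qed
  with E min_gens_mspan[where 'k = 'k, of E] show ?thesis by metis
qed

lemma monomial_power: "(monomial a :: ('v::finite, 'k::field) mpoly) ^ q = monomial (\<Sum>i<q. a)"
  by (induction q) (simp_all add: monomial_def mult_single add.commute)

subsection \<open>A free resolution of the residue field\<close>

definition pm :: "('v::finite \<Rightarrow> nat) \<Rightarrow> 'v \<Rightarrow>\<^sub>0 nat" where
  "pm f = Abs_poly_mapping f"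

lemma lookup_pm [simp]: "lookup (pm f) = f"
  unfolding pm_def by (rule lookup_Abs_poly_mapping) simp

lemma pm_lookup [simp]: "pm (lookup u) = u"
  by (rule poly_mapping_eqI) simp

lemma pm_add: "pm f + pm g = pm (\<lambda>v. f v + g v)"
  by (rule poly_mapping_eqI) (simp add: lookup_add)

lemma pm_eq_iff: "pm f = pm g \<longleftrightarrow> f = g"
  by (metis lookup_pm)

lemma pm_eq_0_iff:
  fixes f :: "'v::finite \<Rightarrow> nat"
  shows "pm f = 0 \<longleftrightarrow> f = (\<lambda>v. 0)"
proof -
  have z: "(0 :: 'v \<Rightarrow>\<^sub>0 nat) = pm (\<lambda>v. 0)" by (rule poly_mapping_eqI) simp
  show ?thesis unfolding z by (rule pm_eq_iff)
qed

lemma dvdm_pm: "dvdm (pm f) u \<longleftrightarrow> (\<forall>v. f v \<le> lookup u v)"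
  by (simp add: dvdm_def)

lemma sum_single: "(\<Sum>i\<in>S. Poly_Mapping.single k (f i)) = Poly_Mapping.single k (\<Sum>i\<in>S. f i)"
  by (induction S rule: infinite_finite_induct) (auto simp: single_add)

lemma single_eq_0_iff: "Poly_Mapping.single k x = 0 \<longleftrightarrow> x = 0"
  by (cases "x = 0") (auto dest: arg_cong[where f = "\<lambda>p. lookup p k"])

lemma lookup_mapp': "f k 0 = 0 \<Longrightarrow> lookup (Poly_Mapping.mapp f p) k = f k (lookup p k)"
  by (simp add: lookup_mapp when_def in_keys_iff)

text \<open>The differential of \<open>k \<otimes> P\<close>: only degree-preserving terms survive. By \<open>keys_dQ\<close> it does not matter
  with which scaling factor the degrees are computed.\<close>

definition dbar :: "'v::finite qword \<Rightarrow> 'v qword \<Rightarrow>\<^sub>0 'k::comm_ring_1" where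
  "dbar q = Poly_Mapping.mapp (\<lambda>q' x. if qdeg 1 q' = qdeg 1 q then x else 0) (dQ q)"

lemma lookup_dbar: "lookup (dbar q) q' = (if qdeg 1 q' = qdeg 1 q then lookup (dQ q) q' else 0)"
  unfolding dbar_def by (subst lookup_mapp') auto

definition words :: "('v \<Rightarrow> nat) set \<Rightarrow> nat \<Rightarrow> 'v qword set" where
  "words G i = {q. wfQ G q \<and> qh q = i}"

text \<open>In degree 0 everything is a cycle, hence the guard. Neither the ideal nor
  \<open>c\<close> occurs: these spaces are the common description of Tor for both rings.\<close>

definition bar_cycles :: "('v::finite \<Rightarrow> nat) set \<Rightarrow> nat \<Rightarrow> ('v qword \<Rightarrow>\<^sub>0 'k::comm_ring_1) set" where
  "bar_cycles G i = {y. keys y \<subseteq> words G i \<and> (0 < i \<longrightarrow> lext dbar y = 0)}"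

definition bar_boundaries :: "('v::finite \<Rightarrow> nat) set \<Rightarrow> nat \<Rightarrow> ('v qword \<Rightarrow>\<^sub>0 'k::comm_ring_1) set" where
  "bar_boundaries G i = {lext dbar w | w. keys w \<subseteq> words G (Suc i)}"

text \<open>Used with \<open>c = 1\<close> for I and \<open>c = q\<close> for the ideal of powers.
  The set \<open>G\<close>, and with it the words, is the same in both instances.\<close>

locale taylor_resolution = gens G for G :: "('v::finite \<Rightarrow> nat) set" +
  fixes c :: nat and I :: "('v, 'k::field) mpoly set"
  assumes c: "1 \<le> c" and I_eq: "I = mspan ((\<lambda>m. pm (\<lambda>v. c * m v)) ` G)"
begin

sublocale monomial_quotient "(\<lambda>m. pm (\<lambda>v. c * m v)) ` G" I
proof
  show "I = mspan ((\<lambda>m. pm (\<lambda>v. c * m v)) ` G)" by (rule I_eq)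
  show "0 \<notin> (\<lambda>m. pm (\<lambda>v. c * m v)) ` G"
  proof
    assume "0 \<in> (\<lambda>m. pm (\<lambda>v. c * m v)) ` G"
    then obtain m where m: "0 = pm (\<lambda>v. c * m v)" "m \<in> G" by (rule imageE)
    then have "(\<lambda>v. c * m v) = (\<lambda>v. 0)" using pm_eq_0_iff[of "\<lambda>v. c * m v"] by simp
    then have "c * m v = 0" for v by (rule fun_cong)
    then have "m v = 0" for v using c by simp
    then show False using two_le[OF m(2)] by simp
  qed
qed

lemma mem_I: "p \<in> I \<longleftrightarrow> (\<forall>u\<in>keys p. \<exists>m\<in>G. \<forall>v. c * m v \<le> lookup u v)"
  by (simp add: I_eq mspan_def dvdm_pm)

lemmas I_closed = ideal_mpolyD[OF ideal_I]

lemma I_sum: "(\<And>i. i \<in> S \<Longrightarrow> f i \<in> I) \<Longrightarrow> sum f S \<in> I"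
  unfolding I_eq by (rule mspan_sum)

lemma I_mult_right: "p \<in> I \<Longrightarrow> p * q \<in> I"
  using I_closed(3)[of p q] by (simp add: mult.commute)

abbreviation "W \<equiv> words G"

text \<open>\<open>free_resolution\<close> asks for bases of natural numbers, so words are numbered
  by \<open>to_nat\<close>.\<close>

definition Bas :: "nat \<Rightarrow> nat set" where
  "Bas i = to_nat ` W i"

text \<open>Reduction of coefficients modulo I, transported to numbered words. Numbers that code no
  word get the zero of A/I and so stay outside the support.\<close>

definition Pi :: "('v qword \<Rightarrow>\<^sub>0 ('v, 'k) mpoly) \<Rightarrow> nat \<Rightarrow> ('v, 'k) mpoly set" where
  "Pi z n = (if n \<in> range (to_nat :: 'v qword \<Rightarrow> nat) then \<pi> (lookup z (from_nat n)) else \<pi> 0)"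

lemma Pi_to_nat [simp]: "Pi z (to_nat q) = \<pi> (lookup z q)"
  by (simp add: Pi_def)

lemma Pi_other: "n \<notin> range (to_nat :: 'v qword \<Rightarrow> nat) \<Longrightarrow> Pi z n = \<pi> 0"
  by (simp add: Pi_def)

lemma Pi_ext: "f = g" if "\<And>q :: 'v qword. f (to_nat q) = g (to_nat q)"
  "\<And>n. n \<notin> range (to_nat :: 'v qword \<Rightarrow> nat) \<Longrightarrow> f n = g n"
proof
  fix n show "f n = g n" using that by (cases "n \<in> range (to_nat :: 'v qword \<Rightarrow> nat)") auto
qed

lemma Pi_eq_iff: "Pi z = Pi z' \<longleftrightarrow> (\<forall>q. lookup z q - lookup z' q \<in> I)"
proof
  assume eq: "Pi z = Pi z'"
  show "\<forall>q. lookup z q - lookup z' q \<in> I"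
  proof
    fix q :: "'v qword"
    have "\<pi> (lookup z q) = \<pi> (lookup z' q)" using fun_cong[OF eq, of "to_nat q"] by simp
    then show "lookup z q - lookup z' q \<in> I" using coset_eq_iff[of I] by blast
  qed
next
  assume "\<forall>q. lookup z q - lookup z' q \<in> I"
  then have "\<pi> (lookup z q) = \<pi> (lookup z' q)" for q using coset_eq_iff[of I] by blast
  then show "Pi z = Pi z'" by (intro Pi_ext) (simp_all add: Pi_other)
qed

lemma Pi_add: "Pi z \<oplus>\<^bsub>free_mod Q B\<^esub> Pi z' = Pi (z + z')"
  unfolding cring.free_mod_simps[OF cring_Q]
  by (rule Pi_ext) (simp_all add: Q_simps lookup_add Pi_other)

lemma Pi_smult: "\<pi> p \<odot>\<^bsub>free_mod Q B\<^esub> Pi z = Pi (scl p z)"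
  unfolding cring.free_mod_simps[OF cring_Q]
  by (rule Pi_ext) (simp_all add: Q_simps Pi_other)

lemma Pi_zero: "Pi 0 = (\<lambda>b. \<zero>\<^bsub>Q\<^esub>)"
  by (rule Pi_ext) (simp_all add: Q_simps Pi_other)

lemma Pi_carrier:
  assumes "keys z \<subseteq> W i"
  shows "Pi z \<in> carrier (free_mod Q (Bas i))"
proof -
  have sub: "{n. Pi z n \<noteq> \<zero>\<^bsub>Q\<^esub>} \<subseteq> to_nat ` keys z"
  proof
    fix n assume n: "n \<in> {n. Pi z n \<noteq> \<zero>\<^bsub>Q\<^esub>}"
    then have "n \<in> range (to_nat :: 'v qword \<Rightarrow> nat)" using Pi_other[of n z] by (auto simp: Q_simps)
    then obtain q :: "'v qword" where q: "n = to_nat q" by blast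
    then have "lookup z q \<noteq> 0" using n by (auto simp: Q_simps)
    then show "n \<in> to_nat ` keys z" by (simp add: q in_keys_iff)
  qed
  then have "finite {n. Pi z n \<noteq> \<zero>\<^bsub>Q\<^esub>}" by (rule finite_subset) simp
  moreover have "{n. Pi z n \<noteq> \<zero>\<^bsub>Q\<^esub>} \<subseteq> Bas i" using sub assms unfolding Bas_def by blast
  moreover have "\<forall>n. Pi z n \<in> carrier Q" by (simp add: Pi_def Q_carrier)
  ultimately show ?thesis unfolding cring.free_mod_carrier[OF cring_Q] by blast
qed

lemma Pi_surj:
  assumes "f \<in> carrier (free_mod Q (Bas i))"
  shows "\<exists>z. keys z \<subseteq> W i \<and> Pi z = f"
proof -
  from assms have f: "\<And>n. f n \<in> range \<pi>" and fin: "finite {n. f n \<noteq> \<zero>\<^bsub>Q\<^esub>}" and sub: "{n. f n \<noteq> \<zero>\<^bsub>Q\<^esub>} \<subseteq> Bas i"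
    unfolding cring.free_mod_carrier[OF cring_Q] Q_carrier by auto
  have "\<forall>n. \<exists>p. f n = \<pi> p" using f by blast
  from choice[OF this] obtain r where r: "\<And>n. f n = \<pi> (r n)" by blast
  define g where "g q = (if f (to_nat q) = \<zero>\<^bsub>Q\<^esub> then 0 else r (to_nat q))" for q :: "'v qword"
  have "{q. g q \<noteq> 0} \<subseteq> to_nat -` {n. f n \<noteq> \<zero>\<^bsub>Q\<^esub>}" by (auto simp: g_def)
  then have fing: "finite {q. g q \<noteq> 0}"
    by (rule finite_subset) (rule finite_vimageI[OF fin inj_to_nat])
  define z where "z = Abs_poly_mapping g"
  have z: "lookup z = g" unfolding z_def by (rule lookup_Abs_poly_mapping[OF fing])
  have "keys z \<subseteq> W i"
  proof
    fix q assume "q \<in> keys z"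
    then have "to_nat q \<in> Bas i" using sub by (auto simp: in_keys_iff z g_def split: if_splits)
    then show "q \<in> W i" by (auto simp: Bas_def inj_image_mem_iff)
  qed
  moreover have "Pi z = f"
  proof (rule Pi_ext)
    show "Pi z (to_nat q) = f (to_nat q)" for q :: "'v qword"
      by (simp add: z g_def Q_simps flip: r)
    show "Pi z n = f n" if n: "n \<notin> range (to_nat :: 'v qword \<Rightarrow> nat)" for n
    proof -
      have "n \<notin> Bas i" using n by (auto simp: Bas_def)
      then show ?thesis using sub by (auto simp: Pi_other[OF n] Q_simps)
    qed
  qed
  ultimately show ?thesis by blast
qed

section \<open>Homogenisation: from strands over k to chains over A\<close>

text \<open>Restores the monomials that were set to 1. The truncated subtraction is exact for words
  in the strand.\<close>

definition hm :: "('v \<Rightarrow> nat) \<Rightarrow> ('v qword \<Rightarrow>\<^sub>0 'k) \<Rightarrow> 'v qword \<Rightarrow>\<^sub>0 ('v, 'k) mpoly" where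
  "hm \<alpha> y = Poly_Mapping.mapp (\<lambda>q. Poly_Mapping.single (pm (\<lambda>v. \<alpha> v - qdeg c q v))) y"

lemma lookup_hm: "lookup (hm \<alpha> y) q = Poly_Mapping.single (pm (\<lambda>v. \<alpha> v - qdeg c q v)) (lookup y q)"
  unfolding hm_def by (rule lookup_mapp') simp

lemma hm_diff: "hm \<alpha> (y - y') = hm \<alpha> y - hm \<alpha> y'"
  by (rule poly_mapping_eqI) (simp add: lookup_hm lookup_minus single_diff)

lemma keys_hm [simp]: "keys (hm \<alpha> y) = keys y"
  by (auto simp: in_keys_iff lookup_hm single_eq_0_iff)

definition dA :: "('v qword \<Rightarrow>\<^sub>0 ('v, 'k) mpoly) \<Rightarrow> 'v qword \<Rightarrow>\<^sub>0 ('v, 'k) mpoly" where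
  "dA = lext (\<lambda>q. hm (qdeg c q) (dQ q))"

lemma lin_dA: "lin dA"
  unfolding dA_def by (rule lin_lext)

lemmas dA_linear = linD[OF lin_dA]

lemma lookup_dA: "lookup (dA z) q' = (\<Sum>q\<in>keys z. lookup z q *
    Poly_Mapping.single (pm (\<lambda>v. qdeg c q v - qdeg c q' v)) (lookup (dQ q) q'))"
  by (simp add: dA_def lookup_lext lookup_hm)

text \<open>The exponents telescope: \<alpha> minus the degree of \<open>q\<close>, plus the degree
  of \<open>q\<close> minus that of \<open>q'\<close>.\<close>

lemma dA_hm:
  assumes "keys y \<subseteq> QA c \<alpha>"
  shows "dA (hm \<alpha> y) = hm \<alpha> (lext dQ y)"
proof (rule poly_mapping_eqI)
  fix q'
  have "lookup (dA (hm \<alpha> y)) q' = (\<Sum>q\<in>keys y.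
      Poly_Mapping.single (pm (\<lambda>v. \<alpha> v - qdeg c q' v)) (lookup y q * lookup (dQ q) q'))"
    unfolding lookup_dA keys_hm
  proof (rule sum.cong[OF refl])
    fix q assume q: "q \<in> keys y"
    show "lookup (hm \<alpha> y) q * Poly_Mapping.single (pm (\<lambda>v. qdeg c q v - qdeg c q' v)) (lookup (dQ q) q') =
        Poly_Mapping.single (pm (\<lambda>v. \<alpha> v - qdeg c q' v)) (lookup y q * lookup (dQ q) q')"
    proof (cases "lookup (dQ q :: _ \<Rightarrow>\<^sub>0 'k) q' = 0")
      case False
      have qA: "wfQ G q" "\<And>v. qdeg c q v \<le> \<alpha> v" using q assms by (auto simp: QA_def)
      have "qdeg c q' v \<le> qdeg c q v" for v
        using keys_dQ(3)[OF qA(1) _ c, where 'k = 'k] False by (simp add: in_keys_iff)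
      then have "(\<alpha> v - qdeg c q v) + (qdeg c q v - qdeg c q' v) = \<alpha> v - qdeg c q' v" for v
        using qA(2)[of v] by simp
      then show ?thesis by (simp add: lookup_hm mult_single pm_add)
    qed simp
  qed
  then show "lookup (dA (hm \<alpha> y)) q' = lookup (hm \<alpha> (lext dQ y)) q'"
    by (simp add: sum_single lookup_hm lookup_lext)
qed

definition cI :: "('v qword \<Rightarrow>\<^sub>0 ('v, 'k) mpoly) \<Rightarrow> bool" where
  "cI z \<longleftrightarrow> (\<forall>q. lookup z q \<in> I)"

lemma keys_sum': "q \<in> keys (sum f S) \<Longrightarrow> \<exists>s\<in>S. q \<in> keys (f s)"
  by (rule ccontr) (auto simp: in_keys_iff lookup_sum)

lemma cI_hm: "keys y \<subseteq> NA c \<alpha> \<Longrightarrow> cI (hm \<alpha> y)"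
  unfolding cI_def
proof
  fix q assume y: "keys y \<subseteq> NA c \<alpha>"
  show "lookup (hm \<alpha> y) q \<in> I"
  proof (cases "q \<in> keys y")
    case True
    then obtain m where m: "m \<in> G" "\<And>v. qdeg c q v + c * m v \<le> \<alpha> v" using y by (auto simp: NA_def)
    have "c * m v \<le> \<alpha> v - qdeg c q v" for v using m(2)[of v] by simp
    then show ?thesis using m(1) by (auto simp: lookup_hm mem_I)
  next
    case False
    then show ?thesis using I_closed(1) by (simp add: lookup_hm in_keys_iff)
  qed
qed

text \<open>In the coefficient of \<open>q\<close>, different \<alpha> yield different monomials, so
  nothing cancels, and a monomial ideal contains every monomial of its members.\<close>

lemma cI_sum_hm:
  assumes "finite S" "\<And>\<alpha>. \<alpha> \<in> S \<Longrightarrow> keys (y \<alpha>) \<subseteq> QA c \<alpha>" "cI (\<Sum>\<alpha>\<in>S. hm \<alpha> (y \<alpha>))" "\<alpha> \<in> S"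
  shows "keys (y \<alpha>) \<subseteq> NA c \<alpha>"
proof
  fix q assume q: "q \<in> keys (y \<alpha>)"
  then have qA: "wfQ G q" "\<And>v. qdeg c q v \<le> \<alpha> v" using assms(2)[OF assms(4)] by (auto simp: QA_def)
  let ?u = "pm (\<lambda>v. \<alpha> v - qdeg c q v)"
  have "lookup (lookup (\<Sum>\<alpha>\<in>S. hm \<alpha> (y \<alpha>)) q) ?u = (\<Sum>\<beta>\<in>S. if \<beta> = \<alpha> then lookup (y \<alpha>) q else 0)"
    unfolding lookup_sum
  proof (rule sum.cong[OF refl])
    fix \<beta> assume \<beta>: "\<beta> \<in> S"
    show "lookup (lookup (hm \<beta> (y \<beta>)) q) ?u = (if \<beta> = \<alpha> then lookup (y \<alpha>) q else 0)"
    proof (cases "\<beta> = \<alpha> \<or> lookup (y \<beta>) q = 0")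
      case False
      then have "q \<in> keys (y \<beta>)" by (simp add: in_keys_iff)
      then have qB: "\<And>v. qdeg c q v \<le> \<beta> v" using assms(2)[OF \<beta>] by (auto simp: QA_def)
      have "(\<lambda>v. \<beta> v - qdeg c q v) \<noteq> (\<lambda>v. \<alpha> v - qdeg c q v)"
      proof
        assume eq: "(\<lambda>v. \<beta> v - qdeg c q v) = (\<lambda>v. \<alpha> v - qdeg c q v)"
        have "\<beta> v = \<alpha> v" for v using fun_cong[OF eq, of v] qA(2)[of v] qB[of v] by simp
        then show False using False by auto
      qed
      then show ?thesis using False by (simp add: lookup_hm lookup_single pm_eq_iff)
    qed (auto simp: lookup_hm)
  qed
  also have "\<dots> = lookup (y \<alpha>) q" using assms(1,4) by simp
  finally have "?u \<in> keys (lookup (\<Sum>\<alpha>\<in>S. hm \<alpha> (y \<alpha>)) q)" using q by (simp add: in_keys_iff)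
  moreover have "lookup (\<Sum>\<alpha>\<in>S. hm \<alpha> (y \<alpha>)) q \<in> I" using assms(3) unfolding cI_def by (rule spec)
  ultimately obtain m where m: "m \<in> G" "\<And>v. c * m v \<le> \<alpha> v - qdeg c q v" unfolding mem_I by fastforce
  have "qdeg c q v + c * m v \<le> \<alpha> v" for v using m(2)[of v] qA(2)[of v] by simp
  then show "q \<in> NA c \<alpha>" using m(1) qA(1) by (auto simp: NA_def)
qed

text \<open>The component of degree \<alpha> with variables set to 1. The guard matters: for a word
  that does not fit, the truncated difference would select a coefficient of another degree.\<close>

definition comp :: "('v \<Rightarrow> nat) \<Rightarrow> ('v qword \<Rightarrow>\<^sub>0 ('v, 'k) mpoly) \<Rightarrow> 'v qword \<Rightarrow>\<^sub>0 'k" where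
  "comp \<alpha> z = Poly_Mapping.mapp (\<lambda>q p. if \<forall>v. qdeg c q v \<le> \<alpha> v then lookup p (pm (\<lambda>v. \<alpha> v - qdeg c q v)) else 0) z"

lemma lookup_comp: "lookup (comp \<alpha> z) q =
    (if \<forall>v. qdeg c q v \<le> \<alpha> v then lookup (lookup z q) (pm (\<lambda>v. \<alpha> v - qdeg c q v)) else 0)"
  unfolding comp_def by (subst lookup_mapp') auto

definition degs :: "('v qword \<Rightarrow>\<^sub>0 ('v, 'k) mpoly) \<Rightarrow> ('v \<Rightarrow> nat) set" where
  "degs z = (\<Union>q\<in>keys z. (\<lambda>u v. qdeg c q v + lookup u v) ` keys (lookup z q))"

lemma finite_degs: "finite (degs z)"
  by (simp add: degs_def)

lemma decomposition: "z = (\<Sum>\<alpha>\<in>degs z. hm \<alpha> (comp \<alpha> z))"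
proof (rule poly_mapping_eqI, rule poly_mapping_eqI)
  fix q :: "'v qword" and u
  let ?\<alpha> = "\<lambda>v. qdeg c q v + lookup u v"
  have "lookup (lookup (\<Sum>\<alpha>\<in>degs z. hm \<alpha> (comp \<alpha> z)) q) u =
      (\<Sum>\<alpha>\<in>degs z. if \<alpha> = ?\<alpha> then lookup (lookup z q) u else 0)"
    unfolding lookup_sum
  proof (rule sum.cong[OF refl])
    fix \<alpha> :: "'v \<Rightarrow> nat"
    show "lookup (lookup (hm \<alpha> (comp \<alpha> z)) q) u = (if \<alpha> = ?\<alpha> then lookup (lookup z q) u else 0)"
    proof (cases "\<alpha> = ?\<alpha>")
      case True
      then show ?thesis by (simp add: lookup_hm lookup_comp)
    next
      case False
      have "\<not> ((\<forall>v. qdeg c q v \<le> \<alpha> v) \<and> pm (\<lambda>v. \<alpha> v - qdeg c q v) = u)"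
      proof
        assume a: "(\<forall>v. qdeg c q v \<le> \<alpha> v) \<and> pm (\<lambda>v. \<alpha> v - qdeg c q v) = u"
        then have e: "\<alpha> v - qdeg c q v = lookup u v" for v by auto
        have "\<alpha> v = ?\<alpha> v" for v using a by (simp add: e[symmetric])
        then have "\<alpha> = ?\<alpha>" by (rule ext)
        with False show False ..
      qed
      then show ?thesis using False by (auto simp: lookup_hm lookup_comp lookup_single)
    qed
  qed
  also have "\<dots> = lookup (lookup z q) u"
  proof (cases "?\<alpha> \<in> degs z")
    case False
    have "lookup (lookup z q) u = 0"
    proof (rule ccontr)
      assume nz: "lookup (lookup z q) u \<noteq> 0"
      then have "u \<in> keys (lookup z q)" by (simp add: in_keys_iff)
      moreover have "q \<in> keys z" using nz by (auto simp: in_keys_iff)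
      ultimately have "?\<alpha> \<in> degs z" unfolding degs_def by blast
      with False show False ..
    qed
    then show ?thesis by (simp add: finite_degs)
  qed (simp add: finite_degs)
  finally show "lookup (lookup z q) u = lookup (lookup (\<Sum>\<alpha>\<in>degs z. hm \<alpha> (comp \<alpha> z)) q) u" by simp
qed

lemma keys_comp: "keys (comp \<alpha> z) \<subseteq> keys z"
  by (auto simp: in_keys_iff lookup_comp split: if_splits)

lemma comp_QA:
  assumes "keys z \<subseteq> W i"
  shows "keys (comp \<alpha> z) \<subseteq> QA c \<alpha>"
proof
  fix q assume q: "q \<in> keys (comp \<alpha> z)"
  then have "wfQ G q" using keys_comp[of \<alpha> z] assms by (auto simp: words_def)
  then show "q \<in> QA c \<alpha>" using q by (auto simp: in_keys_iff lookup_comp QA_def split: if_splits)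
qed

lemma lext_dQ_QA:
  assumes "keys y \<subseteq> QA c \<alpha>"
  shows "keys (lext dQ y :: _ \<Rightarrow>\<^sub>0 'k) \<subseteq> QA c \<alpha>"
proof
  fix q' assume "q' \<in> keys (lext dQ y :: _ \<Rightarrow>\<^sub>0 'k)"
  then obtain q where q: "q \<in> keys y" "q' \<in> keys (dQ q :: _ \<Rightarrow>\<^sub>0 'k)" by (rule keys_lextE)
  then have wf: "wfQ G q" and le: "\<And>v. qdeg c q v \<le> \<alpha> v" using assms by (auto simp: QA_def)
  have "qdeg c q' v \<le> \<alpha> v" for v using keys_dQ(3)[OF wf q(2) c, of v] le[of v] by simp
  then show "q' \<in> QA c \<alpha>" using keys_dQ(1)[OF wf q(2)] by (simp add: QA_def)
qed

text \<open>The chain is split into its finitely many strands, each is treated by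
  \<open>exact\<close>, and the results are homogenised and added. The condition \<open>pos\<close>
  keeps away from the strand of degree 0 in homological degree 0.\<close>

lemma dA_exact:
  assumes z: "keys z \<subseteq> W i" "cI (dA z)" and pos: "0 < i \<or> (\<forall>\<alpha>\<in>degs z. \<exists>v. 0 < \<alpha> v)"
  shows "\<exists>y. keys y \<subseteq> W (Suc i) \<and> cI (z - dA y)"
proof -
  have dz: "dA z = (\<Sum>\<alpha>\<in>degs z. hm \<alpha> (lext dQ (comp \<alpha> z)))"
  proof -
    have "dA z = dA (\<Sum>\<alpha>\<in>degs z. hm \<alpha> (comp \<alpha> z))" by (rule arg_cong[OF decomposition])
    also have "\<dots> = (\<Sum>\<alpha>\<in>degs z. dA (hm \<alpha> (comp \<alpha> z)))" by (rule dA_linear)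
    also have "\<dots> = (\<Sum>\<alpha>\<in>degs z. hm \<alpha> (lext dQ (comp \<alpha> z)))"
      by (intro sum.cong refl dA_hm comp_QA[OF z(1)])
    finally show ?thesis .
  qed
  have "\<forall>\<alpha>. \<exists>y. \<alpha> \<in> degs z \<longrightarrow> (keys y \<subseteq> QA c \<alpha> \<and> (\<forall>q\<in>keys y. qh q = Suc i) \<and>
    keys (comp \<alpha> z - lext dQ y) \<subseteq> NA c \<alpha>)"
  proof
    fix \<alpha>
    show "\<exists>y. \<alpha> \<in> degs z \<longrightarrow> (keys y \<subseteq> QA c \<alpha> \<and> (\<forall>q\<in>keys y. qh q = Suc i) \<and>
        keys (comp \<alpha> z - lext dQ y) \<subseteq> NA c \<alpha>)"
    proof (cases "\<alpha> \<in> degs z")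
      case True
      have N: "keys (lext dQ (comp \<alpha> z) :: _ \<Rightarrow>\<^sub>0 'k) \<subseteq> NA c \<alpha>"
        by (rule cI_sum_hm[where y = "\<lambda>\<alpha>. lext dQ (comp \<alpha> z)", OF finite_degs[of z] lext_dQ_QA[OF comp_QA[OF z(1)]] _ True])
          (use z(2) dz in simp)
      have h: "qh q = i" if "q \<in> keys (comp \<alpha> z)" for q
        using that keys_comp[of \<alpha> z] z(1) by (auto simp: words_def)
      have p: "0 < i \<or> (\<exists>v. 0 < \<alpha> v)" using pos True by blast
      show ?thesis
        by (rule exact[OF c comp_QA[OF z(1)] h N p]) blast+
    qed blast
  qed
  from choice[OF this] obtain y where y: "\<And>\<alpha>. \<alpha> \<in> degs z \<Longrightarrow> keys (y \<alpha>) \<subseteq> QA c \<alpha>"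
    "\<And>\<alpha> q. \<alpha> \<in> degs z \<Longrightarrow> q \<in> keys (y \<alpha>) \<Longrightarrow> qh q = Suc i"
    "\<And>\<alpha>. \<alpha> \<in> degs z \<Longrightarrow> keys (comp \<alpha> z - lext dQ (y \<alpha>)) \<subseteq> NA c \<alpha>" by blast
  define Y where "Y = (\<Sum>\<alpha>\<in>degs z. hm \<alpha> (y \<alpha>))"
  have "keys Y \<subseteq> W (Suc i)"
  proof
    fix q assume "q \<in> keys Y"
    then obtain \<alpha> where \<alpha>: "\<alpha> \<in> degs z" "q \<in> keys (y \<alpha>)"
      unfolding Y_def using keys_sum'[of _ "\<lambda>\<alpha>. hm \<alpha> (y \<alpha>)"] by fastforce
    then show "q \<in> W (Suc i)" using y(1,2)[OF \<alpha>(1)] by (auto simp: words_def QA_def)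
  qed
  moreover have "z - dA Y = (\<Sum>\<alpha>\<in>degs z. hm \<alpha> (comp \<alpha> z - lext dQ (y \<alpha>)))"
  proof -
    have "dA Y = (\<Sum>\<alpha>\<in>degs z. dA (hm \<alpha> (y \<alpha>)))" unfolding Y_def by (rule dA_linear)
    also have "\<dots> = (\<Sum>\<alpha>\<in>degs z. hm \<alpha> (lext dQ (y \<alpha>)))" by (intro sum.cong refl dA_hm y(1))
    finally have "dA Y = \<dots>" .
    moreover have "z = (\<Sum>\<alpha>\<in>degs z. hm \<alpha> (comp \<alpha> z))" by (rule decomposition)
    ultimately show ?thesis by (simp add: hm_diff sum_subtractf)
  qed
  moreover have "cI (\<Sum>\<alpha>\<in>degs z. hm \<alpha> (comp \<alpha> z - lext dQ (y \<alpha>)))"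
    using cI_hm[OF y(3)] unfolding cI_def lookup_sum by (intro allI I_sum) blast
  ultimately show ?thesis by auto
qed

lemma keys_dA:
  assumes "keys z \<subseteq> W (Suc i)"
  shows "keys (dA z) \<subseteq> W i"
proof
  fix q' assume "q' \<in> keys (dA z)"
  then obtain q where q: "q \<in> keys z" "q' \<in> keys (dQ q :: _ \<Rightarrow>\<^sub>0 'k)"
    unfolding dA_def by (elim keys_lextE) simp
  then have "wfQ G q" "qh q = Suc i" using assms by (auto simp: words_def)
  then show "q' \<in> W i" using keys_dQ(1,2)[OF _ q(2)] by (simp add: words_def)
qed

lemma cI_dA: "cI z \<Longrightarrow> cI (dA z)"
  unfolding cI_def lookup_dA by (intro allI I_sum I_mult_right) blast

text \<open>By linearity a single word suffices, viewed in the strand of its own degree.\<close>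

lemma cI_dA_dA:
  assumes "keys z \<subseteq> W i"
  shows "cI (dA (dA z))"
proof -
  have e: "dA (dA z) = lext (\<lambda>q. dA (hm (qdeg c q) (dQ q))) z"
  proof (rule lin_ext[of "\<lambda>z. dA (dA z)" "lext (\<lambda>q. dA (hm (qdeg c q) (dQ q)))"])
    show "lin (\<lambda>z. dA (dA z))" unfolding dA_def by (rule lin_intros(6)[OF lin_lext])
    show "dA (dA (Poly_Mapping.single q 1)) = lext (\<lambda>q. dA (hm (qdeg c q) (dQ q))) (Poly_Mapping.single q 1)" for q
      by (simp add: dA_def)
  qed (rule lin_lext)
  have "cI (dA (hm (qdeg c q) (dQ q)))" if q: "q \<in> keys z" for q
  proof -
    have wf: "wfQ G q" using q assms by (auto simp: words_def)
    then have qA: "q \<in> QA c (qdeg c q)" by (simp add: QA_def)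
    have "keys (lext dQ (Poly_Mapping.single q 1) :: _ \<Rightarrow>\<^sub>0 'k) \<subseteq> QA c (qdeg c q)"
      by (rule lext_dQ_QA) (simp add: qA)
    then have "keys (dQ q :: _ \<Rightarrow>\<^sub>0 'k) \<subseteq> QA c (qdeg c q)" by simp
    then show ?thesis using dA_hm cI_hm[OF dQ_dQ[OF c qA]] by simp
  qed
  then show ?thesis unfolding e cI_def lookup_lext by (intro allI I_sum I_closed(3)) blast
qed

section \<open>The resolution over A/I\<close>

definition rep :: "nat \<Rightarrow> (nat \<Rightarrow> ('v, 'k) mpoly set) \<Rightarrow> 'v qword \<Rightarrow>\<^sub>0 ('v, 'k) mpoly" where
  "rep i f = (SOME z. keys z \<subseteq> W i \<and> Pi z = f)"

lemma rep:
  assumes "f \<in> carrier (free_mod Q (Bas i))"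
  shows "keys (rep i f) \<subseteq> W i" "Pi (rep i f) = f"
  using someI_ex[OF Pi_surj[OF assms]] by (simp_all add: rep_def)

text \<open>Computed on a chosen lift to A. Another lift changes the result by a chain with
  coefficients in I, since \<open>dA\<close> is A-linear.\<close>

definition dP :: "nat \<Rightarrow> (nat \<Rightarrow> ('v, 'k) mpoly set) \<Rightarrow> nat \<Rightarrow> ('v, 'k) mpoly set" where
  "dP i f = Pi (dA (rep (Suc i) f))"

definition eP :: "(nat \<Rightarrow> ('v, 'k) mpoly set) \<Rightarrow> ('v, 'k) mpoly set" where
  "eP f = f (to_nat (([], []) :: 'v qword)) \<odot>\<^bsub>KN\<^esub> \<mu> 1"

lemma dP_Pi:
  assumes "keys z \<subseteq> W (Suc i)"
  shows "dP i (Pi z) = Pi (dA z)"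
proof -
  let ?z = "rep (Suc i) (Pi z)"
  have "Pi ?z = Pi z" by (rule rep(2)[OF Pi_carrier[OF assms]])
  then have "cI (?z - z)" unfolding Pi_eq_iff cI_def lookup_minus .
  from cI_dA[OF this] have "cI (dA ?z - dA z)" by (simp add: dA_linear)
  then show ?thesis unfolding dP_def Pi_eq_iff cI_def lookup_minus .
qed

lemma eP_Pi: "eP (Pi z) = \<mu> (lookup z ([], []))"
  by (simp add: eP_def KN_simps)

lemma words_0: "W 0 = {([], [])}"
  by (auto simp: words_def wfQ_def qh_def)

lemma dA_0:
  assumes "keys z \<subseteq> W 0"
  shows "dA z = 0"
proof -
  have "dQ ([], []) = (0 :: 'v qword \<Rightarrow>\<^sub>0 'k)" by (simp add: dQ_def dXb_Nil pmap_linear proj_linear)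
  then have "hm (qdeg c q) (dQ q) = 0" if "q \<in> keys z" for q
    using that assms words_0 by (auto intro!: poly_mapping_eqI simp: lookup_hm)
  then show ?thesis unfolding dA_def lext_def by (simp add: sum.neutral)
qed

lemma cI_diff_zero: "Pi z = (\<lambda>b. \<zero>\<^bsub>Q\<^esub>) \<longleftrightarrow> cI z"
  unfolding Pi_zero[symmetric] Pi_eq_iff cI_def by simp

text \<open>A bar has homological degree at least 2, so a word of degree 1 is a single variable of
  K, and that variable is the monomial coefficient of its differential.\<close>

lemma eP_dA:
  assumes "keys z \<subseteq> W (Suc 0)"
  shows "lookup (dA z) ([], []) \<in> max_ideal"
proof -
  have "Poly_Mapping.single (pm (\<lambda>v. qdeg c q v - qdeg c ([], []) v)) x \<in> max_ideal"
    if q: "q \<in> keys z" for q and x :: 'k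
  proof -
    from q assms have wf: "wfQ G q" "qh q = Suc 0" by (auto simp: words_def)
    obtain ts \<kappa> where q': "q = (ts, \<kappa>)" by (cases q)
    have "ts = []"
    proof (rule ccontr)
      assume "ts \<noteq> []"
      then obtain t ts' where t: "ts = t # ts'" by (cases ts) auto
      then have "t \<noteq> []" using wf(1) by (simp add: q' wfQ_def)
      then show False using wf(2) by (simp add: q' t qh_def)
    qed
    then obtain v where "q = ([], [v])" using wf(2) by (auto simp: q' qh_def length_Suc_conv)
    then have ne: "qdeg c q v - qdeg c ([], []) v \<noteq> 0" by (simp add: qdeg_def ind_def)
    have "(\<lambda>v. qdeg c q v - qdeg c ([], []) v) \<noteq> (\<lambda>v. 0)"
    proof
      assume "(\<lambda>v. qdeg c q v - qdeg c ([], []) v) = (\<lambda>v. 0)"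
      from fun_cong[OF this, of v] ne show False by simp
    qed
    then have "pm (\<lambda>v. qdeg c q v - qdeg c ([], []) v) \<noteq> 0" unfolding pm_eq_0_iff .
    then show ?thesis by (simp add: max_ideal_eq lookup_single)
  qed
  then have "lookup (lookup z q * Poly_Mapping.single (pm (\<lambda>v. qdeg c q v - qdeg c ([], []) v)) (lookup (dQ q) ([], []))) 0 = 0"
    if "q \<in> keys z" for q
    using that by (simp add: lookup_times_0 max_ideal_eq)
  then show ?thesis unfolding max_ideal_eq lookup_dA by (simp add: lookup_sum)
qed

theorem free_resolution_taylor: "free_resolution Q KN Bas dP eP"
proof -
  interpret Q: cring Q by (rule cring_Q)
  have fs: "\<And>f i. f \<in> carrier (free_mod Q (Bas i)) \<Longrightarrow> \<exists>z. keys z \<subseteq> W i \<and> f = Pi z"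
    using Pi_surj by blast
  have ksum: "keys (z + z') \<subseteq> W i" if "keys z \<subseteq> W i" "keys z' \<subseteq> W i"
    for z z' :: "'v qword \<Rightarrow>\<^sub>0 ('v, 'k) mpoly" and i
    using that keys_add[of z z'] by blast
  have kscl: "keys (scl p z) \<subseteq> W i" if "keys z \<subseteq> W i" for z :: "'v qword \<Rightarrow>\<^sub>0 ('v, 'k) mpoly" and i p
    using that keys_scl[of p z] by blast
  have e_hom: "eP \<in> module_hom Q (free_mod Q (Bas 0)) KN"
    unfolding module_hom_def
  proof (intro CollectI conjI allI impI Pi_I; (elim conjE)?)
    fix f assume "f \<in> carrier (free_mod Q (Bas 0))"
    then obtain z where z: "keys z \<subseteq> W 0" "f = Pi z" using fs by blast
    show "eP f \<in> carrier KN" by (simp add: z eP_Pi KN_carrier)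
    fix g assume "g \<in> carrier (free_mod Q (Bas 0))"
    then obtain z' where z': "keys z' \<subseteq> W 0" "g = Pi z'" using fs by blast
    show "eP (f \<oplus>\<^bsub>free_mod Q (Bas 0)\<^esub> g) = eP f \<oplus>\<^bsub>KN\<^esub> eP g"
      unfolding z z' Pi_add eP_Pi KN_simps by (simp add: lookup_add)
  next
    fix r f assume "r \<in> carrier Q" "f \<in> carrier (free_mod Q (Bas 0))"
    then obtain p z where z: "r = \<pi> p" "keys z \<subseteq> W 0" "f = Pi z" unfolding Q_carrier using fs by blast
    show "eP (r \<odot>\<^bsub>free_mod Q (Bas 0)\<^esub> f) = r \<odot>\<^bsub>KN\<^esub> eP f"
      unfolding z Pi_smult eP_Pi KN_simps by simp
  qed
  have d_hom: "dP i \<in> module_hom Q (free_mod Q (Bas (Suc i))) (free_mod Q (Bas i))" for i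
    unfolding module_hom_def
  proof (intro CollectI conjI allI impI Pi_I; (elim conjE)?)
    fix f assume "f \<in> carrier (free_mod Q (Bas (Suc i)))"
    then obtain z where z: "keys z \<subseteq> W (Suc i)" "f = Pi z" using fs by blast
    show "dP i f \<in> carrier (free_mod Q (Bas i))"
      unfolding z dP_Pi[OF z(1)] by (rule Pi_carrier[OF keys_dA[OF z(1)]])
    fix g assume "g \<in> carrier (free_mod Q (Bas (Suc i)))"
    then obtain z' where z': "keys z' \<subseteq> W (Suc i)" "g = Pi z'" using fs by blast
    show "dP i (f \<oplus>\<^bsub>free_mod Q (Bas (Suc i))\<^esub> g) = dP i f \<oplus>\<^bsub>free_mod Q (Bas i)\<^esub> dP i g"
      unfolding z z' Pi_add dP_Pi[OF z(1)] dP_Pi[OF z'(1)] dP_Pi[OF ksum[OF z(1) z'(1)]] by (simp add: dA_linear)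
  next
    fix r f assume "r \<in> carrier Q" "f \<in> carrier (free_mod Q (Bas (Suc i)))"
    then obtain p z where z: "r = \<pi> p" "keys z \<subseteq> W (Suc i)" "f = Pi z" unfolding Q_carrier using fs by blast
    show "dP i (r \<odot>\<^bsub>free_mod Q (Bas (Suc i))\<^esub> f) = r \<odot>\<^bsub>free_mod Q (Bas i)\<^esub> dP i f"
      unfolding z(1,3) Pi_smult dP_Pi[OF z(2)] dP_Pi[OF kscl[OF z(2)]] by (simp add: dA_linear)
  qed
  have surj: "eP ` carrier (free_mod Q (Bas 0)) = carrier KN"
  proof (intro equalityI subsetI)
    fix y assume "y \<in> carrier KN"
    then obtain p where p: "y = \<mu> p" unfolding KN_carrier by blast
    let ?z = "Poly_Mapping.single ([], []) p :: 'v qword \<Rightarrow>\<^sub>0 ('v, 'k) mpoly"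
    have "keys ?z \<subseteq> W 0" by (simp add: words_0)
    then have "Pi ?z \<in> carrier (free_mod Q (Bas 0))" by (rule Pi_carrier)
    moreover have "y = eP (Pi ?z)" by (simp add: p eP_Pi)
    ultimately show "y \<in> eP ` carrier (free_mod Q (Bas 0))" by blast
  next
    fix y assume "y \<in> eP ` carrier (free_mod Q (Bas 0))"
    then obtain f where "f \<in> carrier (free_mod Q (Bas 0))" "y = eP f" by blast
    then show "y \<in> carrier KN" using Q.module_homD(1)[OF e_hom] by simp
  qed
  have lift: "Pi z \<in> dP i ` carrier (free_mod Q (Bas (Suc i)))"
    if z: "keys z \<subseteq> W i" "cI (dA z)" and pos: "0 < i \<or> (\<forall>\<alpha>\<in>degs z. \<exists>v. 0 < \<alpha> v)" for z i
  proof -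
    from dA_exact[OF that] obtain y where y: "keys y \<subseteq> W (Suc i)" "cI (z - dA y)" by blast
    have "Pi z = Pi (dA y)" using y(2) unfolding Pi_eq_iff cI_def lookup_minus .
    then have "Pi z = dP i (Pi y)" by (simp add: dP_Pi[OF y(1)])
    then show ?thesis using Pi_carrier[OF y(1)] by blast
  qed
  have ex0: "dP 0 ` carrier (free_mod Q (Bas 1)) = {x \<in> carrier (free_mod Q (Bas 0)). eP x = \<zero>\<^bsub>KN\<^esub>}"
  proof (intro equalityI subsetI)
    fix x assume "x \<in> dP 0 ` carrier (free_mod Q (Bas 1))"
    then obtain f where f: "f \<in> carrier (free_mod Q (Bas (Suc 0)))" "x = dP 0 f" by auto
    then obtain z where z: "keys z \<subseteq> W (Suc 0)" "f = Pi z" using fs by blast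
    have "\<mu> (lookup (dA z) ([], [])) = \<mu> 0"
      using eP_dA[OF z(1)] coset_eq_iff[of max_ideal "lookup (dA z) ([], [])" 0] by simp
    then have "eP x = \<zero>\<^bsub>KN\<^esub>" unfolding f(2) z(2) dP_Pi[OF z(1)] eP_Pi KN_simps .
    then show "x \<in> {x \<in> carrier (free_mod Q (Bas 0)). eP x = \<zero>\<^bsub>KN\<^esub>}"
      using Q.module_homD(1)[OF d_hom f(1)] f(2) by simp
  next
    fix x assume "x \<in> {x \<in> carrier (free_mod Q (Bas 0)). eP x = \<zero>\<^bsub>KN\<^esub>}"
    then have x: "x \<in> carrier (free_mod Q (Bas 0))" "eP x = \<zero>\<^bsub>KN\<^esub>" by auto
    then obtain z where z: "keys z \<subseteq> W 0" "x = Pi z" using fs by blast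
    have "\<mu> (lookup z ([], [])) = \<mu> 0" using x(2) unfolding z eP_Pi KN_simps .
    then have m: "lookup (lookup z ([], [])) 0 = 0"
      using coset_eq_iff[of max_ideal "lookup z ([], [])" 0] by (simp add: max_ideal_eq)
    \<comment> \<open>The only word in degree 0 is the empty one, of multidegree 0. Its coefficient
      has no constant term, so no strand of degree 0 occurs.\<close>
    have "\<exists>v. 0 < \<alpha> v" if "\<alpha> \<in> degs z" for \<alpha>
    proof -
      from that obtain q u where q: "q \<in> keys z" "u \<in> keys (lookup z q)" "\<alpha> = (\<lambda>v. qdeg c q v + lookup u v)"
        unfolding degs_def by blast
      then have "q = ([], [])" using z(1) words_0 by blast
      with q m have "u \<noteq> 0" by (auto simp: in_keys_iff)
      then obtain v where "lookup u v \<noteq> 0" using poly_mapping_eqI[of u 0] by auto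
      then show ?thesis by (auto simp: q(3))
    qed
    moreover have "cI (dA z)" using dA_0[OF z(1)] I_closed(1) by (simp add: cI_def)
    ultimately show "x \<in> dP 0 ` carrier (free_mod Q (Bas 1))"
      using lift[OF z(1)] unfolding z(2) by simp
  qed
  have exS: "dP (Suc i) ` carrier (free_mod Q (Bas (Suc (Suc i)))) =
      {x \<in> carrier (free_mod Q (Bas (Suc i))). dP i x = \<zero>\<^bsub>free_mod Q (Bas i)\<^esub>}" for i
  proof (intro equalityI subsetI)
    fix x assume "x \<in> dP (Suc i) ` carrier (free_mod Q (Bas (Suc (Suc i))))"
    then obtain f where f: "f \<in> carrier (free_mod Q (Bas (Suc (Suc i))))" "x = dP (Suc i) f" by auto
    then obtain z where z: "keys z \<subseteq> W (Suc (Suc i))" "f = Pi z" using fs by blast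
    have "dP i x = (\<lambda>b. \<zero>\<^bsub>Q\<^esub>)"
      unfolding f(2) z(2) dP_Pi[OF z(1)] dP_Pi[OF keys_dA[OF z(1)]] cI_diff_zero by (rule cI_dA_dA[OF z(1)])
    then show "x \<in> {x \<in> carrier (free_mod Q (Bas (Suc i))). dP i x = \<zero>\<^bsub>free_mod Q (Bas i)\<^esub>}"
      using Q.module_homD(1)[OF d_hom f(1)] f(2) by simp
  next
    fix x assume "x \<in> {x \<in> carrier (free_mod Q (Bas (Suc i))). dP i x = \<zero>\<^bsub>free_mod Q (Bas i)\<^esub>}"
    then have x: "x \<in> carrier (free_mod Q (Bas (Suc i)))" "dP i x = (\<lambda>b. \<zero>\<^bsub>Q\<^esub>)" by auto
    then obtain z where z: "keys z \<subseteq> W (Suc i)" "x = Pi z" using fs by blast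
    have "cI (dA z)" using x(2) unfolding z(2) dP_Pi[OF z(1)] cI_diff_zero .
    then show "x \<in> dP (Suc i) ` carrier (free_mod Q (Bas (Suc (Suc i))))"
      using lift[OF z(1)] unfolding z(2) by simp
  qed
  show ?thesis
    unfolding free_resolution_def by (intro conjI allI e_hom d_hom surj ex0 exS)
qed

end

subsection \<open>Tor of the residue field\<close>

context taylor_resolution
begin

definition cc :: "('v qword \<Rightarrow>\<^sub>0 ('v, 'k) mpoly) \<Rightarrow> 'v qword \<Rightarrow>\<^sub>0 'k" where
  "cc z = Poly_Mapping.mapp (\<lambda>q p. lookup p 0) z"

definition cst :: "('v qword \<Rightarrow>\<^sub>0 'k) \<Rightarrow> 'v qword \<Rightarrow>\<^sub>0 ('v, 'k) mpoly" where
  "cst y = Poly_Mapping.mapp (\<lambda>q. mconst) y"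

lemma lookup_cc: "lookup (cc z) q = lookup (lookup z q) 0"
  unfolding cc_def by (rule lookup_mapp') simp

lemma lookup_cst: "lookup (cst y) q = mconst (lookup y q)"
  unfolding cst_def by (rule lookup_mapp') (simp add: mconst_def)

lemma keys_cc: "keys (cc z) \<subseteq> keys z"
  by (auto simp: in_keys_iff lookup_cc)

lemma keys_cst: "keys (cst y) \<subseteq> keys y"
  by (auto simp: in_keys_iff lookup_cst mconst_def)

lemma cc_cst [simp]: "cc (cst y) = y"
  by (rule poly_mapping_eqI) (simp add: lookup_cc lookup_cst mconst_def)

lemma cc_linear: "cc 0 = 0" "cc (z + z') = cc z + cc z'" "cc (z - z') = cc z - cc z'"
  by (rule poly_mapping_eqI, simp add: lookup_cc lookup_add lookup_minus)+

lemma cst_linear: "cst 0 = 0" "cst (y + y') = cst y + cst y'" "cst (scl a y) = scl (mconst a) (cst y)"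
  by (rule poly_mapping_eqI, simp add: lookup_cst lookup_add mconst_def single_add mult_single)+

text \<open>A coefficient of the differential is a scalar times a monomial, with a constant term
  only if the degrees agree. By the last clause of \<open>keys_dQ\<close> this may be tested with 1
  in place of \<open>c\<close>, and \<open>c\<close> disappears.\<close>

lemma cc_dA:
  assumes "keys z \<subseteq> W i"
  shows "cc (dA z) = lext dbar (cc z)"
proof (rule poly_mapping_eqI)
  fix q'
  have "lookup (cc (dA z)) q' = (\<Sum>q\<in>keys z. lookup (cc z) q * lookup (dbar q) q')"
    unfolding lookup_cc lookup_dA lookup_sum
  proof (rule sum.cong[OF refl])
    fix q assume "q \<in> keys z"
    then have wf: "wfQ G q" using assms by (auto simp: words_def)
    have "lookup (Poly_Mapping.single (pm (\<lambda>v. qdeg c q v - qdeg c q' v)) (lookup (dQ q) q')) 0 = lookup (dbar q :: _ \<Rightarrow>\<^sub>0 'k) q'"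
    proof (cases "lookup (dQ q :: _ \<Rightarrow>\<^sub>0 'k) q' = 0")
      case False
      then have q': "q' \<in> keys (dQ q :: _ \<Rightarrow>\<^sub>0 'k)" by (simp add: in_keys_iff)
      have le: "qdeg c q' v \<le> qdeg c q v" for v by (rule keys_dQ(3)[OF wf q' c])
      have "pm (\<lambda>v. qdeg c q v - qdeg c q' v) = 0 \<longleftrightarrow> qdeg c q' = qdeg c q"
      proof
        assume "pm (\<lambda>v. qdeg c q v - qdeg c q' v) = 0"
        then have "(\<lambda>v. qdeg c q v - qdeg c q' v) = (\<lambda>v. 0)" unfolding pm_eq_0_iff .
        then have z: "qdeg c q v - qdeg c q' v = 0" for v by (rule fun_cong)
        show "qdeg c q' = qdeg c q" by (rule ext) (use le z in \<open>simp add: antisym\<close>)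
      qed (simp add: pm_eq_0_iff)
      also have "\<dots> \<longleftrightarrow> qdeg 1 q' = qdeg 1 q"
        using keys_dQ(4)[OF wf q', of c 1] keys_dQ(4)[OF wf q', of 1 c] c by auto
      finally show ?thesis by (simp add: lookup_single when_def lookup_dbar)
    qed (simp add: lookup_dbar)
    then show "lookup (lookup z q * Poly_Mapping.single (pm (\<lambda>v. qdeg c q v - qdeg c q' v)) (lookup (dQ q) q')) 0 =
        lookup (lookup z q) 0 * lookup (dbar q) q'"
      by (simp add: lookup_times_0)
  qed
  also have "\<dots> = lookup (lext dbar (cc z)) q'"
    unfolding lookup_lext by (rule sum.mono_neutral_right) (auto simp: in_keys_iff lookup_cc)
  finally show "lookup (cc (dA z)) q' = lookup (lext dbar (cc z)) q'" .
qed

lemma residue_map_Q: "residue_map Q const_coeff"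
  using residue_tensor_KN by (rule residue_tensor.axioms(1))

lemma red_Pi_eq_iff:
  "residue_map.red const_coeff (Pi z) = residue_map.red const_coeff (Pi z') \<longleftrightarrow> cc z = cc z'"
proof -
  have red: "residue_map.red const_coeff x b = const_coeff (x b)" for x :: "nat \<Rightarrow> ('v, 'k) mpoly set" and b
    by (simp add: residue_map.red_def[OF residue_map_Q])
  show ?thesis
  proof
    assume eq: "residue_map.red const_coeff (Pi z) = residue_map.red const_coeff (Pi z')"
    show "cc z = cc z'"
    proof (rule poly_mapping_eqI)
      fix q :: "'v qword"
      from fun_cong[OF eq, of "to_nat q"] show "lookup (cc z) q = lookup (cc z') q"
        by (simp add: red const_coeff_coset lookup_cc)
    qed
  next
    assume eq: "cc z = cc z'"
    have "lookup (lookup z q) 0 = lookup (lookup z' q) 0" for q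
      using arg_cong[OF eq, of "\<lambda>y. lookup y q"] by (simp add: lookup_cc)
    then show "residue_map.red const_coeff (Pi z) = residue_map.red const_coeff (Pi z')"
      by (intro Pi_ext) (simp_all add: red const_coeff_coset Pi_other)
  qed
qed

lemma red_Pi_eq_0_iff: "residue_map.red const_coeff (Pi z) = (\<lambda>b. 0) \<longleftrightarrow> cc z = 0"
proof -
  have "residue_map.red const_coeff (Pi 0) = (\<lambda>b. 0 :: 'k)"
    unfolding residue_map.red_def[OF residue_map_Q]
    by (intro Pi_ext) (simp_all add: const_coeff_coset Pi_other)
  then show ?thesis using red_Pi_eq_iff[of z 0] by (simp add: cc_linear)
qed

lemma mcyc_Pi:
  assumes "keys z \<subseteq> W i"
  shows "Pi z \<in> residue_map.mcyc Q const_coeff Bas dP i \<longleftrightarrow> cc z \<in> bar_cycles G i"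
proof -
  have k: "keys (cc z) \<subseteq> W i" using keys_cc[of z] assms by blast
  show ?thesis
  proof (cases i)
    case 0
    then show ?thesis using Pi_carrier[OF assms] k
      by (simp add: residue_map.mcyc_def[OF residue_map_Q] bar_cycles_def)
  next
    case (Suc j)
    have "residue_map.red const_coeff (dP j (Pi z)) = (\<lambda>b. 0) \<longleftrightarrow> lext dbar (cc z) = 0"
      using assms unfolding Suc by (simp add: dP_Pi red_Pi_eq_0_iff cc_dA[of z "Suc j"])
    then show ?thesis using Pi_carrier[OF assms] k
      by (simp add: residue_map.mcyc_def[OF residue_map_Q] bar_cycles_def Suc)
  qed
qed

lemma mbd_Pi:
  assumes "keys z \<subseteq> W i"
  shows "Pi z \<in> residue_map.mbd Q const_coeff Bas dP i \<longleftrightarrow> cc z \<in> bar_boundaries G i"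
proof -
  have red: "residue_map.red const_coeff (Pi z) = residue_map.red const_coeff (dP i (Pi w)) \<longleftrightarrow> cc z = lext dbar (cc w)"
    if "keys w \<subseteq> W (Suc i)" for w
    unfolding dP_Pi[OF that] red_Pi_eq_iff cc_dA[OF that] ..
  show ?thesis
  proof
    assume "Pi z \<in> residue_map.mbd Q const_coeff Bas dP i"
    then obtain f where f: "f \<in> carrier (free_mod Q (Bas (Suc i)))"
      "residue_map.red const_coeff (Pi z) = residue_map.red const_coeff (dP i f)"
      unfolding residue_map.mbd_def[OF residue_map_Q] by blast
    then obtain w where w: "keys w \<subseteq> W (Suc i)" "Pi w = f" using Pi_surj by blast
    have "cc z = lext dbar (cc w)" using f(2) red[OF w(1)] by (simp add: w(2))
    moreover have "keys (cc w) \<subseteq> W (Suc i)" using keys_cc[of w] w(1) by blast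
    ultimately show "cc z \<in> bar_boundaries G i" unfolding bar_boundaries_def by blast
  next
    assume "cc z \<in> bar_boundaries G i"
    then obtain w where w: "keys w \<subseteq> W (Suc i)" "cc z = lext dbar w" unfolding bar_boundaries_def by blast
    have k: "keys (cst w) \<subseteq> W (Suc i)" using keys_cst[of w] w(1) by blast
    have "residue_map.red const_coeff (Pi z) = residue_map.red const_coeff (dP i (Pi (cst w)))"
      using red[OF k] w(2) by simp
    then show "Pi z \<in> residue_map.mbd Q const_coeff Bas dP i"
      using Pi_carrier[OF k] Pi_carrier[OF assms] unfolding residue_map.mbd_def[OF residue_map_Q] by blast
  qed
qed

abbreviation "TorK i \<equiv> Tor Q KN KN i"

text \<open>Constants give a k-linear section \<open>cst\<close> of the reduction \<open>cc\<close>,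
  and with it cycles are represented by constant coefficients. A chain \<open>z\<close> differs from
  \<open>cst (cc z)\<close> by one of residue 0, which vanishes in Tor.\<close>

theorem Tor_bar:
  "\<exists>\<theta>. \<theta> ` bar_cycles G i = carrier (TorK i) \<and>
    (\<forall>x\<in>bar_cycles G i. \<forall>y\<in>bar_cycles G i. \<theta> (x + y) = \<theta> x \<oplus>\<^bsub>TorK i\<^esub> \<theta> y) \<and>
    (\<forall>x\<in>bar_cycles G i. \<forall>a. \<theta> (scl a x) = \<pi> (mconst a) \<odot>\<^bsub>TorK i\<^esub> \<theta> x) \<and>
    \<theta> 0 = \<zero>\<^bsub>TorK i\<^esub> \<and> (\<forall>x\<in>bar_cycles G i. \<theta> x = \<zero>\<^bsub>TorK i\<^esub> \<longleftrightarrow> x \<in> bar_boundaries G i)"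
proof -
  let ?mcyc = "residue_map.mcyc Q const_coeff Bas dP i" and ?mbd = "residue_map.mbd Q const_coeff Bas dP i"
  let ?F = "free_mod Q (Bas i)"
  from residue_tensor.Tor_presentation[OF residue_tensor_KN module_KN free_resolution_taylor, of i]
  obtain \<Theta> where "\<Theta> ` ?mcyc = carrier (TorK i) \<and>
    (\<forall>x\<in>carrier ?F. \<forall>y\<in>carrier ?F. \<Theta> (x \<oplus>\<^bsub>?F\<^esub> y) = \<Theta> x \<oplus>\<^bsub>TorK i\<^esub> \<Theta> y) \<and>
    (\<forall>x\<in>carrier ?F. \<forall>r\<in>carrier Q. \<Theta> (r \<odot>\<^bsub>?F\<^esub> x) = r \<odot>\<^bsub>TorK i\<^esub> \<Theta> x) \<and>
    (\<forall>x\<in>?mcyc. \<Theta> x = \<zero>\<^bsub>TorK i\<^esub> \<longleftrightarrow> x \<in> ?mbd)" ..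
  then have surj: "\<Theta> ` ?mcyc = carrier (TorK i)"
    and add: "\<And>x y. x \<in> carrier ?F \<Longrightarrow> y \<in> carrier ?F \<Longrightarrow> \<Theta> (x \<oplus>\<^bsub>?F\<^esub> y) = \<Theta> x \<oplus>\<^bsub>TorK i\<^esub> \<Theta> y"
    and smult: "\<And>x r. x \<in> carrier ?F \<Longrightarrow> r \<in> carrier Q \<Longrightarrow> \<Theta> (r \<odot>\<^bsub>?F\<^esub> x) = r \<odot>\<^bsub>TorK i\<^esub> \<Theta> x"
    and ker: "\<And>x. x \<in> ?mcyc \<Longrightarrow> \<Theta> x = \<zero>\<^bsub>TorK i\<^esub> \<longleftrightarrow> x \<in> ?mbd" by blast+
  have kc: "keys (cst y) \<subseteq> W i" if "y \<in> bar_cycles G i" for y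
    using that keys_cst[of y] unfolding bar_cycles_def by blast
  have cyc: "Pi (cst y) \<in> ?mcyc" if "y \<in> bar_cycles G i" for y
    using mcyc_Pi[OF kc[OF that]] that by simp
  have z0: "(0 :: 'v qword \<Rightarrow>\<^sub>0 'k) \<in> bar_cycles G i" "(0 :: 'v qword \<Rightarrow>\<^sub>0 'k) \<in> bar_boundaries G i"
    unfolding bar_cycles_def bar_boundaries_def
    by (auto simp: lext_linear intro!: exI[of _ 0])
  have null: "\<Theta> (Pi z) = \<zero>\<^bsub>TorK i\<^esub>" if "keys z \<subseteq> W i" "cc z = 0" for z
    using ker[of "Pi z"] mcyc_Pi[OF that(1)] mbd_Pi[OF that(1)] z0 by (simp add: that(2))
  have padd: "\<Theta> (Pi (z + z')) = \<Theta> (Pi z) \<oplus>\<^bsub>TorK i\<^esub> \<Theta> (Pi z')" if "keys z \<subseteq> W i" "keys z' \<subseteq> W i" for z z'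
    using add[OF Pi_carrier[OF that(1)] Pi_carrier[OF that(2)]] by (simp only: Pi_add)
  have "(\<lambda>y. \<Theta> (Pi (cst y))) ` bar_cycles G i = carrier (TorK i)"
  proof (intro equalityI subsetI)
    fix T assume "T \<in> carrier (TorK i)"
    then obtain f where f: "f \<in> ?mcyc" "T = \<Theta> f" using surj by blast
    then have "f \<in> carrier ?F" unfolding residue_map.mcyc_def[OF residue_map_Q] by blast
    then obtain z where z: "keys z \<subseteq> W i" "Pi z = f" using Pi_surj by blast
    have y: "cc z \<in> bar_cycles G i" using f(1) mcyc_Pi[OF z(1)] by (simp add: z(2))
    have kd: "keys (z - cst (cc z)) \<subseteq> W i" using z(1) kc[OF y] keys_diffE[of _ z "cst (cc z)"] by blast
    have k0: "keys (0 :: 'v qword \<Rightarrow>\<^sub>0 ('v, 'k) mpoly) \<subseteq> W i" by simp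
    have "T = \<Theta> (Pi (cst (cc z) + (z - cst (cc z))))" by (simp add: f(2) z(2))
    also have "\<dots> = \<Theta> (Pi (cst (cc z))) \<oplus>\<^bsub>TorK i\<^esub> \<Theta> (Pi (z - cst (cc z)))" by (rule padd[OF kc[OF y] kd])
    also have "\<Theta> (Pi (z - cst (cc z))) = \<Theta> (Pi 0)"
      using null[OF kd] null[OF k0] by (simp add: cc_linear)
    also have "\<Theta> (Pi (cst (cc z))) \<oplus>\<^bsub>TorK i\<^esub> \<Theta> (Pi 0) = \<Theta> (Pi (cst (cc z)))"
      using padd[OF kc[OF y] k0] by simp
    finally show "T \<in> (\<lambda>y. \<Theta> (Pi (cst y))) ` bar_cycles G i" using y by blast
  next
    fix T assume "T \<in> (\<lambda>y. \<Theta> (Pi (cst y))) ` bar_cycles G i"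
    then show "T \<in> carrier (TorK i)" using surj cyc by blast
  qed
  moreover have "\<forall>x\<in>bar_cycles G i. \<forall>y\<in>bar_cycles G i.
      \<Theta> (Pi (cst (x + y))) = \<Theta> (Pi (cst x)) \<oplus>\<^bsub>TorK i\<^esub> \<Theta> (Pi (cst y))"
    using padd[OF kc kc] by (simp add: cst_linear)
  moreover have "\<Theta> (Pi (cst (scl a x))) = \<pi> (mconst a) \<odot>\<^bsub>TorK i\<^esub> \<Theta> (Pi (cst x))" if "x \<in> bar_cycles G i" for a x
  proof -
    have "\<Theta> (\<pi> (mconst a) \<odot>\<^bsub>?F\<^esub> Pi (cst x)) = \<pi> (mconst a) \<odot>\<^bsub>TorK i\<^esub> \<Theta> (Pi (cst x))"
      by (rule smult[OF Pi_carrier[OF kc[OF that]]]) (simp add: Q_carrier)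
    then show ?thesis by (simp only: Pi_smult cst_linear)
  qed
  moreover have "\<Theta> (Pi (cst 0)) = \<zero>\<^bsub>TorK i\<^esub>" by (rule null) (simp_all add: cst_linear cc_linear)
  moreover have "\<Theta> (Pi (cst x)) = \<zero>\<^bsub>TorK i\<^esub> \<longleftrightarrow> x \<in> bar_boundaries G i" if "x \<in> bar_cycles G i" for x
    using ker[OF cyc[OF that]] mbd_Pi[OF kc[OF that]] by simp
  ultimately show ?thesis by (intro exI[of _ "\<lambda>y. \<Theta> (Pi (cst y))"]) simp
qed

end

section \<open>Equality of the Poincare series\<close>

lemma bar_cycles_closed:
  "0 \<in> bar_cycles G i" "x \<in> bar_cycles G i \<Longrightarrow> y \<in> bar_cycles G i \<Longrightarrow> x + y \<in> bar_cycles G i"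
  "x \<in> bar_cycles G i \<Longrightarrow> scl a x \<in> bar_cycles G i"
  using keys_add[of x y] keys_scl[of a x] by (auto simp: bar_cycles_def lext_linear)

lemma restrict_scalars_simps:
  "carrier (restrict_scalars h M) = carrier M" "\<zero>\<^bsub>restrict_scalars h M\<^esub> = \<zero>\<^bsub>M\<^esub>"
  "x \<oplus>\<^bsub>restrict_scalars h M\<^esub> y = x \<oplus>\<^bsub>M\<^esub> y" "a \<odot>\<^bsub>restrict_scalars h M\<^esub> x = h a \<odot>\<^bsub>M\<^esub> x"
  by (simp_all add: restrict_scalars_def)

text \<open>In each degree both Tor spaces are the quotient of the same cycles by the same
  boundaries.\<close>

theorem poincare_series_scale:
  fixes I I' :: "('v::finite, 'k::field) mpoly set"
  assumes "taylor_resolution G c I" "taylor_resolution G c' I'"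
  shows "poincare_series I = poincare_series I'"
proof -
  interpret R: taylor_resolution G c I by fact
  interpret R': taylor_resolution G c' I' by fact
  let ?V = "\<lambda>i. restrict_scalars (\<lambda>a. I +>\<^bsub>mpoly_ring\<^esub> mconst a) (R.TorK i)"
  let ?V' = "\<lambda>i. restrict_scalars (\<lambda>a. I' +>\<^bsub>mpoly_ring\<^esub> mconst a) (R'.TorK i)"
  have "vectorspace.dim (ring_of_type_algebra :: 'k ring) (?V i) = vectorspace.dim ring_of_type_algebra (?V' i)" for i
  proof -
    from R.Tor_bar[of i] obtain \<theta> where
      1: "\<theta> ` bar_cycles G i = carrier (R.TorK i)"
      "\<And>x y. x \<in> bar_cycles G i \<Longrightarrow> y \<in> bar_cycles G i \<Longrightarrow> \<theta> (x + y) = \<theta> x \<oplus>\<^bsub>R.TorK i\<^esub> \<theta> y"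
      "\<And>a x. x \<in> bar_cycles G i \<Longrightarrow> \<theta> (scl a x) = coset I (mconst a) \<odot>\<^bsub>R.TorK i\<^esub> \<theta> x"
      "\<theta> 0 = \<zero>\<^bsub>R.TorK i\<^esub>"
      "\<And>x. x \<in> bar_cycles G i \<Longrightarrow> \<theta> x = \<zero>\<^bsub>R.TorK i\<^esub> \<longleftrightarrow> x \<in> bar_boundaries G i" by auto
    from R'.Tor_bar[of i] obtain \<theta>' where
      2: "\<theta>' ` bar_cycles G i = carrier (R'.TorK i)"
      "\<And>x y. x \<in> bar_cycles G i \<Longrightarrow> y \<in> bar_cycles G i \<Longrightarrow> \<theta>' (x + y) = \<theta>' x \<oplus>\<^bsub>R'.TorK i\<^esub> \<theta>' y"
      "\<And>a x. x \<in> bar_cycles G i \<Longrightarrow> \<theta>' (scl a x) = coset I' (mconst a) \<odot>\<^bsub>R'.TorK i\<^esub> \<theta>' x"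
      "\<theta>' 0 = \<zero>\<^bsub>R'.TorK i\<^esub>"
      "\<And>x. x \<in> bar_cycles G i \<Longrightarrow> \<theta>' x = \<zero>\<^bsub>R'.TorK i\<^esub> \<longleftrightarrow> x \<in> bar_boundaries G i" by auto
    show ?thesis
      by (rule vectorspace_dim_eq[where f = \<theta> and g = \<theta>' and Z = "bar_cycles G i"])
        (simp_all add: bar_cycles_closed restrict_scalars_simps 1 2 flip: coset_def)
  qed
  then show ?thesis unfolding poincare_series_def by simp
qed

theorem theorem2p3:
  fixes I I_q :: "('v::finite, 'k::field) mpoly set" and q :: nat
  assumes "monomial_ideal I"
    and "I \<subseteq> ideal_prod mpoly_ring max_ideal max_ideal"
    and "q > 1"
    and "monomial_ideal I_q"
    and "min_gens I_q = {m ^ q | m. m \<in> min_gens I}"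
  shows "poincare_series I = poincare_series I_q"
proof -
  from monomial_ideal_min_gens[OF assms(1)] obtain E where E: "min_gens I = monomial ` E" "I = mspan E" by blast
  from monomial_ideal_min_gens[OF assms(4)] obtain F where F: "min_gens I_q = monomial ` F" "I_q = mspan F" by blast
  \<comment> \<open>The exponent vectors of the minimal generators of I serve both ideals; the
    powers only multiply them by \<open>q\<close>.\<close>
  define G where "G = lookup ` E"
  have pow: "(monomial a :: ('v, 'k) mpoly) ^ q = monomial (pm (\<lambda>v. q * lookup a v))" for a
  proof -
    have "(\<Sum>i<q. a) = pm (\<lambda>v. q * lookup a v)" by (rule poly_mapping_eqI) (simp add: lookup_sum)
    then show ?thesis by (simp add: monomial_power)
  qed
  have "monomial ` F = (monomial ` ((\<lambda>m. pm (\<lambda>v. q * m v)) ` G) :: ('v, 'k) mpoly set)"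
  proof -
    have "{m ^ q | m. m \<in> monomial ` E} = (\<lambda>a. (monomial a :: ('v, 'k) mpoly) ^ q) ` E" by blast
    also have "\<dots> = monomial ` ((\<lambda>m. pm (\<lambda>v. q * m v)) ` G)" by (simp only: pow G_def image_image)
    finally show ?thesis using assms(5) by (simp only: E(1) F(1))
  qed
  then have F_eq: "F = (\<lambda>m. pm (\<lambda>v. q * m v)) ` G" by (simp only: inj_image_eq_iff[OF inj_monomial])
  have E_eq: "E = (\<lambda>m. pm (\<lambda>v. 1 * m v)) ` G" by (simp add: G_def image_image)
  \<comment> \<open>Each generator is a monomial lying in the square of the maximal ideal, hence of
    degree at least 2.\<close>
  have "gens G"
  proof
    fix m assume "m \<in> G"
    then obtain a where a: "a \<in> E" "m = lookup a" unfolding G_def by blast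
    have "(monomial a :: ('v, 'k) mpoly) \<in> I"
      using a(1) by (auto simp: E(2) mspan_def monomial_def intro!: bexI[of _ a] dvdm_refl)
    then have "(monomial a :: ('v, 'k) mpoly) \<in> ideal_prod mpoly_ring max_ideal max_ideal" using assms(2) by blast
    from degree_ideal_prod[OF this, of a] show "2 \<le> (\<Sum>v\<in>UNIV. m v)" by (simp add: a(2) monomial_def)
  qed
  then have "taylor_resolution G 1 I" "taylor_resolution G q I_q"
    using assms(3) E_eq F_eq E(2) F(2) by (simp_all add: taylor_resolution_def taylor_resolution_axioms_def)
  then show ?thesis by (rule poincare_series_scale)
qed

end
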